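(* Consider the discrete-time skew-product $\phi$ on $B\times M$, the compact set $Q\subset M$ with lift $\mathcal{Q}$, and the hyperbolic splitting $T_xM=E^-_{b,x}\oplus E^+_{b,x}$, $(b,x)\in\mathcal{Q}$, described in the context. Assume that the dimensions of the subspaces $E^\pm_{b,x}$ are constant on $\mathcal{Q}$ and that the constant $c$ in property (2) of the splitting equals $1$. Then for every sufficiently small $\varepsilon>0$ there exists $C_\varepsilon\ge1$ such that for all $(b,x)\in\mathcal{Q}$ and all integers $n\ge0$, $$C_\varepsilon^{-1}\ \le\ \operatorname{vol}\left(B^n_b(x,\varepsilon)\right)\cdot\left|\det\left((\mathrm{d}\varphi_{n,b})_x|_{E^+_{b,x}}:E^+_{b,x}\to E^+_{\phi_n(b,x)}\right)\right|\ \le\ C_\varepsilon .$$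
   Context: $B$ is a compact metric space and $M$ a Riemannian manifold with induced distance $\varrho$ and Riemannian volume $\operatorname{vol}$. The discrete-time skew-product is $\phi:\mathbb{Z}\times B\times M\to B\times M$, $\phi_k(b,x)=(\theta^kb,\varphi(k,x,b))$ (a $\mathbb{Z}$-action), where (i) $\theta:B\to B$ and the cocycle $\varphi$ are continuous; (ii) for all $k\in\mathbb{Z}$, $b\in B$ the map $\varphi_{k,b}:M\to M$, $x\mapsto\varphi(k,x,b)$, is a $\mathcal{C}^2$-diffeomorphism and its first and second derivatives depend continuously on $(b,x)$. $Q\subset M$ is a compact set such that for every $x\in Q$ there is $b\in B$ with $\varphi(\mathbb{Z},x,b)\subset Q$, and its lift is $\mathcal{Q}=\{(b,x)\in B\times M:\varphi(\mathbb{Z},x,b)\subset Q\}$ (compact and $\phi$-invariant). For every $(b,x)\in\mathcal{Q}$ there is a splitting $T_xM=E^-_{b,x}\oplus E^+_{b,x}$ with: (1) $(\mathrm{d}\varphi_{k,b})_xE^\pm_{b,x}=E^\pm_{\phi_k(b,x)}$ for all $(b,x)\in\mathcal{Q}$, $k\in\mathbb{Z}$; (2) there are constants $c\ge1$, $\lambda\in(0,1)$ such that for all $k\ge0$ and $(b,x)\in\mathcal{Q}$: $|(\mathrm{d}\varphi_{k,b})_xv|\le c\lambda^k|v|$ for $v\in E^-_{b,x}$ and $|(\mathrm{d}\varphi_{k,b})_xv|\ge c^{-1}\lambda^{-k}|v|$ for $v\in E^+_{b,x}$; (3) the projections $\pi^\pm_{b,x}:T_xM\to E^\pm_{b,x}$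 along $E^\mp_{b,x}$ depend continuously on $(b,x)\in\mathcal{Q}$. The Bowen-metric is $\varrho_{b,n}(x,y)=\max_{0\le k\le n}\varrho(\varphi(k,x,b),\varphi(k,y,b))$, and the Bowen-ball is $B^n_b(x,\varepsilon)=\{y\in M:\varrho_{b,n}(x,y)<\varepsilon\}$. Determinants are taken in absolute value with respect to the inner products induced by the Riemannian metric. *)

theory Defs
  imports "HOL-Analysis.Analysis" "Jordan_Normal_Form.Determinant"
begin

section \<open>Smooth manifolds\<close>

text \<open>\<open>f\<close> is of class \<open>C\<^sup>k\<close> on the open set \<open>S\<close>.\<close>

primrec Ck_on :: "nat \<Rightarrow> 'a::real_normed_vector set \<Rightarrow> ('a \<Rightarrow> 'b::real_normed_vector) \<Rightarrow> bool" where
  "Ck_on 0 S f \<longleftrightarrow> continuous_on S f"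
| "Ck_on (Suc k) S f \<longleftrightarrow>
     (\<forall>x\<in>S. f differentiable (at x)) \<and> (\<forall>v. Ck_on k S (\<lambda>x. frechet_derivative f (at x) v))"

text \<open>A chart is a pair of its domain and its coordinate map. The values of the coordinate map
  outside the domain are irrelevant.\<close>

type_synonym ('m, 'n) chart = "'m set \<times> ('m \<Rightarrow> real^'n)"

definition inv_chart :: "('m, 'n) chart \<Rightarrow> real^'n \<Rightarrow> 'm" where
  "inv_chart c = inv_into (fst c) (snd c)"

definition is_chart :: "('m::topological_space, 'n::finite) chart \<Rightarrow> bool" where
  "is_chart c \<longleftrightarrow> open (fst c) \<and> open (snd c ` fst c) \<and>
     homeomorphism (fst c) (snd c ` fst c) (snd c) (inv_chart c)"

definition smooth_atlas :: "('m::topological_space, 'n::finite) chart set \<Rightarrow> bool" where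
  "smooth_atlas A \<longleftrightarrow> (\<forall>c\<in>A. is_chart c) \<and> (\<Union>c\<in>A. fst c) = UNIV \<and>
     (\<forall>c\<in>A. \<forall>d\<in>A. \<forall>k. Ck_on k (snd c ` (fst c \<inter> fst d)) (snd d \<circ> inv_chart c))"

text \<open>The tangent space \<open>T\<^sub>x M\<close> is modelled on \<open>real^'n\<close>: a vector is identified with its
  components in the preferred chart \<open>chart_at A x\<close>. The maps \<open>to_coords A c x\<close> and
  \<open>from_coords A c x\<close> pass between \<open>T\<^sub>x M\<close> and components in another chart \<open>c\<close> around \<open>x\<close>.
  As \<open>chart_at\<close> need not depend continuously on \<open>x\<close>, smoothness and continuity of fields of
  tensors are always expressed in components with respect to fixed charts.\<close>

definition chart_at :: "('m, 'n) chart set \<Rightarrow> 'm \<Rightarrow> ('m, 'n) chart" where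
  "chart_at A x = (SOME c. c \<in> A \<and> x \<in> fst c)"

definition to_coords ::
  "('m, 'n::finite) chart set \<Rightarrow> ('m, 'n) chart \<Rightarrow> 'm \<Rightarrow> real^'n \<Rightarrow> real^'n" where
  "to_coords A c x =
     frechet_derivative (snd c \<circ> inv_chart (chart_at A x)) (at (snd (chart_at A x) x))"

definition from_coords ::
  "('m, 'n::finite) chart set \<Rightarrow> ('m, 'n) chart \<Rightarrow> 'm \<Rightarrow> real^'n \<Rightarrow> real^'n" where
  "from_coords A c x =
     frechet_derivative (snd (chart_at A x) \<circ> inv_chart c) (at (snd c x))"

definition local_rep :: "('m, 'n) chart \<Rightarrow> ('m, 'n) chart \<Rightarrow> ('m \<Rightarrow> 'm) \<Rightarrow> real^'n \<Rightarrow> real^'n" where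
  "local_rep c d f = snd d \<circ> f \<circ> inv_chart c"

definition tangent_map ::
  "('m, 'n::finite) chart set \<Rightarrow> ('m \<Rightarrow> 'm) \<Rightarrow> 'm \<Rightarrow> real^'n \<Rightarrow> real^'n" where
  "tangent_map A f x =
     frechet_derivative (local_rep (chart_at A x) (chart_at A (f x)) f) (at (snd (chart_at A x) x))"

definition C2_map :: "('m::topological_space, 'n::finite) chart set \<Rightarrow> ('m \<Rightarrow> 'm) \<Rightarrow> bool" where
  "C2_map A f \<longleftrightarrow> continuous_on UNIV f \<and>
     (\<forall>c\<in>A. \<forall>d\<in>A. Ck_on 2 (snd c ` (fst c \<inter> f -` fst d)) (local_rep c d f))"

text \<open>Below, \<open>inv_into UNIV f\<close> is the inverse function of \<open>f\<close>; its usual notation is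
  shadowed by the group inverse of HOL-Algebra.\<close>

definition C2_diffeomorphism ::
  "('m::topological_space, 'n::finite) chart set \<Rightarrow> ('m \<Rightarrow> 'm) \<Rightarrow> bool" where
  "C2_diffeomorphism A f \<longleftrightarrow> bij f \<and> C2_map A f \<and> C2_map A (inv_into UNIV f)"

section \<open>Riemannian manifolds\<close>

type_synonym ('m, 'n) metric_tensor = "'m \<Rightarrow> real^'n \<Rightarrow> real^'n \<Rightarrow> real"

definition metric_in_chart ::
  "('m, 'n::finite) chart set \<Rightarrow> ('m, 'n) metric_tensor \<Rightarrow> ('m, 'n) chart \<Rightarrow>
    real^'n \<Rightarrow> real^'n \<Rightarrow> real^'n \<Rightarrow> real" where
  "metric_in_chart A g c z u v =
     (let x = inv_chart c z in g x (from_coords A c x u) (from_coords A c x v))"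

definition riemannian_metric ::
  "('m, 'n::finite) chart set \<Rightarrow> ('m, 'n) metric_tensor \<Rightarrow> bool" where
  "riemannian_metric A g \<longleftrightarrow>
     (\<forall>x. bilinear (g x) \<and> (\<forall>u v. g x u v = g x v u) \<and> (\<forall>v. v \<noteq> 0 \<longrightarrow> g x v v > 0)) \<and>
     (\<forall>c\<in>A. \<forall>u v k. Ck_on k (snd c ` fst c) (\<lambda>z. metric_in_chart A g c z u v))"

definition tnorm :: "('m, 'n) metric_tensor \<Rightarrow> 'm \<Rightarrow> real^'n \<Rightarrow> real" where
  "tnorm g x v = sqrt (g x v v)"

definition piecewise_C1_curve ::
  "('m::topological_space, 'n::finite) chart set \<Rightarrow> (real \<Rightarrow> 'm) \<Rightarrow> bool" where
  "piecewise_C1_curve A \<gamma> \<longleftrightarrow> continuous_on {0..1} \<gamma> \<and>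
     (\<forall>c\<in>A. \<forall>s t. 0 \<le> s \<and> s < t \<and> t \<le> 1 \<and> \<gamma> ` {s..t} \<subseteq> fst c \<longrightarrow>
        (snd c \<circ> \<gamma>) piecewise_C1_differentiable_on {s..t})"

definition velocity :: "('m, 'n::finite) chart set \<Rightarrow> (real \<Rightarrow> 'm) \<Rightarrow> real \<Rightarrow> real^'n" where
  "velocity A \<gamma> t = vector_derivative (snd (chart_at A (\<gamma> t)) \<circ> \<gamma>) (at t)"

definition curve_length ::
  "('m, 'n::finite) chart set \<Rightarrow> ('m, 'n) metric_tensor \<Rightarrow> (real \<Rightarrow> 'm) \<Rightarrow> ennreal" where
  "curve_length A g \<gamma> = (\<integral>\<^sup>+t\<in>{0..1}. ennreal (tnorm g (\<gamma> t) (velocity A \<gamma> t)) \<partial>lborel)"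

definition riemannian_distance ::
  "('m::topological_space, 'n::finite) chart set \<Rightarrow> ('m, 'n) metric_tensor \<Rightarrow> 'm \<Rightarrow> 'm \<Rightarrow> ennreal" where
  "riemannian_distance A g x y =
     (INF \<gamma>\<in>{\<gamma>. piecewise_C1_curve A \<gamma> \<and> \<gamma> 0 = x \<and> \<gamma> 1 = y}. curve_length A g \<gamma>)"

text \<open>The metric \<open>dist\<close> of the type is the one induced by the Riemannian metric. Finiteness of
  the distance amounts to connectedness of the manifold.\<close>

definition riemannian_manifold ::
  "('m::{metric_space, second_countable_topology}, 'n::finite) chart set \<Rightarrow>
    ('m, 'n) metric_tensor \<Rightarrow> bool" where
  "riemannian_manifold A g \<longleftrightarrow> smooth_atlas A \<and> riemannian_metric A g \<and>
     (\<forall>x y. ennreal (dist x y) = riemannian_distance A g x y)"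

text \<open>The local formula below determines the Borel measure \<open>vol\<close> uniquely, as countably many
  chart domains cover the manifold.\<close>

definition is_riemannian_volume ::
  "('m::topological_space, 'n::finite) chart set \<Rightarrow> ('m, 'n) metric_tensor \<Rightarrow> 'm measure \<Rightarrow> bool" where
  "is_riemannian_volume A g vol \<longleftrightarrow> sets vol = sets borel \<and>
     (\<forall>c\<in>A. \<forall>S\<in>sets borel. S \<subseteq> fst c \<longrightarrow>
        emeasure vol S =
          (\<integral>\<^sup>+z\<in>snd c ` S. ennreal (sqrt (Determinants.det
              (\<chi> i j. metric_in_chart A g c z (axis i 1) (axis j 1)))) \<partial>lborel))"

definition orthonormal_basis ::
  "('m, 'n::finite) metric_tensor \<Rightarrow> 'm \<Rightarrow> (real^'n) set \<Rightarrow> (real^'n) list \<Rightarrow> bool" where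
  "orthonormal_basis g x E es \<longleftrightarrow> span (set es) = E \<and>
     (\<forall>i<length es. \<forall>j<length es. g x (es ! i) (es ! j) = (if i = j then 1 else 0))"

text \<open>Absolute value of the determinant of a linear map \<open>L : E \<rightarrow> F\<close> between subspaces
  \<open>E \<subseteq> T\<^sub>x M\<close> and \<open>F \<subseteq> T\<^sub>y M\<close> of equal dimension, computed from the matrix of \<open>L\<close> in
  orthonormal bases of \<open>E\<close> and \<open>F\<close>; it does not depend on the choice of these bases.\<close>

definition abs_det ::
  "('m, 'n::finite) metric_tensor \<Rightarrow> 'm \<Rightarrow> (real^'n) set \<Rightarrow> 'm \<Rightarrow> (real^'n) set \<Rightarrow>
    (real^'n \<Rightarrow> real^'n) \<Rightarrow> real" where
  "abs_det g x E y F L =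
     (let es = (SOME es. orthonormal_basis g x E es);
          fs = (SOME fs. orthonormal_basis g y F fs)
      in \<bar>Determinant.det (Matrix.mat (length fs) (length es) (\<lambda>(i, j). g y (fs ! i) (L (es ! j))))\<bar>)"

section \<open>Skew products\<close>

definition int_iterate :: "('b \<Rightarrow> 'b) \<Rightarrow> int \<Rightarrow> 'b \<Rightarrow> 'b" where
  "int_iterate \<theta> k = (if 0 \<le> k then \<theta> ^^ nat k else inv_into UNIV \<theta> ^^ nat (- k))"

definition skew :: "('b \<Rightarrow> 'b) \<Rightarrow> (int \<Rightarrow> 'm \<Rightarrow> 'b \<Rightarrow> 'm) \<Rightarrow> int \<Rightarrow> 'b \<times> 'm \<Rightarrow> 'b \<times> 'm" where
  "skew \<theta> \<phi> k = (\<lambda>(b, x). (int_iterate \<theta> k b, \<phi> k x b))"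

definition derivatives_continuous ::
  "('m::topological_space, 'n::finite) chart set \<Rightarrow> ('m \<Rightarrow> 'b::topological_space \<Rightarrow> 'm) \<Rightarrow> bool" where
  "derivatives_continuous A f \<longleftrightarrow>
     (\<forall>c\<in>A. \<forall>d\<in>A. \<forall>u v.
        let W = {(b, z). z \<in> snd c ` fst c \<and> f (inv_chart c z) b \<in> fst d};
            F = (\<lambda>b. local_rep c d (\<lambda>x. f x b))
        in continuous_on W (\<lambda>(b, z). frechet_derivative (F b) (at z) u) \<and>
           continuous_on W (\<lambda>(b, z).
             frechet_derivative (\<lambda>z. frechet_derivative (F b) (at z) u) (at z) v))"

definition skew_product ::
  "('m::topological_space, 'n::finite) chart set \<Rightarrow> ('b::topological_space \<Rightarrow> 'b) \<Rightarrow>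
    (int \<Rightarrow> 'm \<Rightarrow> 'b \<Rightarrow> 'm) \<Rightarrow> bool" where
  "skew_product A \<theta> \<phi> \<longleftrightarrow>
     bij \<theta> \<and> skew \<theta> \<phi> 0 = id \<and> (\<forall>k l. skew \<theta> \<phi> (k + l) = skew \<theta> \<phi> k \<circ> skew \<theta> \<phi> l) \<and>
     continuous_on UNIV \<theta> \<and> (\<forall>k. continuous_on UNIV (\<lambda>(b, x). \<phi> k x b)) \<and>
     (\<forall>k b. C2_diffeomorphism A (\<lambda>x. \<phi> k x b)) \<and>
     (\<forall>k. derivatives_continuous A (\<phi> k))"

definition lift :: "(int \<Rightarrow> 'm \<Rightarrow> 'b \<Rightarrow> 'm) \<Rightarrow> 'm set \<Rightarrow> ('b \<times> 'm) set" where
  "lift \<phi> Q = {(b, x). \<forall>k. \<phi> k x b \<in> Q}"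

section \<open>Hyperbolic splittings\<close>

definition is_splitting :: "'v::real_vector set \<Rightarrow> 'v set \<Rightarrow> bool" where
  "is_splitting E F \<longleftrightarrow> subspace E \<and> subspace F \<and> E \<inter> F = {0} \<and>
     (\<forall>v. \<exists>u\<in>E. \<exists>w\<in>F. v = u + w)"

definition proj_along :: "'v::real_vector set \<Rightarrow> 'v set \<Rightarrow> 'v \<Rightarrow> 'v" where
  "proj_along E F v = (THE u. u \<in> E \<and> v - u \<in> F)"

definition projections_continuous ::
  "('m::topological_space, 'n::finite) chart set \<Rightarrow> ('b::topological_space \<times> 'm) set \<Rightarrow>
    ('b \<times> 'm \<Rightarrow> (real^'n) set) \<Rightarrow> ('b \<times> 'm \<Rightarrow> (real^'n) set) \<Rightarrow> bool" where
  "projections_continuous A \<Q> E F \<longleftrightarrow>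
     (\<forall>c\<in>A. \<forall>v. continuous_on {(b, x) \<in> \<Q>. x \<in> fst c}
        (\<lambda>(b, x). to_coords A c x (proj_along (E (b, x)) (F (b, x)) (from_coords A c x v))))"

definition hyperbolic_splitting ::
  "('m::topological_space, 'n::finite) chart set \<Rightarrow> ('m, 'n) metric_tensor \<Rightarrow>
    ('b::topological_space \<Rightarrow> 'b) \<Rightarrow> (int \<Rightarrow> 'm \<Rightarrow> 'b \<Rightarrow> 'm) \<Rightarrow> ('b \<times> 'm) set \<Rightarrow>
    ('b \<times> 'm \<Rightarrow> (real^'n) set) \<Rightarrow> ('b \<times> 'm \<Rightarrow> (real^'n) set) \<Rightarrow> real \<Rightarrow> real \<Rightarrow> bool" where
  "hyperbolic_splitting A g \<theta> \<phi> \<Q> Em Ep c lam \<longleftrightarrow>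
     (\<forall>p\<in>\<Q>. is_splitting (Em p) (Ep p)) \<and>
     (\<forall>(b, x)\<in>\<Q>. \<forall>k.
        tangent_map A (\<lambda>y. \<phi> k y b) x ` Em (b, x) = Em (skew \<theta> \<phi> k (b, x)) \<and>
        tangent_map A (\<lambda>y. \<phi> k y b) x ` Ep (b, x) = Ep (skew \<theta> \<phi> k (b, x))) \<and>
     1 \<le> c \<and> 0 < lam \<and> lam < 1 \<and>
     (\<forall>(b, x)\<in>\<Q>. \<forall>k::nat.
        (\<forall>v\<in>Em (b, x). tnorm g (\<phi> (int k) x b) (tangent_map A (\<lambda>y. \<phi> (int k) y b) x v)
            \<le> c * lam ^ k * tnorm g x v) \<and>
        (\<forall>v\<in>Ep (b, x). tnorm g (\<phi> (int k) x b) (tangent_map A (\<lambda>y. \<phi> (int k) y b) x v)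
            \<ge> (1 / c) * (1 / lam) ^ k * tnorm g x v)) \<and>
     projections_continuous A \<Q> Em Ep \<and> projections_continuous A \<Q> Ep Em"

section \<open>Bowen balls\<close>

definition bowen_dist :: "(int \<Rightarrow> 'm::metric_space \<Rightarrow> 'b \<Rightarrow> 'm) \<Rightarrow> 'b \<Rightarrow> nat \<Rightarrow> 'm \<Rightarrow> 'm \<Rightarrow> real" where
  "bowen_dist \<phi> b n x y = Max ((\<lambda>k. dist (\<phi> (int k) x b) (\<phi> (int k) y b)) ` {0..n})"

definition bowen_ball :: "(int \<Rightarrow> 'm::metric_space \<Rightarrow> 'b \<Rightarrow> 'm) \<Rightarrow> 'b \<Rightarrow> nat \<Rightarrow> 'm \<Rightarrow> real \<Rightarrow> 'm set" where
  "bowen_ball \<phi> b n x \<epsilon> = {y. bowen_dist \<phi> b n x y < \<epsilon>}"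

end

theory Submission
  imports Defs
begin

text \<open>Along the orbit of a point of the lift, use charts from a finite family composed with linear
  frames that are orthonormal on each of the two subbundles. The frames need not depend continuously on
  the point; by compactness they and the second derivatives of the cocycle are uniformly bounded. In
  these coordinates the cocycle becomes a sequence of maps \<open>f k\<close> fixing \<open>0\<close>, whose derivatives at \<open>0\<close>
  preserve a fixed splitting into coordinate subspaces, contract the first one and expand the second one,
  and a Bowen ball is sandwiched between two sets of points whose first \<open>n\<close> images stay in a small ball.

  Such a set is mapped injectively by the mixed coordinates (initial contracting component, final
  expanding component) onto a set between two balls of fixed radii. The Jacobian determinant of this map
  is, up to a bounded factor, its value at \<open>0\<close>, which is the determinant of the linear cocycle on the
  expanding subspace: the logarithmic distortion of the \<open>k\<close>-th step is of the order of the norm of the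
  \<open>k\<close>-th image, and these norms are summable with a bound independent of \<open>n\<close>.\<close>

text \<open>For a point \<open>y\<close> of the Bowen ball, \<open>(b, y)\<close> need not lie in
  the lift, so there is no splitting at \<open>y\<close> and no expanding determinant there to
  compare with. The mixed coordinates use only the two coordinate subspaces fixed along the
  reference orbit, and their Jacobian makes sense at every nearby \<open>y\<close>. The norms of the
  intermediate images are summable because the contracting component decays forwards from time
  \<open>0\<close> and the expanding one backwards from time \<open>n\<close>, up to small errors,
  while both boundary values are at most the radius. This uses contraction in every single step,
  which is what \<open>c = 1\<close> provides; frames orthonormal on each subbundle preserve the
  rate \<open>lam\<close>. Riemannian distance and coordinate norm are related only through uniform
  continuity of the charts, so two radii are needed to enclose a Bowen ball; the linear parts along
  the reference orbit, hence the determinants, are the same for both. Only the smaller radius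
  depends on \<epsilon>, and with it the constant \<open>C\<close>.\<close>

no_notation vec_index (infixl "$" 100)
no_notation scalar_prod (infix "\<bullet>" 70)


section \<open>Determinants and coordinate projections\<close>

text \<open>The absolute determinant is the factor by which \<open>T\<close> scales volume, and
  \<open>T\<close> maps the unit ball into the ball of radius \<open>M\<close>. Used for the
  perturbations \<open>Q\<close> of the identity and for coordinate changes.\<close>

lemma abs_det_le_power:
  fixes T :: "real^'k::{finite,wellorder} \<Rightarrow> real^'k::_"
  assumes lin: "linear T" and le: "\<And>v. norm (T v) \<le> M * norm v"
  shows "\<bar>Determinants.det (matrix T)\<bar> \<le> M ^ CARD('k)"
proof -
  have "0 \<le> norm (T (axis undefined 1))" by simp
  also have "\<dots> \<le> M" using le[of "axis undefined 1"] by simp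
  finally have M: "0 \<le> M" .
  have sub: "T ` cball 0 1 \<subseteq> cball 0 M"
  proof clarsimp
    fix v :: "real^'k::_" assume "norm v \<le> 1"
    then have "M * norm v \<le> M" using M by (simp add: mult_left_le)
    then show "norm (T v) \<le> M" using le[of v] by simp
  qed
  have "\<bar>Determinants.det (matrix T)\<bar> * measure lebesgue (cball (0::real^'k::_) 1)
      = measure lebesgue (T ` cball 0 1)"
    by (rule measure_linear_image[OF lin, symmetric]) simp
  also have "\<dots> \<le> measure lebesgue (cball (0::real^'k::_) M)"
    by (rule measure_mono_fmeasurable[OF sub])
       (use measurable_linear_image[OF lin, of "cball 0 1"] in auto)
  also have "\<dots> = M ^ CARD('k) * measure lebesgue (cball (0::real^'k::_) 1)"
    using M by (simp add: content_cball)
  finally show ?thesis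
    using content_cball_pos[of 1 "0::real^'k::_"] by simp
qed

text \<open>Dually, \<open>T\<close> is onto and the image of the unit ball contains the ball of
  radius \<open>m\<close>.\<close>

lemma abs_det_ge_power:
  fixes T :: "real^'k::{finite,wellorder} \<Rightarrow> real^'k::_"
  assumes lin: "linear T" and m: "0 < m" and ge: "\<And>v. m * norm v \<le> norm (T v)"
  shows "m ^ CARD('k) \<le> \<bar>Determinants.det (matrix T)\<bar>"
proof -
  have "inj T"
    unfolding linear_injective_0[OF lin]
  proof (intro allI impI)
    fix v assume "T v = 0"
    then show "v = 0" using ge[of v] m by (simp add: mult_le_0_iff)
  qed
  then have surj: "surj T" using lin linear_injective_imp_surjective by blast
  have sub: "cball 0 m \<subseteq> T ` cball 0 1"
  proof
    fix w :: "real^'k::_" assume w: "w \<in> cball 0 m"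
    obtain v where v: "w = T v" using surj by blast
    have "m * norm v \<le> m * 1" using ge[of v] w v by simp
    then have "norm v \<le> 1" using m by (simp only: mult_le_cancel_left_pos)
    then show "w \<in> T ` cball 0 1" using v by simp
  qed
  have "m ^ CARD('k) * measure lebesgue (cball (0::real^'k::_) 1) = measure lebesgue (cball (0::real^'k::_) m)"
    using m by (simp add: content_cball)
  also have "\<dots> \<le> measure lebesgue (T ` cball 0 1)"
    by (rule measure_mono_fmeasurable[OF sub])
       (use measurable_linear_image[OF lin, of "cball 0 1"] in auto)
  also have "\<dots> = \<bar>Determinants.det (matrix T)\<bar> * measure lebesgue (cball (0::real^'k::_) 1)"
    by (rule measure_linear_image[OF lin]) simp
  finally show ?thesis
    using content_cball_pos[of 1 "0::real^'k::_"] by simp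
qed

lemma matrix_det_compose:
  fixes S T :: "real^'k::finite \<Rightarrow> real^'k"
  assumes "linear S" "linear T"
  shows "\<bar>Determinants.det (matrix (S \<circ> T))\<bar> = \<bar>Determinants.det (matrix S)\<bar> * \<bar>Determinants.det (matrix T)\<bar>"
  using assms by (simp add: matrix_compose Determinants.det_mul abs_mult)

text \<open>Both summands of the splitting stay inside one space: \<open>- I\<close> labels the
  contracting and \<open>I\<close> the expanding directions. Maps in mixed coordinates are then
  endomorphisms and have a determinant, also when one summand is trivial.\<close>

definition cproj :: "'k set \<Rightarrow> real^'k \<Rightarrow> real^'k::_" where
  "cproj I v = (\<chi> i. if i \<in> I then v $ i else 0)"

lemma linear_cproj: "linear (cproj I)"
  by (rule linearI) (auto simp: cproj_def Finite_Cartesian_Product.vec_eq_iff)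

lemma cproj_add_compl: "cproj (- I) v + cproj I v = v"
  by (auto simp: cproj_def Finite_Cartesian_Product.vec_eq_iff)

lemma cproj_cproj [simp]: "cproj I (cproj J v) = cproj (I \<inter> J) v"
  by (auto simp: cproj_def Finite_Cartesian_Product.vec_eq_iff)

lemma cproj_empty [simp]: "cproj {} v = 0"
  by (auto simp: cproj_def Finite_Cartesian_Product.vec_eq_iff)

lemma norm_cproj_le: "norm (cproj I v) \<le> norm v" for v :: "real^'k::finite"
  by (rule norm_le_componentwise_cart) (simp add: cproj_def)

lemmas cproj_simps = linear_0[OF linear_cproj] linear_add[OF linear_cproj]
  linear_diff[OF linear_cproj] linear_cmul[OF linear_cproj]

section \<open>Volume of the set of points with small orbits\<close>

primrec orbit :: "(nat \<Rightarrow> 'a \<Rightarrow> 'a) \<Rightarrow> nat \<Rightarrow> 'a \<Rightarrow> 'a" where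
  "orbit f 0 y = y"
| "orbit f (Suc k) y = f k (orbit f k y)"

text \<open>\<open>commute\<close>, \<open>contract\<close> and \<open>expand\<close> say that the
  linear parts at the fixed point \<open>0\<close> are block diagonal with one-step rate
  \<open>lam\<close>; \<open>lip\<close> is what remains of the bound on second derivatives. The
  smallness of \<open>r\<close> serves twice: with \<open>q = (1 - lam) / 2\<close> it gives
  \<open>K * r \<le> q / 2\<close>, the error allowed in the a priori estimate, and
  \<open>4 * K * r / q\<^sup>2 \<le> 1 / 3\<close>, which bounds the total distortion.\<close>

locale hyperbolic_sequence =
  fixes I :: "'k::{finite,wellorder} set" and lam K r :: real
    and f :: "nat \<Rightarrow> real^'k::_ \<Rightarrow> real^'k::_" and A :: "nat \<Rightarrow> real^'k::_ \<Rightarrow> real^'k::_ \<Rightarrow> real^'k::_"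
  assumes lam: "0 < lam" "lam < 1" and r: "0 < r" and K: "0 \<le> K"
    and small: "12 * K * r \<le> ((1 - lam) / 2)\<^sup>2"
    and f0: "f k 0 = 0"
    and deriv: "norm y < r \<Longrightarrow> (f k has_derivative A k y) (at y)"
    and commute: "cproj I (A k 0 v) = A k 0 (cproj I v)"
    and contract: "norm (A k 0 (cproj (- I) v)) \<le> lam * norm (cproj (- I) v)"
    and expand: "norm (cproj I v) \<le> lam * norm (A k 0 (cproj I v))"
    and lip: "norm y < r \<Longrightarrow> norm (A k y v - A k 0 v) \<le> K * norm y * norm v"
begin

definition q where "q = (1 - lam) / 2"

lemma q: "0 < q" "q < 1 / 2" using lam by (auto simp: q_def)

lemma Kr: "K * r \<le> q / 2"
proof -
  have "q\<^sup>2 \<le> q" using q by (simp add: power2_eq_square mult_left_le)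
  then show ?thesis using small q unfolding q_def[symmetric] by linarith
qed

lemma linear_A: "norm y < r \<Longrightarrow> linear (A k y)"
  using deriv has_derivative_linear by blast

lemma linear_A0: "linear (A k 0)" using linear_A[of 0] r by simp

lemma commute_compl: "cproj (- I) (A k 0 v) = A k 0 (cproj (- I) v)"
  by (metis (no_types, lifting) add_diff_cancel_right' commute cproj_add_compl linear_diff linear_A0)

text \<open>A single a priori estimate for approximate orbits of the linear parts. Applied to differences of
  orbits it gives injectivity of the mixed coordinates, applied to orbits the summability of their
  norms, and applied to derivatives the bounds on the inverse of the Jacobian matrix.\<close>

lemma sequence_bound:
  assumes "\<And>j. j < n \<Longrightarrow> norm (v (Suc j) - A j 0 (v j)) \<le> q / 2 * norm (v j)"
  shows "q * (\<Sum>j\<le>n. norm (v j)) \<le> norm (cproj (- I) (v 0)) + norm (cproj I (v n))"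
proof -
  define a where "a j = norm (cproj (- I) (v j))" for j
  define b where "b j = norm (cproj I (v j))" for j
  define e where "e j = v (Suc j) - A j 0 (v j)" for j
  have ab: "norm (v j) \<le> a j + b j" for j
    unfolding a_def b_def by (metis cproj_add_compl norm_triangle_ineq)
  have nn: "0 \<le> a j" "0 \<le> b j" for j by (auto simp: a_def b_def)
  have e: "norm (e j) \<le> q / 2 * (a j + b j)" if "j < n" for j
  proof -
    have "norm (e j) \<le> q / 2 * norm (v j)" using assms[OF that] by (simp add: e_def)
    also have "\<dots> \<le> q / 2 * (a j + b j)" using ab[of j] q by (intro mult_left_mono) auto
    finally show ?thesis .
  qed
  have vS: "v (Suc j) = A j 0 (v j) + e j" for j by (simp add: e_def)
  have a: "a (Suc j) \<le> lam * a j + q / 2 * (a j + b j)" if "j < n" for j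
  proof -
    have "cproj (- I) (v (Suc j)) = A j 0 (cproj (- I) (v j)) + cproj (- I) (e j)"
      by (simp add: vS cproj_simps commute_compl)
    then have "a (Suc j) \<le> norm (A j 0 (cproj (- I) (v j))) + norm (cproj (- I) (e j))"
      unfolding a_def by (metis norm_triangle_ineq)
    then show ?thesis
      using contract[of j "v j"] norm_cproj_le[of "- I" "e j"] e[OF that] unfolding a_def by linarith
  qed
  \<comment> \<open>The expanding component is estimated backwards in time, so that its boundary
    term is the value at time \<open>n\<close>.\<close>
  have b: "b j \<le> lam * b (Suc j) + q / 2 * (a j + b j)" if "j < n" for j
  proof -
    have "A j 0 (cproj I (v j)) = cproj I (v (Suc j)) - cproj I (e j)"
      by (simp add: vS cproj_simps commute)
    then have "norm (A j 0 (cproj I (v j))) \<le> b (Suc j) + norm (e j)"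
      using norm_triangle_ineq4[of "cproj I (v (Suc j))" "cproj I (e j)"]
        norm_cproj_le[of I "e j"] by (simp add: b_def)
    then have "lam * norm (A j 0 (cproj I (v j))) \<le> lam * b (Suc j) + lam * norm (e j)"
      using lam by (simp flip: distrib_left)
    moreover have "lam * norm (e j) \<le> norm (e j)"
      using lam by (simp add: mult_left_le_one_le)
    ultimately show ?thesis
      using expand[of "v j" j] e[OF that] unfolding b_def by linarith
  qed
  define s where "s = (\<Sum>j\<le>n. a j + b j)"
  have s: "s = (\<Sum>j\<le>n. a j) + (\<Sum>j\<le>n. b j)" by (simp add: s_def sum.distrib)
  have le_s: "(\<Sum>j<n. a j + b j) \<le> s"
    unfolding s_def by (rule sum_mono2) (use nn in \<open>auto intro: add_nonneg_nonneg\<close>)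
  have shift: "(\<Sum>j\<le>n. h j) = h 0 + (\<Sum>j<n. h (Suc j))" for h :: "nat \<Rightarrow> real"
    by (induction n) auto
  have "(\<Sum>j\<le>n. a j) = a 0 + (\<Sum>j<n. a (Suc j))"
    by (rule shift)
  also have "\<dots> \<le> a 0 + (\<Sum>j<n. lam * a j + q / 2 * (a j + b j))"
    using a by (intro add_left_mono sum_mono) auto
  also have "\<dots> = a 0 + lam * (\<Sum>j<n. a j) + q / 2 * (\<Sum>j<n. a j + b j)"
    by (simp only: sum_distrib_left add.assoc
        sum.distrib[of "\<lambda>j. lam * a j" "\<lambda>j. q / 2 * (a j + b j)"])
  also have "\<dots> \<le> a 0 + lam * (\<Sum>j\<le>n. a j) + q / 2 * s"
    using le_s q lam nn by (intro add_mono mult_left_mono sum_mono2) auto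
  finally have A: "(\<Sum>j\<le>n. a j) \<le> a 0 + lam * (\<Sum>j\<le>n. a j) + q / 2 * s" .
  have "(\<Sum>j\<le>n. b j) = b n + (\<Sum>j<n. b j)"
    by (simp flip: lessThan_Suc_atMost)
  also have "\<dots> \<le> b n + (\<Sum>j<n. lam * b (Suc j) + q / 2 * (a j + b j))"
    using b by (intro add_left_mono sum_mono) auto
  also have "\<dots> = b n + lam * (\<Sum>j<n. b (Suc j)) + q / 2 * (\<Sum>j<n. a j + b j)"
    by (simp only: sum_distrib_left add.assoc
        sum.distrib[of "\<lambda>j. lam * b (Suc j)" "\<lambda>j. q / 2 * (a j + b j)"])
  finally have B: "(\<Sum>j\<le>n. b j) \<le> b n + lam * (\<Sum>j<n. b (Suc j)) + q / 2 * (\<Sum>j<n. a j + b j)" .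
  have "(\<Sum>j<n. b (Suc j)) \<le> (\<Sum>j\<le>n. b j)"
    using nn by (simp add: shift)
  then have "lam * (\<Sum>j<n. b (Suc j)) \<le> lam * (\<Sum>j\<le>n. b j)" using lam by simp
  then have B: "(\<Sum>j\<le>n. b j) \<le> b n + lam * (\<Sum>j\<le>n. b j) + q / 2 * s"
    using B mult_left_mono[OF le_s, of "q/2"] q by linarith
  \<comment> \<open>Here \<open>1 - lam = 2 * q\<close>, and the two error terms together cost
    \<open>q * s\<close>; adding the estimates leaves \<open>q * s\<close> on the left.\<close>
  have "q * s \<le> a 0 + b n"
    using A B by (simp add: s q_def field_simps)
  moreover have "(\<Sum>j\<le>n. norm (v j)) \<le> s"
    unfolding s_def by (rule sum_mono) (rule ab)
  then have "q * (\<Sum>j\<le>n. norm (v j)) \<le> q * s" using q by simp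
  ultimately show ?thesis unfolding a_def b_def by linarith
qed

text \<open>Mean value inequality for \<open>f k - A k 0\<close> on the convex ball of radius
  \<open>r\<close>; the constant \<open>q / 2\<close> is the error that
  \<open>sequence_bound\<close> tolerates. Two arbitrary points are allowed because injectivity
  compares two orbits.\<close>

lemma nonlinear_bound:
  assumes "norm y < r" "norm y' < r"
  shows "norm (f k y - f k y' - A k 0 (y - y')) \<le> q / 2 * norm (y - y')"
proof -
  have "norm ((f k y - A k 0 y) - (f k y' - A k 0 y')) \<le> q / 2 * norm (y - y')"
  proof (rule differentiable_bound[where S = "ball 0 r" and f = "\<lambda>y. f k y - A k 0 y"
        and f' = "\<lambda>y v. A k y v - A k 0 v"])
    fix x :: "real^'k::_" assume "x \<in> ball 0 r"
    then have x: "norm x < r" by simp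
    show "((\<lambda>y. f k y - A k 0 y) has_derivative (\<lambda>v. A k x v - A k 0 v)) (at x within ball 0 r)"
      by (intro has_derivative_diff has_derivative_at_withinI[OF deriv[OF x]]
          linear_imp_has_derivative linear_A0)
    have "norm (A k x v - A k 0 v) \<le> q / 2 * norm v" for v
    proof -
      have "K * norm x \<le> q / 2" using Kr x K mult_left_mono[of "norm x" r K] by linarith
      then have "K * norm x * norm v \<le> q / 2 * norm v" by (rule mult_right_mono) simp
      then show ?thesis using lip[OF x, of k v] by linarith
    qed
    then show "onorm (\<lambda>v. A k x v - A k 0 v) \<le> q / 2" by (rule onorm_le)
  qed (use assms in auto)
  then show ?thesis by (simp add: linear_diff[OF linear_A0] algebra_simps)
qed

section \<open>Orbits, their derivatives and the mixed coordinates\<close>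

primrec dorbit :: "nat \<Rightarrow> real^'k::_ \<Rightarrow> real^'k::_ \<Rightarrow> real^'k::_" where
  "dorbit 0 y v = v"
| "dorbit (Suc k) y v = A k (orbit f k y) (dorbit k y v)"

definition W :: "nat \<Rightarrow> (real^'k::_) set" where
  "W n = {y. \<forall>k\<le>n. norm (orbit f k y) < r}"

text \<open>Mixed coordinates: the contracting component of the initial point and the expanding component of
  the final point. In these coordinates the set \<open>W n\<close> of points with small orbits is comparable to a ball
  of radius independent of \<open>n\<close>.\<close>

definition mixed :: "nat \<Rightarrow> real^'k::_ \<Rightarrow> real^'k::_" where
  "mixed n y = cproj (- I) y + cproj I (orbit f n y)"

definition dmixed :: "nat \<Rightarrow> real^'k::_ \<Rightarrow> real^'k::_ \<Rightarrow> real^'k::_" where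
  "dmixed n y v = cproj (- I) v + cproj I (dorbit n y v)"

lemma orbit_zero [simp]: "orbit f k 0 = 0"
  by (induction k) (auto simp: f0)

lemma zero_in_W: "0 \<in> W n"
  using r by (simp add: W_def)

text \<open>The first \<open>k\<close> maps are evaluated only at the orbit points with times
  \<open>0\<close> to \<open>k - 1\<close>, so membership in \<open>W n\<close> suffices up to time
  \<open>Suc n\<close>. This extra step carries the induction in \<open>open_W\<close>.\<close>

lemma deriv_orbit:
  assumes "y \<in> W n" "k \<le> Suc n"
  shows "(orbit f k has_derivative dorbit k y) (at y)"
  using assms(2)
proof (induction k)
  case 0
  have "orbit f 0 = (\<lambda>y. y)" "dorbit 0 y = (\<lambda>y. y)" by (rule ext, simp)+
  then show ?case by (simp only: has_derivative_ident)
next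
  case (Suc k)
  then have "norm (orbit f k y) < r" using assms(1) by (auto simp: W_def)
  then have "((\<lambda>y. f k (orbit f k y)) has_derivative (\<lambda>v. A k (orbit f k y) (dorbit k y v))) (at y)"
    using has_derivative_compose[of "orbit f k" "dorbit k y" y UNIV, OF _ deriv] Suc by simp
  moreover have "orbit f (Suc k) = (\<lambda>y. f k (orbit f k y))"
    "dorbit (Suc k) y = (\<lambda>v. A k (orbit f k y) (dorbit k y v))" by (rule ext, simp)+
  ultimately show ?case by (simp only:)
qed

lemma continuous_orbit: "k \<le> Suc n \<Longrightarrow> continuous_on (W n) (orbit f k)"
  by (rule has_derivative_continuous_on) (rule has_derivative_at_withinI[OF deriv_orbit])

lemma open_W: "open (W n)"
proof (induction n)
  case 0
  have "W 0 = ball 0 r" by (auto simp: W_def)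
  then show ?case by simp
next
  case (Suc n)
  have "W (Suc n) = W n \<inter> orbit f (Suc n) -` ball 0 r"
    by (auto simp: W_def le_Suc_eq)
  then show ?case
    using continuous_open_preimage[OF continuous_orbit[of "Suc n" n] Suc] by auto
qed

lemma deriv_mixed:
  assumes "y \<in> W n" "k \<le> Suc n"
  shows "(mixed k has_derivative dmixed k y) (at y)"
proof -
  have c: "(cproj J has_derivative cproj J) (at x)" for J and x :: "real^'k::_"
    by (rule linear_imp_has_derivative[OF linear_cproj])
  have "((\<lambda>y. cproj (- I) y + cproj I (orbit f k y)) has_derivative
      (\<lambda>v. cproj (- I) v + cproj I (dorbit k y v))) (at y)"
    by (intro has_derivative_add c has_derivative_compose[OF deriv_orbit[OF assms] c])
  moreover have "mixed k = (\<lambda>y. cproj (- I) y + cproj I (orbit f k y))"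
    "dmixed k y = (\<lambda>v. cproj (- I) v + cproj I (dorbit k y v))"
    by (rule ext, simp add: mixed_def dmixed_def)+
  ultimately show ?thesis by (simp only:)
qed

lemma linear_dmixed: "y \<in> W n \<Longrightarrow> k \<le> Suc n \<Longrightarrow> linear (dmixed k y)"
  by (rule has_derivative_linear[OF deriv_mixed])

lemma orbit_sum_bound:
  assumes "y \<in> W n"
  shows "q * (\<Sum>j\<le>n. norm (orbit f j y)) \<le> norm (cproj (- I) y) + norm (cproj I (orbit f n y))"
proof -
  have "norm (orbit f (Suc j) y - A j 0 (orbit f j y)) \<le> q / 2 * norm (orbit f j y)" if "j < n" for j
    using nonlinear_bound[of "orbit f j y" 0 j] r that assms by (auto simp: W_def f0)
  from sequence_bound[of n "\<lambda>j. orbit f j y", OF this] show ?thesis by simp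
qed

text \<open>As \<open>K * r \<le> q / 2\<close>, the derivative along an orbit is an approximate
  orbit of the linear parts. Every intermediate vector is therefore controlled by the two boundary
  components, which together form the value of \<open>dmixed\<close>.\<close>

lemma dorbit_bound:
  assumes y: "y \<in> W n" and "k \<le> Suc n" "j \<le> k"
  shows "q * norm (dorbit j y v) \<le> norm (cproj (- I) v) + norm (cproj I (dorbit k y v))"
proof -
  have "norm (dorbit (Suc j) y v - A j 0 (dorbit j y v)) \<le> q / 2 * norm (dorbit j y v)" if "j < k" for j
  proof -
    have n: "norm (orbit f j y) < r" using that assms by (auto simp: W_def)
    have "K * norm (orbit f j y) \<le> q / 2" using Kr n K mult_left_mono[of "norm (orbit f j y)" r K] by linarith
    then have "K * norm (orbit f j y) * norm (dorbit j y v) \<le> q / 2 * norm (dorbit j y v)"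
      by (rule mult_right_mono) simp
    then show ?thesis using lip[OF n, of j "dorbit j y v"] by simp
  qed
  from sequence_bound[of k "\<lambda>j. dorbit j y v", OF this]
  have "q * (\<Sum>j\<le>k. norm (dorbit j y v)) \<le> norm (cproj (- I) v) + norm (cproj I (dorbit k y v))"
    by simp
  moreover have "norm (dorbit j y v) \<le> (\<Sum>j\<le>k. norm (dorbit j y v))"
    using assms by (intro member_le_sum) auto
  then have "q * norm (dorbit j y v) \<le> q * (\<Sum>j\<le>k. norm (dorbit j y v))" using q by simp
  ultimately show ?thesis by linarith
qed

lemma cproj_mixed [simp]:
  "cproj (- I) (mixed n y) = cproj (- I) y" "cproj I (mixed n y) = cproj I (orbit f n y)"
  "cproj (- I) (dmixed n y v) = cproj (- I) v" "cproj I (dmixed n y v) = cproj I (dorbit n y v)"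
  by (simp_all add: mixed_def dmixed_def cproj_simps)

lemma dorbit_le_dmixed:
  assumes "y \<in> W n" "k \<le> Suc n" "j \<le> k"
  shows "q * norm (dorbit j y v) \<le> 2 * norm (dmixed k y v)"
  using dorbit_bound[OF assms, of v] norm_cproj_le[of I "dmixed k y v"]
    norm_cproj_le[of "- I" "dmixed k y v"] by simp

text \<open>The difference of two orbits with equal mixed coordinates is an approximate orbit of the
  linear parts whose boundary components vanish.\<close>

lemma inj_mixed: "inj_on (mixed n) (W n)"
proof (rule inj_onI)
  fix y y' assume y: "y \<in> W n" "y' \<in> W n" and eq: "mixed n y = mixed n y'"
  have 1: "cproj (- I) y = cproj (- I) y'" and 2: "cproj I (orbit f n y) = cproj I (orbit f n y')"
    using arg_cong[OF eq, of "cproj (- I)"] arg_cong[OF eq, of "cproj I"] by simp_all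
  have "norm ((orbit f (Suc j) y - orbit f (Suc j) y') - A j 0 (orbit f j y - orbit f j y'))
      \<le> q / 2 * norm (orbit f j y - orbit f j y')" if "j < n" for j
    using nonlinear_bound[of "orbit f j y" "orbit f j y'" j] that y by (auto simp: W_def)
  from sequence_bound[of n "\<lambda>j. orbit f j y - orbit f j y'", OF this]
  have "q * (\<Sum>j\<le>n. norm (orbit f j y - orbit f j y')) \<le> 0" by (simp add: cproj_simps 1 2)
  then have "(\<Sum>j\<le>n. norm (orbit f j y - orbit f j y')) \<le> 0" using q by (simp add: mult_le_0_iff)
  moreover have "norm (orbit f 0 y - orbit f 0 y') \<le> (\<Sum>j\<le>n. norm (orbit f j y - orbit f j y'))"
    by (intro member_le_sum) auto
  ultimately have "norm (orbit f 0 y - orbit f 0 y') \<le> 0" by linarith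
  then show "y = y'" by simp
qed

section \<open>Distortion of the Jacobian determinant\<close>

definition G :: "nat \<Rightarrow> real^'k::_ \<Rightarrow> real^'k::_" where
  "G k u = cproj (- I) u + cproj I (A k 0 u)"

lemma linear_G: "linear (G k)"
  unfolding G_def by (intro linearI) (auto simp: cproj_simps linear_add[OF linear_A0] linear_cmul[OF linear_A0] algebra_simps)

lemma cproj_G [simp]: "cproj (- I) (G k u) = cproj (- I) u" "cproj I (G k u) = A k 0 (cproj I u)"
  by (simp add: G_def cproj_simps, simp add: G_def cproj_simps commute)

lemma inj_G: "inj (G k)"
  unfolding linear_injective_0[OF linear_G]
proof (intro allI impI)
  fix u assume "G k u = 0"
  then have "cproj (- I) (G k u) = 0" "cproj I (G k u) = 0" by (simp_all add: cproj_simps)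
  then have "cproj (- I) u = 0" "cproj I u = 0" using expand[of u k] by simp_all
  then show "u = 0" using cproj_add_compl[of I u] by simp
qed

text \<open>At the origin the expanding block evolves by itself, so the mixed derivative grows by
  exactly \<open>G k\<close>. The determinant of \<open>G k\<close> is thus the reference factor
  with which the growth at other points is compared.\<close>

lemma dmixed_zero_Suc: "dmixed (Suc k) 0 = G k \<circ> dmixed k 0"
proof
  fix v
  have "(G k \<circ> dmixed k 0) v = cproj (- I) (dmixed k 0 v) + A k 0 (cproj I (dmixed k 0 v))"
    by (simp add: G_def commute)
  then show "dmixed (Suc k) 0 v = (G k \<circ> dmixed k 0) v"
    by (simp add: dmixed_def[of "Suc k"] commute)
qed

lemma dmixed_lower:
  assumes "y \<in> W n" "k \<le> Suc n"
  shows "q / 2 * norm v \<le> norm (dmixed k y v)"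
  using dorbit_le_dmixed[OF assms, of 0 v] by simp

lemma bij_dmixed:
  assumes "y \<in> W n" "k \<le> Suc n"
  shows "bij (dmixed k y)"
proof -
  have "inj (dmixed k y)"
    unfolding linear_injective_0[OF linear_dmixed[OF assms]]
  proof (intro allI impI)
    fix v assume "dmixed k y v = 0"
    then show "v = 0" using dmixed_lower[OF assms, of v] q by (simp add: mult_le_0_iff)
  qed
  then show ?thesis
    using linear_injective_imp_surjective linear_dmixed[OF assms] by (auto simp: bij_def)
qed

text \<open>As \<open>A k 0\<close> is block diagonal, the deviation of \<open>Q\<close> from the identity is of the order of \<open>A k y - A k 0\<close>
  along the orbit; no control on the inclination of the images of the expanding directions is needed.\<close>

lemma dmixed_Suc:
  assumes y: "y \<in> W n" and k: "k \<le> n"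
  obtains Q where "linear Q" "dmixed (Suc k) y = G k \<circ> Q \<circ> dmixed k y"
    "\<And>u. norm (Q u - u) \<le> 2 * K / q * norm (orbit f k y) * norm u"
proof -
  obtain G' where G': "linear G'" and G2: "\<And>v. G k (G' v) = v"
    using linear_injective_isomorphism[OF linear_G inj_G] by metis
  have lin: "linear (dmixed k y)" "linear (dmixed (Suc k) y)" using linear_dmixed[OF y] k by auto
  have "inj (dmixed k y)" using bij_dmixed y k bij_is_inj by (meson le_Suc_eq)
  then obtain D' where D': "linear D'" and D'2: "\<And>v. D' (dmixed k y v) = v" "\<And>v. dmixed k y (D' v) = v"
    using linear_injective_isomorphism[OF lin(1)] by metis
  \<comment> \<open>\<open>Q\<close> solves the desired factorisation: \<open>G k\<close> is
    stripped off on the left and \<open>dmixed k y\<close> on the right.\<close>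
  define Q where "Q = G' \<circ> dmixed (Suc k) y \<circ> D'"
  show ?thesis
  proof
    show "linear Q" unfolding Q_def by (rule linear_compose[OF D' linear_compose[OF lin(2) G'], unfolded o_assoc])
    show "dmixed (Suc k) y = G k \<circ> Q \<circ> dmixed k y"
      by (rule ext) (simp add: Q_def G2 D'2)
    fix u
    define v where "v = D' u"
    have u: "u = dmixed k y v" by (simp add: v_def D'2)
    define e where "e = Q u - u"
    have "G k e = dmixed (Suc k) y v - G k (dmixed k y v)"
      by (simp add: e_def linear_diff[OF linear_G] Q_def u D'2 G2)
    \<comment> \<open>The contracting component is the initial one for both maps and cancels; the
      expanding one comes from the difference of two derivatives of \<open>f k\<close>, which
      \<open>lip\<close> bounds.\<close>
    then have Ge: "cproj (- I) (G k e) = 0"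
      "cproj I (G k e) = cproj I (A k (orbit f k y) (dorbit k y v) - A k 0 (dorbit k y v))"
      by (simp_all add: cproj_simps commute)
    have n: "norm (orbit f k y) < r" using y k by (auto simp: W_def)
    \<comment> \<open>On the expanding subspace the inverse of \<open>A k 0\<close> contracts, so
      nothing is lost in passing from \<open>G k e\<close> back to \<open>e\<close>.\<close>
    have "e = cproj I e" using Ge(1) cproj_add_compl[of I e] by simp
    then have "norm e \<le> lam * norm (A k 0 (cproj I e))" using expand[of e k] by simp
    also have "\<dots> \<le> norm (A k 0 (cproj I e))" using lam by (simp add: mult_left_le_one_le)
    also have "\<dots> \<le> norm (A k (orbit f k y) (dorbit k y v) - A k 0 (dorbit k y v))"
      using Ge(2) norm_cproj_le by simp
    also have "\<dots> \<le> K * norm (orbit f k y) * norm (dorbit k y v)" by (rule lip[OF n])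
    also have "\<dots> \<le> K * norm (orbit f k y) * (2 / q * norm u)"
      using dorbit_le_dmixed[OF y, of k k v] k q K by (intro mult_left_mono) (auto simp: u field_simps)
    finally show "norm (Q u - u) \<le> 2 * K / q * norm (orbit f k y) * norm u"
      by (simp add: e_def mult_ac)
  qed
qed

text \<open>Determinants multiply along the factorisation of \<open>dmixed_Suc\<close>: the factors
  from \<open>G k\<close> are the same at \<open>y\<close> and at \<open>0\<close>, and the
  determinant of \<open>Q\<close> lies between powers of \<open>1 - t k\<close> and
  \<open>1 + t k\<close>.\<close>

lemma distortion_product:
  assumes y: "y \<in> W n" and k: "k \<le> Suc n"
    and t: "\<And>j. t j = 2 * K / q * norm (orbit f j y)" "\<And>j. j \<le> n \<Longrightarrow> t j < 1"
  shows "(\<Prod>j<k. 1 - t j) ^ CARD('k) * \<bar>Determinants.det (matrix (dmixed k 0))\<bar>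
      \<le> \<bar>Determinants.det (matrix (dmixed k y))\<bar>"
    and "\<bar>Determinants.det (matrix (dmixed k y))\<bar>
      \<le> (\<Prod>j<k. 1 + t j) ^ CARD('k) * \<bar>Determinants.det (matrix (dmixed k 0))\<bar>"
proof -
  have t0: "0 \<le> t j" for j using t(1) K q by simp
  have *: "(\<Prod>j<k. 1 - t j) ^ CARD('k) * \<bar>Determinants.det (matrix (dmixed k 0))\<bar>
      \<le> \<bar>Determinants.det (matrix (dmixed k y))\<bar> \<and>
      \<bar>Determinants.det (matrix (dmixed k y))\<bar>
      \<le> (\<Prod>j<k. 1 + t j) ^ CARD('k) * \<bar>Determinants.det (matrix (dmixed k 0))\<bar>"
    using k
  proof (induction k)
    case 0
    have "dmixed 0 0 = dmixed 0 y" by (rule ext) (simp add: dmixed_def)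
    then show ?case by simp
  next
    case (Suc k)
    then have k: "k \<le> n" by simp
    let ?d = "\<lambda>T. \<bar>Determinants.det (matrix T)\<bar>"
    obtain Q where Q: "linear Q" "dmixed (Suc k) y = G k \<circ> Q \<circ> dmixed k y"
      "\<And>u. norm (Q u - u) \<le> t k * norm u"
      using dmixed_Suc[OF y k] t(1) by metis
    have "?d Q \<le> (1 + t k) ^ CARD('k)"
    proof (rule abs_det_le_power[OF Q(1)])
      fix v show "norm (Q v) \<le> (1 + t k) * norm v"
        using Q(3)[of v] norm_triangle_ineq2[of "Q v" v] by (simp add: algebra_simps)
    qed
    moreover have "(1 - t k) ^ CARD('k) \<le> ?d Q"
    proof (rule abs_det_ge_power[OF Q(1)])
      fix v show "(1 - t k) * norm v \<le> norm (Q v)"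
        using Q(3)[of v] norm_triangle_ineq2[of v "Q v"] by (simp add: algebra_simps norm_minus_commute)
    qed (use t(2)[OF k] in simp)
    ultimately have dQ: "(1 - t k) ^ CARD('k) \<le> ?d Q" "?d Q \<le> (1 + t k) ^ CARD('k)" by auto
    have lin: "linear (dmixed k y)" "linear (dmixed k 0)"
      using linear_dmixed y zero_in_W k by (meson le_Suc_eq)+
    have eq: "?d (dmixed (Suc k) y) = ?d (G k) * ?d Q * ?d (dmixed k y)"
      unfolding Q(2) using lin Q(1) linear_G
      by (simp add: matrix_det_compose linear_compose)
    have eq0: "?d (dmixed (Suc k) 0) = ?d (G k) * ?d (dmixed k 0)"
      unfolding dmixed_zero_Suc by (intro matrix_det_compose linear_G lin)
    have IH: "(\<Prod>j<k. 1 - t j) ^ CARD('k) * ?d (dmixed k 0) \<le> ?d (dmixed k y)"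
      "?d (dmixed k y) \<le> (\<Prod>j<k. 1 + t j) ^ CARD('k) * ?d (dmixed k 0)"
      using Suc by auto
    have p0: "0 \<le> (\<Prod>j<k. 1 - t j)"
      using t(2) k by (intro prod_nonneg) (simp add: less_imp_le)
    have "(1 - t k) ^ CARD('k) * ((\<Prod>j<k. 1 - t j) ^ CARD('k) * ?d (dmixed k 0)) \<le> ?d Q * ?d (dmixed k y)"
      by (intro mult_mono dQ IH mult_nonneg_nonneg zero_le_power p0) auto
    from mult_left_mono[OF this, of "?d (G k)"]
    have 1: "(\<Prod>j<Suc k. 1 - t j) ^ CARD('k) * ?d (dmixed (Suc k) 0) \<le> ?d (dmixed (Suc k) y)"
      unfolding eq eq0 by (simp add: power_mult_distrib mult_ac)
    have "?d Q * ?d (dmixed k y) \<le> (1 + t k) ^ CARD('k) * ((\<Prod>j<k. 1 + t j) ^ CARD('k) * ?d (dmixed k 0))"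
      using t0 by (intro mult_mono dQ IH) auto
    from mult_left_mono[OF this, of "?d (G k)"]
    have 2: "?d (dmixed (Suc k) y) \<le> (\<Prod>j<Suc k. 1 + t j) ^ CARD('k) * ?d (dmixed (Suc k) 0)"
      unfolding eq eq0 by (simp add: power_mult_distrib mult_ac)
    from 1 2 show ?case by blast
  qed
  then show "(\<Prod>j<k. 1 - t j) ^ CARD('k) * \<bar>Determinants.det (matrix (dmixed k 0))\<bar>
      \<le> \<bar>Determinants.det (matrix (dmixed k y))\<bar>"
    and "\<bar>Determinants.det (matrix (dmixed k y))\<bar>
      \<le> (\<Prod>j<k. 1 + t j) ^ CARD('k) * \<bar>Determinants.det (matrix (dmixed k 0))\<bar>"
    by auto
qed

lemma distortion:
  assumes y: "y \<in> W n"
  shows "(1 / 2) ^ CARD('k) * \<bar>Determinants.det (matrix (dmixed n 0))\<bar>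
      \<le> \<bar>Determinants.det (matrix (dmixed n y))\<bar>"
    and "\<bar>Determinants.det (matrix (dmixed n y))\<bar>
      \<le> 2 ^ CARD('k) * \<bar>Determinants.det (matrix (dmixed n 0))\<bar>"
proof -
  define t where "t j = 2 * K / q * norm (orbit f j y)" for j
  have t0: "0 \<le> t j" for j using K q by (simp add: t_def)
  have "norm (cproj (- I) y) \<le> r" "norm (cproj I (orbit f n y)) \<le> r"
    using norm_cproj_le[of "- I" y] norm_cproj_le[of I "orbit f n y"] y unfolding W_def
    by (force dest!: spec[of _ 0], force)
  then have "q * (\<Sum>j\<le>n. norm (orbit f j y)) \<le> 2 * r"
    using orbit_sum_bound[OF y] by linarith
  then have "2 * K / q\<^sup>2 * (q * (\<Sum>j\<le>n. norm (orbit f j y))) \<le> 2 * K / q\<^sup>2 * (2 * r)"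
    using K by (intro mult_left_mono) auto
  moreover have "2 * K / q\<^sup>2 * (q * (\<Sum>j\<le>n. norm (orbit f j y))) = sum t {..n}"
    using q unfolding t_def sum_distrib_left[symmetric] by (simp add: power2_eq_square)
  \<comment> \<open>Both boundary components of the orbit are at most \<open>r\<close>, so the sum
    of the \<open>t j\<close> is at most \<open>4 * K * r / q\<^sup>2\<close>, which
    \<open>small\<close> keeps below \<open>1 / 2\<close>.\<close>
  moreover have "2 * K / q\<^sup>2 * (2 * r) \<le> 1 / 2"
    using small q mult_nonneg_nonneg[OF K less_imp_le[OF r]] unfolding q_def[symmetric]
    by (simp add: field_simps)
  ultimately have sum: "sum t {..n} \<le> 1 / 2" by linarith
  have t1: "t j < 1" if "j \<le> n" for j
    using member_le_sum[of j "{..n}" t] that t0 sum by simp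
  have sum: "sum t {..<n} \<le> 1 / 2"
    using sum t0[of n] by (simp flip: lessThan_Suc_atMost)
  \<comment> \<open>A product of factors \<open>1 - t j\<close> is at least one minus the sum, so a
    bound on the sum alone keeps the product away from zero.\<close>
  have "1 - sum t {..<n} \<le> (\<Prod>j<n. 1 - t j)"
    using t0 t1 by (intro Weierstrass_prod_ineq) (auto simp: less_imp_le)
  then have 1: "1 / 2 \<le> (\<Prod>j<n. 1 - t j)" using sum by linarith
  \<comment> \<open>The crude bound \<open>exp (1 / 2) \<le> 7 / 4\<close> suffices for the factor
    \<open>2\<close>.\<close>
  have "(\<Prod>j<n. 1 + t j) \<le> (\<Prod>j<n. exp (t j))"
    using t0 by (intro prod_mono) (auto intro: exp_ge_add_one_self add_nonneg_nonneg)
  also have "\<dots> = exp (sum t {..<n})" by (simp add: exp_sum)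
  also have "\<dots> \<le> exp (1 / 2)" using sum by simp
  also have "\<dots> \<le> 1 + 1 / 2 + (1 / 2)\<^sup>2" by (rule exp_bound) auto
  finally have 2: "(\<Prod>j<n. 1 + t j) \<le> 2" by (simp add: power2_eq_square)
  have "(1 / 2) ^ CARD('k) \<le> (\<Prod>j<n. 1 - t j) ^ CARD('k)" by (intro power_mono 1) auto
  then show "(1 / 2) ^ CARD('k) * \<bar>Determinants.det (matrix (dmixed n 0))\<bar>
      \<le> \<bar>Determinants.det (matrix (dmixed n y))\<bar>"
    by (rule order_trans[OF mult_right_mono distortion_product(1)[OF y _ t_def t1]]) auto
  have p2: "(\<Prod>j<n. 1 + t j) ^ CARD('k) \<le> 2 ^ CARD('k)"
    using t0 by (intro power_mono 2 prod_nonneg) (auto intro: add_nonneg_nonneg)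
  show "\<bar>Determinants.det (matrix (dmixed n y))\<bar>
      \<le> 2 ^ CARD('k) * \<bar>Determinants.det (matrix (dmixed n 0))\<bar>"
    by (rule order_trans[OF distortion_product(2)[OF y _ t_def t1] mult_right_mono[OF p2]]) auto
qed

text \<open>The part of the image inside the ball is open by invariance of domain, and closed since, by the
  a priori estimate, it is attained on the compact set of points with orbits of norm at most \<open>r / 2\<close>.\<close>

lemma ball_subset_mixed_image: "ball 0 (q * r / 4) \<subseteq> mixed n ` W n"
proof -
  define V where "V k = {y. \<forall>j\<le>k. norm (orbit f j y) \<le> r / 2}" for k
  have VW: "V k \<subseteq> W k" for k using r by (force simp: V_def W_def)
  have closed: "closed (V k)" for k
  proof (induction k)
    case 0
    have "V 0 = cball 0 (r / 2)" by (auto simp: V_def)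
    then show ?case by simp
  next
    case (Suc k)
    have "V (Suc k) = V k \<inter> orbit f (Suc k) -` cball 0 (r / 2)"
      by (auto simp: V_def le_Suc_eq)
    moreover have "continuous_on (V k) (orbit f (Suc k))"
      using continuous_on_subset[OF continuous_orbit VW] by blast
    ultimately show ?case using continuous_closed_preimage Suc by (metis closed_cball)
  qed
  have "V n \<subseteq> cball 0 (r / 2)" by (force simp: V_def)
  then have "compact (V n)" using closed bounded_subset[OF bounded_cball] by (auto simp: compact_eq_bounded_closed)
  have cont: "continuous_on (W n) (mixed n)"
    by (rule has_derivative_continuous_on) (rule has_derivative_at_withinI[OF deriv_mixed], auto)
  have "closed (mixed n ` V n)"
    using \<open>compact (V n)\<close> continuous_on_subset[OF cont VW] compact_continuous_image compact_imp_closed by blast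
  moreover have "open (mixed n ` W n)" by (rule invariance_of_domain[OF cont open_W inj_mixed])
  \<comment> \<open>Origin of the radius \<open>q * r / 4\<close>: \<open>q\<close> times any orbit
    norm is at most \<open>2 * norm (mixed n y)\<close>, so the orbit stays in the closed ball of
    radius \<open>r / 2\<close>.\<close>
  moreover have W_V: "y \<in> V n" if "y \<in> W n" "mixed n y \<in> ball 0 (q * r / 4)" for y
  proof -
    have "norm (orbit f j y) \<le> r / 2" if "j \<le> n" for j
    proof -
      have "norm (orbit f j y) \<le> (\<Sum>j\<le>n. norm (orbit f j y))"
        using that by (intro member_le_sum) auto
      then have "q * norm (orbit f j y) \<le> q * (\<Sum>j\<le>n. norm (orbit f j y))" using q by simp
      also have "\<dots> \<le> 2 * norm (mixed n y)"
        using orbit_sum_bound[OF \<open>y \<in> W n\<close>] norm_cproj_le[of I "mixed n y"] norm_cproj_le[of "- I" "mixed n y"]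
        by simp
      also have "\<dots> \<le> q * (r / 2)" using \<open>mixed n y \<in> _\<close> by simp
      finally show ?thesis using q by simp
    qed
    then show ?thesis by (simp add: V_def)
  qed
  \<comment> \<open>Inside the ball, the image of \<open>W n\<close> and the complement of the image
    of \<open>V n\<close> are open, disjoint by \<open>W_V\<close>, and cover everything;
    connectedness makes one of them miss the ball, and \<open>0\<close> lies in the first.\<close>
  ultimately have "mixed n ` W n \<inter> ball 0 (q * r / 4) = {} \<or> - mixed n ` V n \<inter> ball 0 (q * r / 4) = {}"
    using VW[of n] by (intro connectedD[OF connected_ball]) auto
  moreover have "0 \<in> mixed n ` W n \<inter> ball 0 (q * r / 4)"
    using zero_in_W[of n] q r by (auto simp: mixed_def cproj_simps intro!: image_eqI[of _ _ 0])
  ultimately show ?thesis using VW[of n] by blast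
qed

lemma norm_mixed_less: "y \<in> W n \<Longrightarrow> norm (mixed n y) < 2 * r"
proof -
  assume "y \<in> W n"
  then have "norm (orbit f 0 y) < r" "norm (orbit f n y) < r" unfolding W_def by blast+
  then show ?thesis
    using norm_triangle_ineq[of "cproj (- I) y" "cproj I (orbit f n y)"] norm_cproj_le[of "- I" y]
      norm_cproj_le[of I "orbit f n y"]
    by (simp add: mixed_def)
qed

lemma W_lmeasurable: "W n \<in> lmeasurable"
proof -
  have "W n \<subseteq> ball 0 r" by (force simp: W_def)
  then show ?thesis by (intro lmeasurable_open open_W bounded_subset[OF bounded_ball])
qed

text \<open>The integral of the Jacobian over \<open>W n\<close> is the volume of its image, which
  lies between balls of radii \<open>q * r / 4\<close> and \<open>2 * r\<close>, whereas by
  \<open>distortion\<close> the integrand is comparable to its value at \<open>0\<close>. So the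
  volume of \<open>W n\<close> is the reciprocal of that determinant, up to factors independent of
  \<open>n\<close>.\<close>

theorem measure_W:
  shows "measure lebesgue (ball (0::real^'k::_) (q * r / 4))
      \<le> 2 ^ CARD('k) * \<bar>Determinants.det (matrix (dmixed n 0))\<bar> * measure lebesgue (W n)"
    and "(1 / 2) ^ CARD('k) * \<bar>Determinants.det (matrix (dmixed n 0))\<bar> * measure lebesgue (W n)
      \<le> measure lebesgue (ball (0::real^'k::_) (2 * r))"
proof -
  let ?d = "\<bar>Determinants.det (matrix (dmixed n 0))\<bar>"
  have cont: "continuous_on (W n) (mixed n)"
    by (rule has_derivative_continuous_on) (rule has_derivative_at_withinI[OF deriv_mixed], auto)
  have sub: "mixed n ` W n \<subseteq> ball 0 (2 * r)" using norm_mixed_less by auto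
  then have img: "mixed n ` W n \<in> lmeasurable"
    by (intro lmeasurable_open invariance_of_domain[OF cont open_W inj_mixed] bounded_subset[OF bounded_ball])
  have int: "((\<lambda>y. \<bar>Determinants.det (matrix (dmixed n y))\<bar>) has_integral measure lebesgue (mixed n ` W n)) (W n)"
  proof (rule has_measure_differentiable_image[THEN iffD1])
    show "(mixed n has_derivative dmixed n y) (at y within W n)" if "y \<in> W n" for y
      using deriv_mixed[OF that] by (simp add: has_derivative_at_withinI)
  qed (use inj_mixed W_lmeasurable img in auto)
  have const: "((\<lambda>y. c) has_integral c * measure lebesgue (W n)) (W n)" for c :: real
    using has_integral_mult_right[of "\<lambda>_. 1" "measure lebesgue (W n)" "W n" c]
    by (simp add: has_integral_iff W_lmeasurable lmeasure_integral lmeasurable_iff_integrable_on[symmetric])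
  have "measure lebesgue (ball (0::real^'k::_) (q * r / 4)) \<le> measure lebesgue (mixed n ` W n)"
    by (rule measure_mono_fmeasurable[OF ball_subset_mixed_image _ img]) simp
  also have "\<dots> \<le> 2 ^ CARD('k) * ?d * measure lebesgue (W n)"
    by (rule has_integral_le[OF int const]) (rule distortion)
  finally show "measure lebesgue (ball (0::real^'k::_) (q * r / 4)) \<le> 2 ^ CARD('k) * ?d * measure lebesgue (W n)" .
  have "(1 / 2) ^ CARD('k) * ?d * measure lebesgue (W n) \<le> measure lebesgue (mixed n ` W n)"
    by (rule has_integral_le[OF const int]) (rule distortion)
  also have "\<dots> \<le> measure lebesgue (ball (0::real^'k::_) (2 * r))"
    by (rule measure_mono_fmeasurable[OF sub]) (use img in auto)
  finally show "(1 / 2) ^ CARD('k) * ?d * measure lebesgue (W n) \<le> measure lebesgue (ball (0::real^'k::_) (2 * r))" .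
qed

end

section \<open>Determinants of matrices over the two libraries\<close>

text \<open>Rows outside \<open>I\<close> are those of the identity, so only permutations fixing
  every index outside \<open>I\<close> contribute; conjugation with \<open>h\<close> turns these
  into permutations of \<open>{0..<d}\<close> with the same sign. The mixed derivative at
  \<open>0\<close> has this form.\<close>

lemma det_block:
  fixes M :: "'a::comm_ring_1^'k^'k"
  assumes h: "bij_betw h I {0..<d}"
    and M: "\<And>i j. i \<in> I \<Longrightarrow> j \<in> I \<Longrightarrow> M $ i $ j = a (h i) (h j)"
    and M1: "\<And>i j. i \<notin> I \<Longrightarrow> M $ i $ j = (if i = j then 1 else 0)"
  shows "Determinants.det M = Determinant.det (Matrix.mat d d (\<lambda>(i, j). a i j))"
proof -
  define F where "F \<pi> = (\<lambda>x. if x \<in> {0..<d} then h (\<pi> (inv_into I h x)) else x)" for \<pi>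
  have F: "bij_betw F {\<pi>. \<pi> permutes I} {\<pi>. \<pi> permutes {0..<d}}"
    using bij_betw_permutations[OF h] unfolding F_def .
  have hI: "inj_on h I" "h ` I = {0..<d}" using h by (auto simp: bij_betw_def)
  have sign: "sign (F p) = sign p" if "p permutes I" for p
  proof -
    have "F p = map_permutation I h p"
      by (auto simp: F_def map_permutation_def restrict_id_def hI fun_eq_iff)
    then show ?thesis using sign_map_permutation[OF hI(1) that] by simp
  qed
  have prod_eq: "(\<Prod>i\<in>UNIV. M $ i $ p i) = (\<Prod>i = 0..<d. a i (F p i))" if p: "p permutes I" for p
  proof -
    have "(\<Prod>i\<in>UNIV. M $ i $ p i) = (\<Prod>i\<in>I. M $ i $ p i)"
      by (rule prod.mono_neutral_right) (use p M1 in \<open>auto simp: permutes_not_in\<close>)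
    also have "\<dots> = (\<Prod>i\<in>I. a (h i) (F p (h i)))"
    proof (rule prod.cong[OF refl])
      fix i assume i: "i \<in> I"
      then have "F p (h i) = h (p i)" using hI by (auto simp: F_def)
      then show "M $ i $ p i = a (h i) (F p (h i))" using M[OF i] permutes_in_image[OF p] i by simp
    qed
    also have "\<dots> = (\<Prod>i = 0..<d. a i (F p i))"
      by (rule prod.reindex_bij_betw[OF h])
    finally show ?thesis .
  qed
  have "Determinants.det M = (\<Sum>p | p permutes I. of_int (sign p) * (\<Prod>i\<in>UNIV. M $ i $ p i))"
    unfolding Determinants.det_def
  proof (rule sum.mono_neutral_right)
    show "\<forall>p\<in>{p. p permutes (UNIV::'k set)} - {p. p permutes I}.
        of_int (sign p) * (\<Prod>i\<in>UNIV. M $ i $ p i) = 0"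
    proof
      fix p assume "p \<in> {p. p permutes (UNIV::'k set)} - {p. p permutes I}"
      then have p: "p permutes (UNIV::'k set)" and "\<not> p permutes I" by auto
      then obtain i where i: "i \<notin> I" "p i \<noteq> i" by (auto simp: permutes_def)
      then have "M $ i $ p i = 0" using M1 by simp
      then have "(\<Prod>i\<in>UNIV. M $ i $ p i) = 0" by (intro prod_zero) auto
      then show "of_int (sign p) * (\<Prod>i\<in>UNIV. M $ i $ p i) = 0" by simp
    qed
  qed (auto intro: permutes_subset)
  also have "\<dots> = (\<Sum>p | p permutes I. of_int (sign (F p)) * (\<Prod>i = 0..<d. a i (F p i)))"
    by (rule sum.cong) (simp_all add: sign prod_eq)
  also have "\<dots> = (\<Sum>p | p permutes {0..<d}. of_int (sign p) * (\<Prod>i = 0..<d. a i (p i)))"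
    by (rule sum.reindex_bij_betw[OF F])
  also have "\<dots> = Determinant.det (Matrix.mat d d (\<lambda>(i, j). a i j))"
    unfolding Determinant.det_def
    by (auto intro!: sum.cong prod.cong simp: permutes_in_image)
  finally show ?thesis .
qed

section \<open>A well-ordered copy of a finite index type\<close>

text \<open>The change of variables theorem of HOL-Analysis requires a well-ordered index type, whereas the
  index type of the coordinates of the manifold is merely finite.\<close>

typedef 'a well_ordered = "UNIV :: 'a set" ..

instantiation well_ordered :: (finite) "{finite, wellorder}"
begin

definition less_eq_well_ordered :: "'a well_ordered \<Rightarrow> 'a well_ordered \<Rightarrow> bool" where
  "x \<le> y \<longleftrightarrow> to_nat_on UNIV (Rep_well_ordered x) \<le> to_nat_on UNIV (Rep_well_ordered y)"

definition less_well_ordered :: "'a well_ordered \<Rightarrow> 'a well_ordered \<Rightarrow> bool" where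
  "x < y \<longleftrightarrow> to_nat_on UNIV (Rep_well_ordered x) < to_nat_on UNIV (Rep_well_ordered y)"

instance
proof
  fix x y z :: "'a well_ordered"
  show "finite (UNIV :: 'a well_ordered set)"
    by (metis finite finite_imageI type_definition.Abs_image type_definition_well_ordered)
  show "x < y \<longleftrightarrow> x \<le> y \<and> \<not> y \<le> x" "x \<le> x" "x \<le> y \<Longrightarrow> y \<le> z \<Longrightarrow> x \<le> z" "x \<le> y \<or> y \<le> x"
    by (auto simp: less_eq_well_ordered_def less_well_ordered_def)
  assume "x \<le> y" "y \<le> x"
  then have "to_nat_on UNIV (Rep_well_ordered x) = to_nat_on UNIV (Rep_well_ordered y)"
    by (simp add: less_eq_well_ordered_def)
  then show "x = y"
    using inj_on_to_nat_on[of "UNIV :: 'a set"]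
    by (simp add: countable_finite inj_on_def Rep_well_ordered_inject)
next
  fix P :: "'a well_ordered \<Rightarrow> bool" and x
  assume *: "\<And>x. (\<And>y. y < x \<Longrightarrow> P y) \<Longrightarrow> P x"
  show "P x"
    by (induction x rule: measure_induct_rule[of "\<lambda>x. to_nat_on UNIV (Rep_well_ordered x)"])
       (rule *, simp add: less_well_ordered_def)
qed

end

definition reindex :: "real^'a well_ordered \<Rightarrow> real^'a::finite" where
  "reindex v = (\<chi> i. v $ Abs_well_ordered i)"

definition unreindex :: "real^'a::finite \<Rightarrow> real^'a well_ordered" where
  "unreindex v = (\<chi> i. v $ Rep_well_ordered i)"

lemma reindex_unreindex [simp]: "reindex (unreindex v) = v" "unreindex (reindex w) = w"
  by (auto simp: reindex_def unreindex_def Finite_Cartesian_Product.vec_eq_iff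
      Rep_well_ordered_inverse Abs_well_ordered_inverse)

lemma reindex_eq_iff: "reindex x = y \<longleftrightarrow> x = unreindex y"
  by (metis reindex_unreindex)

lemma linear_reindex: "linear reindex" "linear unreindex"
  by (auto intro!: linearI simp: reindex_def unreindex_def Finite_Cartesian_Product.vec_eq_iff)

lemma bij_Rep_well_ordered: "bij Rep_well_ordered"
  by (rule bij_betw_byWitness[of _ Abs_well_ordered])
    (auto simp: Rep_well_ordered_inverse Abs_well_ordered_inverse)

lemma card_well_ordered: "CARD('a::finite well_ordered) = CARD('a)"
  using bij_betw_same_card[OF bij_Rep_well_ordered] .

lemma norm_unreindex: "norm (unreindex v) = norm v"
  unfolding norm_vec_def L2_set_def unreindex_def
  by (simp add: sum.reindex_bij_betw[OF bij_Rep_well_ordered, of "\<lambda>i. (v $ i)\<^sup>2"])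

lemma prod_Basis_cart: "(\<Prod>b\<in>Basis. v \<bullet> b) = (\<Prod>i\<in>UNIV. v $ i)" for v :: "real^'a::finite"
proof -
  have "bij_betw (\<lambda>i. axis i 1) UNIV (Basis :: (real^'a) set)"
    by (auto simp: bij_betw_def inj_on_def axis_eq_axis Basis_vec_def)
  from prod.reindex_bij_betw[OF this, of "\<lambda>b. v \<bullet> b"] show ?thesis
    by (simp add: inner_axis)
qed

text \<open>Lebesgue measure is determined by its values on boxes, and relabelling coordinates takes
  boxes to boxes with the same edge lengths.\<close>

lemma emeasure_unreindex_vimage:
  assumes "S \<in> sets borel"
  shows "emeasure lborel S = emeasure lborel (reindex -` S)"
proof -
  have cont: "continuous_on UNIV (reindex :: real^'a well_ordered \<Rightarrow> real^'a)"
    by (rule linear_continuous_on[OF linear_linear[THEN iffD2, OF linear_reindex(1)]])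
  have meas: "reindex \<in> lborel \<rightarrow>\<^sub>M (borel :: (real^'a) measure)"
    using borel_measurable_continuous_onI[OF cont] by simp
  have "lborel = distr lborel borel (reindex :: _ \<Rightarrow> real^'a)"
  proof (rule lborel_eqI)
    fix l u :: "real^'a" assume lu: "\<And>b. b \<in> Basis \<Longrightarrow> l \<bullet> b \<le> u \<bullet> b"
    have le: "l $ i \<le> u $ i" for i using lu[of "axis i 1"] by (simp add: inner_axis)
    have "reindex -` box l u = box (unreindex l) (unreindex u)"
      unfolding set_eq_iff vimage_eq mem_box_cart
      by (auto simp: reindex_def unreindex_def) (metis Rep_well_ordered_inverse, metis Rep_well_ordered_inverse,
          metis Abs_well_ordered_inverse UNIV_I, metis Abs_well_ordered_inverse UNIV_I)
    moreover have "emeasure lborel (box (unreindex l) (unreindex u))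
        = (\<Prod>b\<in>Basis. (unreindex u - unreindex l) \<bullet> b)"
    proof (rule emeasure_lborel_box)
      fix b :: "real^'a well_ordered" assume "b \<in> Basis"
      then obtain i where "b = axis i 1" by (auto simp: Basis_vec_def)
      then show "unreindex l \<bullet> b \<le> unreindex u \<bullet> b" using le by (simp add: inner_axis unreindex_def)
    qed
    moreover have "(\<Prod>b\<in>Basis. (unreindex u - unreindex l) \<bullet> b) = (\<Prod>b\<in>Basis. (u - l) \<bullet> b)"
      using prod.reindex_bij_betw[OF bij_Rep_well_ordered, of "\<lambda>i. (u - l) $ i"]
      by (simp add: prod_Basis_cart unreindex_def)
    ultimately show "emeasure (distr lborel borel reindex) (box l u) = (\<Prod>b\<in>Basis. (u - l) \<bullet> b)"
      using meas by (simp add: emeasure_distr)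
  qed simp
  then have "emeasure lborel S = emeasure (distr lborel borel reindex) S" by simp
  also have "\<dots> = emeasure lborel (reindex -` S)" using assms meas by (simp add: emeasure_distr)
  finally show ?thesis .
qed

text \<open>\<open>T\<close> joins spaces with different index types and has no determinant itself.
  The endomorphism \<open>unreindex \<circ> T\<close> has one, and the two-sided norm bound confines
  it between powers of \<open>1 / \<kappa>\<close> and \<open>\<kappa>\<close>.\<close>

lemma affine_image_measure:
  fixes T :: "real^'n::finite well_ordered \<Rightarrow> real^'n"
  assumes lin: "linear T" and \<kappa>: "1 \<le> \<kappa>"
    and T: "\<And>v. norm (T v) \<le> \<kappa> * norm v" "\<And>v. norm v \<le> \<kappa> * norm (T v)"
    and W: "open W" "bounded W"
  shows "open ((\<lambda>w. z + T w) ` W)"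
    and "emeasure lborel ((\<lambda>w. z + T w) ` W) \<le> ennreal (\<kappa> ^ CARD('n) * measure lebesgue W)"
    and "ennreal ((1 / \<kappa>) ^ CARD('n) * measure lebesgue W) \<le> emeasure lborel ((\<lambda>w. z + T w) ` W)"
proof -
  define U where "U = unreindex \<circ> T"
  have linU: "linear U" unfolding U_def by (intro linear_compose lin linear_reindex)
  have nU: "norm (U v) = norm (T v)" for v by (simp add: U_def norm_unreindex)
  have det: "\<bar>Determinants.det (matrix U)\<bar> \<le> \<kappa> ^ CARD('n)"
    "(1 / \<kappa>) ^ CARD('n) \<le> \<bar>Determinants.det (matrix U)\<bar>"
    using abs_det_le_power[OF linU, of \<kappa>] abs_det_ge_power[OF linU, of "1 / \<kappa>"] T \<kappa>
    by (simp_all add: nU card_well_ordered field_simps)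
  have "inj U"
    unfolding linear_injective_0[OF linU]
  proof (intro allI impI)
    fix v assume "U v = 0"
    then have "norm (T v) = 0" using nU[of v] by simp
    then show "v = 0" using T(2)[of v] by simp
  qed
  then have "surj U" using linU linear_injective_imp_surjective by blast
  have surj: "surj T"
  proof (rule surjI)
    fix x show "T (inv_into UNIV U (unreindex x)) = x"
      using surj_f_inv_f[OF \<open>surj U\<close>, of "unreindex x"] unfolding U_def by (metis comp_apply reindex_unreindex(1))
  qed
  have oT: "open (T ` W)" by (rule open_surjective_linear_image[OF W(1) lin surj])
  have bT: "bounded (T ` W)" by (rule bounded_linear_image[OF W(2)]) (use lin linear_linear in blast)
  have img: "(\<lambda>w. z + T w) ` W = (+) z ` (T ` W)" by auto
  show o: "open ((\<lambda>w. z + T w) ` W)" unfolding img by (rule open_translation[OF oT])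
  have b: "bounded ((\<lambda>w. z + T w) ` W)" unfolding img by (rule bounded_translation[OF bT])
  have fin: "emeasure lborel X = ennreal (measure lebesgue X)" if "open X" "bounded X" for X :: "(real^'b::finite) set"
    using that emeasure_bounded_finite[of X] by (simp add: emeasure_eq_ennreal_measure)
  have "emeasure lborel (T ` W) = emeasure lborel (reindex -` T ` W)"
    by (rule emeasure_unreindex_vimage) (use oT in simp)
  also have "reindex -` T ` W = U ` W"
    by (auto simp: U_def reindex_eq_iff)
  finally have "measure lborel (T ` W) = measure lborel (U ` W)" by (simp add: measure_def)
  then have "measure lebesgue (T ` W) = measure lebesgue (U ` W)"
    using oT open_surjective_linear_image[OF W(1) linU \<open>surj U\<close>] by simp
  also have "\<dots> = \<bar>Determinants.det (matrix U)\<bar> * measure lebesgue W"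
    by (rule measure_linear_image[OF linU lmeasurable_open[OF W(2,1)]])
  finally have eq: "emeasure lborel ((\<lambda>w. z + T w) ` W) = ennreal (\<bar>Determinants.det (matrix U)\<bar> * measure lebesgue W)"
    using fin[OF o b] by (simp add: img measure_translation)
  show "emeasure lborel ((\<lambda>w. z + T w) ` W) \<le> ennreal (\<kappa> ^ CARD('n) * measure lebesgue W)"
    "ennreal ((1 / \<kappa>) ^ CARD('n) * measure lebesgue W) \<le> emeasure lborel ((\<lambda>w. z + T w) ` W)"
    unfolding eq by (intro ennreal_leI mult_right_mono det measure_nonneg)+
qed

section \<open>Charts and tangent maps\<close>

text \<open>Monotonicity in the parameter allows it to be shrunk to the minimum over a finite
  subcover. All uniform constants below come from this argument, each estimate being arranged to
  depend monotonically on one positive number.\<close>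

lemma compact_uniform:
  fixes S :: "'a::topological_space set" and P :: "'a \<Rightarrow> real \<Rightarrow> bool"
  assumes S: "compact S"
    and loc: "\<And>p. p \<in> S \<Longrightarrow> \<exists>U r. open U \<and> p \<in> U \<and> 0 < r \<and> (\<forall>q\<in>U \<inter> S. P q r)"
    and mono: "\<And>q r s. q \<in> S \<Longrightarrow> P q r \<Longrightarrow> 0 < s \<Longrightarrow> s \<le> r \<Longrightarrow> P q s"
  shows "\<exists>r>0. \<forall>p\<in>S. P p r"
proof -
  obtain U r where U: "\<And>p. p \<in> S \<Longrightarrow> open (U p) \<and> p \<in> U p \<and> 0 < r p \<and> (\<forall>q\<in>U p \<inter> S. P q (r p))"
    using loc by metis
  obtain C where C: "C \<subseteq> S" "finite C" "S \<subseteq> (\<Union>p\<in>C. U p)"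
    using compactE_image[OF S, of S U] U by blast
  \<comment> \<open>The inserted \<open>1\<close> keeps the minimum meaningful when the subcover is
    empty.\<close>
  define e where "e = Min (insert 1 (r ` C))"
  have fin: "finite (insert 1 (r ` C))" using C(2) by simp
  have "0 < e" unfolding e_def using C U by (subst Min_gr_iff) auto
  moreover have "P q e" if q: "q \<in> S" for q
  proof -
    obtain p where p: "p \<in> C" "q \<in> U p" using C(3) q by blast
    then have "e \<le> r p" unfolding e_def using fin by (intro Min_le) auto
    then show ?thesis using mono[OF q _ \<open>0 < e\<close>] U p C(1) q by blast
  qed
  ultimately show ?thesis by blast
qed

lemma finite_uniform:
  fixes P :: "'a \<Rightarrow> real \<Rightarrow> bool"
  assumes F: "finite F" and loc: "\<And>c. c \<in> F \<Longrightarrow> \<exists>r>0. P c r"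
    and mono: "\<And>c r s. c \<in> F \<Longrightarrow> P c r \<Longrightarrow> 0 < s \<Longrightarrow> s \<le> r \<Longrightarrow> P c s"
  shows "\<exists>r>0. \<forall>c\<in>F. P c r"
proof -
  obtain r where r: "\<And>c. c \<in> F \<Longrightarrow> 0 < r c \<and> P c (r c)" using loc by metis
  define e where "e = Min (insert 1 (r ` F))"
  have "0 < e" unfolding e_def using F r by (subst Min_gr_iff) auto
  moreover have "P c e" if "c \<in> F" for c
  proof -
    have "e \<le> r c" unfolding e_def using F that by (intro Min_le) auto
    then show ?thesis using mono[OF that _ \<open>0 < e\<close>] r that by blast
  qed
  ultimately show ?thesis by blast
qed

lemma
  assumes "is_chart c"
  shows open_chart_dom: "open (fst c)" and open_chart_image: "open (snd c ` fst c)"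
    and continuous_chart: "continuous_on (fst c) (snd c)"
    and continuous_inv_chart: "continuous_on (snd c ` fst c) (inv_chart c)"
    and inv_chart_chart: "x \<in> fst c \<Longrightarrow> inv_chart c (snd c x) = x"
    and chart_inv_chart: "z \<in> snd c ` fst c \<Longrightarrow> snd c (inv_chart c z) = z"
    and inv_chart_in: "z \<in> snd c ` fst c \<Longrightarrow> inv_chart c z \<in> fst c"
  using assms by (auto simp: is_chart_def homeomorphism_def)

lemma open_chart_preimage:
  assumes c: "is_chart c" and f: "continuous_on UNIV f" and V: "open V"
  shows "open (snd c ` (fst c \<inter> f -` V))"
proof -
  have "open (f -` V)" using f V by (simp add: continuous_on_open_vimage)
  then have "open (snd c ` fst c \<inter> inv_chart c -` (f -` V))"
    using continuous_open_preimage[OF continuous_inv_chart open_chart_image, OF c c] by blast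
  moreover have "snd c ` (fst c \<inter> f -` V) = snd c ` fst c \<inter> inv_chart c -` (f -` V)"
    using inv_chart_chart[OF c] by force
  ultimately show ?thesis by simp
qed

text \<open>The derivative in two freely chosen charts. \<open>to_coords\<close>,
  \<open>from_coords\<close> and \<open>tangent_map\<close> are special cases, with \<open>f\<close>
  the identity or both charts the preferred ones, so the single chain rule \<open>drep_comp\<close>
  covers all changes of components.\<close>

definition drep :: "('m, 'n::finite) chart \<Rightarrow> ('m, 'n) chart \<Rightarrow> ('m \<Rightarrow> 'm) \<Rightarrow> 'm \<Rightarrow> real^'n \<Rightarrow> real^'n" where
  "drep c d f x = frechet_derivative (local_rep c d f) (at (snd c x))"

locale smooth_manifold =
  fixes A :: "('m::{metric_space, second_countable_topology}, 'n::finite) chart set"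
  assumes atlas: "smooth_atlas A"
begin

lemma chart: "c \<in> A \<Longrightarrow> is_chart c"
  using atlas by (simp add: smooth_atlas_def)

lemma chart_at: "chart_at A x \<in> A" "x \<in> fst (chart_at A x)"
proof -
  have "(\<Union>c\<in>A. fst c) = UNIV" using atlas unfolding smooth_atlas_def by blast
  then have "x \<in> (\<Union>c\<in>A. fst c)" by simp
  then have "\<exists>c. c \<in> A \<and> x \<in> fst c" by blast
  then have "chart_at A x \<in> A \<and> x \<in> fst (chart_at A x)" unfolding chart_at_def by (rule someI_ex)
  then show "chart_at A x \<in> A" "x \<in> fst (chart_at A x)" by auto
qed

lemma C2_map_id: "C2_map A id"
  using atlas unfolding C2_map_def smooth_atlas_def local_rep_def by simp

lemma C2_map_differentiable:
  assumes "C2_map A f" "c \<in> A" "d \<in> A" "z \<in> snd c ` (fst c \<inter> f -` fst d)"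
  shows "local_rep c d f differentiable (at z)"
    and "(\<lambda>z. frechet_derivative (local_rep c d f) (at z) v) differentiable (at z)"
proof -
  have "Ck_on (Suc (Suc 0)) (snd c ` (fst c \<inter> f -` fst d)) (local_rep c d f)"
    using assms(1-3) by (simp add: C2_map_def numeral_2_eq_2 del: Ck_on.simps)
  then show "local_rep c d f differentiable (at z)"
    "(\<lambda>z. frechet_derivative (local_rep c d f) (at z) v) differentiable (at z)"
    unfolding Ck_on.simps(2) using assms(4) by blast+
qed

lemma deriv_local_rep:
  assumes "C2_map A f" "c \<in> A" "d \<in> A" "x \<in> fst c" "f x \<in> fst d"
  shows "(local_rep c d f has_derivative drep c d f x) (at (snd c x))"
  unfolding drep_def using C2_map_differentiable(1)[OF assms(1-3)] assms(4,5) frechet_derivative_works by blast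

lemma deriv_local_rep_comp:
  assumes f: "C2_map A f" and g: "C2_map A g" and c: "c \<in> A" "d \<in> A" "e \<in> A"
    and x: "x \<in> fst c" "f x \<in> fst d" "g (f x) \<in> fst e"
  shows "(local_rep c e (g \<circ> f) has_derivative drep d e g (f x) \<circ> drep c d f x) (at (snd c x))"
proof -
  have cont: "continuous_on UNIV f" using f by (simp add: C2_map_def)
  have eq: "local_rep c d f (snd c x) = snd d (f x)"
    using inv_chart_chart[OF chart[OF c(1)] x(1)] by (simp add: local_rep_def)
  have "(local_rep d e g \<circ> local_rep c d f has_derivative drep d e g (f x) \<circ> drep c d f x) (at (snd c x))"
    by (rule diff_chain_at) (use deriv_local_rep assms eq in auto)
  then show ?thesis
  proof (rule has_derivative_transform_within_open)
    show "open (snd c ` (fst c \<inter> f -` fst d))"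
      by (rule open_chart_preimage[OF chart[OF c(1)] cont open_chart_dom[OF chart[OF c(2)]]])
    show "(local_rep d e g \<circ> local_rep c d f) z = local_rep c e (g \<circ> f) z"
      if "z \<in> snd c ` (fst c \<inter> f -` fst d)" for z
      using that inv_chart_chart[OF chart[OF c(1)]] inv_chart_chart[OF chart[OF c(2)]]
      by (auto simp: local_rep_def)
  qed (use x in auto)
qed

lemma drep_comp:
  assumes "C2_map A f" "C2_map A g" "c \<in> A" "d \<in> A" "e \<in> A"
    "x \<in> fst c" "f x \<in> fst d" "g (f x) \<in> fst e"
  shows "drep c e (g \<circ> f) x = drep d e g (f x) \<circ> drep c d f x"
  using frechet_derivative_at[OF deriv_local_rep_comp[OF assms]] by (simp add: drep_def)

lemma drep_id:
  assumes c: "c \<in> A" and x: "x \<in> fst c"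
  shows "drep c c id x = id"
proof -
  have "(id has_derivative id) (at (snd c x))" by (rule has_derivative_id)
  then have "(local_rep c c id has_derivative id) (at (snd c x))"
    by (rule has_derivative_transform_within_open[OF _ open_chart_image[OF chart[OF c]]])
      (use x chart_inv_chart[OF chart[OF c]] in \<open>auto simp: local_rep_def\<close>)
  then show ?thesis using frechet_derivative_at by (force simp: drep_def)
qed

lemma to_coords_drep: "to_coords A c x = drep (chart_at A x) c id x"
  and from_coords_drep: "from_coords A c x = drep c (chart_at A x) id x"
  and tangent_map_drep: "tangent_map A f x = drep (chart_at A x) (chart_at A (f x)) f x"
  by (simp_all add: to_coords_def from_coords_def tangent_map_def drep_def local_rep_def)

lemma linear_drep:
  assumes "C2_map A f" "c \<in> A" "d \<in> A" "x \<in> fst c" "f x \<in> fst d"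
  shows "linear (drep c d f x)"
  using deriv_local_rep[OF assms] has_derivative_linear by blast

lemma linear_coords:
  assumes "c \<in> A" "x \<in> fst c"
  shows "linear (to_coords A c x)" "linear (from_coords A c x)"
  unfolding to_coords_drep from_coords_drep using assms chart_at C2_map_id by (auto intro!: linear_drep)

lemma to_from_coords:
  assumes "c \<in> A" "x \<in> fst c"
  shows "to_coords A c x (from_coords A c x v) = v" "from_coords A c x (to_coords A c x v) = v"
proof -
  have "to_coords A c x \<circ> from_coords A c x = drep c c (id \<circ> id) x"
    unfolding to_coords_drep from_coords_drep
    using drep_comp[OF C2_map_id C2_map_id assms(1) chart_at(1) assms(1), of x x] assms chart_at by simp
  then show "to_coords A c x (from_coords A c x v) = v"
    using drep_id[OF assms] by (simp add: fun_eq_iff)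
  have "from_coords A c x \<circ> to_coords A c x = drep (chart_at A x) (chart_at A x) (id \<circ> id) x"
    unfolding to_coords_drep from_coords_drep
    using drep_comp[OF C2_map_id C2_map_id chart_at(1) assms(1) chart_at(1), of x x] assms chart_at by simp
  then show "from_coords A c x (to_coords A c x v) = v"
    using drep_id[OF chart_at] by (simp add: fun_eq_iff)
qed

lemma tangent_map_comp:
  assumes "C2_map A f" "C2_map A g"
  shows "tangent_map A (g \<circ> f) x = tangent_map A g (f x) \<circ> tangent_map A f x"
  unfolding tangent_map_drep
  using drep_comp[OF assms chart_at(1) chart_at(1) chart_at(1)] chart_at by simp

lemma tangent_map_id: "tangent_map A id x = id"
  unfolding tangent_map_drep using drep_id[OF chart_at] by simp

text \<open>Both sides are the derivative of \<open>f\<close> from the preferred chart at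
  \<open>x\<close> to the chart \<open>d\<close>, read once as \<open>f \<circ> id\<close> and once
  as \<open>id \<circ> f\<close>.\<close>

lemma drep_to_coords:
  assumes f: "C2_map A f" and c: "c \<in> A" "d \<in> A" and x: "x \<in> fst c" "f x \<in> fst d"
  shows "drep c d f x (to_coords A c x v) = to_coords A d (f x) (tangent_map A f x v)"
proof -
  have "drep c d f x \<circ> to_coords A c x = drep (chart_at A x) d (f \<circ> id) x"
    unfolding to_coords_drep using drep_comp[OF C2_map_id f chart_at(1) c, of x x] x chart_at by simp
  also have "\<dots> = drep (chart_at A x) d (id \<circ> f) x" by simp
  also have "\<dots> = to_coords A d (f x) \<circ> tangent_map A f x"
    unfolding to_coords_drep tangent_map_drep
    using drep_comp[OF f C2_map_id chart_at(1)[of x] chart_at(1)[of "f x"] c(2)] x chart_at by simp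
  finally show ?thesis by (simp add: fun_eq_iff)
qed

end

section \<open>Inner products\<close>

lemma bilinear_expand:
  fixes B :: "real^'n::finite \<Rightarrow> real^'n \<Rightarrow> real"
  assumes "bilinear B"
  shows "B x y = (\<Sum>i\<in>UNIV. \<Sum>j\<in>UNIV. x $ i * y $ j * B (axis i 1) (axis j 1))"
proof -
  have 1: "v = (\<Sum>i\<in>UNIV. v $ i *\<^sub>R axis i 1)" for v :: "real^'n"
    using basis_expansion[of v] by (simp add: scalar_mult_eq_scaleR)
  have "B x y = B (\<Sum>i\<in>UNIV. x $ i *\<^sub>R axis i 1) (\<Sum>j\<in>UNIV. y $ j *\<^sub>R axis j 1)"
    using 1 by metis
  also have "\<dots> = (\<Sum>(i, j)\<in>UNIV \<times> UNIV. x $ i * y $ j * B (axis i 1) (axis j 1))"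
    using assms by (simp add: bilinear_sum bilinear_lmul bilinear_rmul case_prod_unfold mult_ac)
  finally show ?thesis by (simp add: sum.cartesian_product)
qed

text \<open>The segment from the identity to the Gram matrix consists of positive definite, hence
  invertible, matrices, so the determinant cannot change sign on the way.\<close>

lemma gram_det_pos:
  fixes B :: "real^'n::finite \<Rightarrow> real^'n \<Rightarrow> real"
  assumes bil: "bilinear B" and pos: "\<And>v. v \<noteq> 0 \<Longrightarrow> 0 < B v v"
  shows "0 < Determinants.det (\<chi> i j. B (axis i 1) (axis j 1))"
proof (rule ccontr)
  define M where "M t = (\<chi> i j. (1 - t) * (if i = j then 1 else 0) + t * B (axis i 1) (axis j 1))" for t
  have M1: "M 1 = (\<chi> i j. B (axis i 1) (axis j 1))" by (simp add: M_def)
  have M0: "M 0 = Finite_Cartesian_Product.mat 1" by (simp add: M_def Finite_Cartesian_Product.mat_def)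
  assume "\<not> ?thesis"
  then have "Determinants.det (M 1) \<le> 0" "0 \<le> Determinants.det (M 0)" by (simp_all add: M1 M0)
  moreover have "continuous_on {0..1} (\<lambda>t. Determinants.det (M t))"
    unfolding Determinants.det_def M_def by (auto intro!: continuous_intros)
  ultimately obtain t where t: "0 \<le> t" "t \<le> 1" "Determinants.det (M t) = 0"
    using IVT2'[of "\<lambda>t. Determinants.det (M t)" 1 0 0] by auto
  then obtain x where x: "x \<noteq> 0" "M t *v x = 0" 
    using invertible_det_nz[of "M t"] invertible_left_inverse[of "M t"] matrix_left_invertible_ker[of "M t"] by auto
  have "0 = x \<bullet> (M t *v x)" using x by simp
  also have "\<dots> = (\<Sum>i\<in>UNIV. \<Sum>j\<in>UNIV. x $ i * (M t $ i $ j * x $ j))"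
    by (simp add: inner_vec_def matrix_vector_mult_def sum_distrib_left)
  also have "\<dots> = (\<Sum>i\<in>UNIV. \<Sum>j\<in>UNIV. (if j = i then (1 - t) * (x $ i * x $ j) else 0)
      + t * (x $ i * x $ j * B (axis i 1) (axis j 1)))"
    by (intro sum.cong) (auto simp: M_def algebra_simps)
  also have "\<dots> = (1 - t) * (x \<bullet> x) + t * B x x"
    by (simp add: sum.distrib bilinear_expand[OF bil, of x x] inner_vec_def flip: sum_distrib_left)
  also have "\<dots> > 0"
  proof (cases "t = 0")
    case False
    then have "0 < t * B x x" using pos[OF x(1)] t by simp
    then show ?thesis using t by (intro add_nonneg_pos mult_nonneg_nonneg) auto
  qed (use x in simp)
  finally show False by simp
qed

lemma orthonormal_basis_length:
  assumes bil: "bilinear (g x)" and b: "orthonormal_basis g x E es"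
  shows "length es = dim E"
proof -
  have on: "g x (es ! i) (es ! j) = (if i = j then 1 else 0)" if "i < length es" "j < length es" for i j
    using b that by (simp add: orthonormal_basis_def)
  have dist: "distinct es"
    unfolding distinct_conv_nth using on by (metis zero_neq_one)
  have on': "g x e e' = (if e = e' then 1 else 0)" if "e \<in> set es" "e' \<in> set es" for e e'
    using that on dist by (auto simp: in_set_conv_nth nth_eq_iff_index_eq)
  have "independent (set es)"
  proof (rule independent_if_scalars_zero)
    fix f e assume z: "(\<Sum>e\<in>set es. f e *\<^sub>R e) = 0" and e: "e \<in> set es"
    have lin: "linear (g x e)" using bil by (simp add: bilinear_def)
    have "0 = g x e (\<Sum>e\<in>set es. f e *\<^sub>R e)" using z linear_0[OF lin] by simp
    also have "\<dots> = (\<Sum>e'\<in>set es. f e' * g x e e')"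
      by (simp add: linear_sum[OF lin] linear_cmul[OF lin])
    also have "\<dots> = (\<Sum>e'\<in>set es. if e = e' then f e' else 0)"
      by (rule sum.cong) (auto simp: on' e)
    also have "\<dots> = f e" using e by (simp add: sum.delta')
    finally show "f e = 0" by simp
  qed simp
  then have "dim (span (set es)) = card (set es)" by (rule dim_span_eq_card_independent)
  then show ?thesis using b dist by (auto simp: orthonormal_basis_def distinct_card)
qed

text \<open>Gram-Schmidt along a finite spanning set. The induction does not keep the set
  independent, so a vector whose orthogonal remainder \<open>w\<close> vanishes is simply
  dropped.\<close>

lemma exists_orthonormal_basis:
  assumes bil: "bilinear (g x)" and sym: "\<And>u v. g x u v = g x v u"
    and pos: "\<And>v. v \<noteq> 0 \<Longrightarrow> 0 < g x v v" and E: "subspace E"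
  shows "\<exists>es. orthonormal_basis g x E es"
proof -
  have lin: "linear (g x u)" for u using bil by (simp add: bilinear_def)
  have "\<exists>es. orthonormal_basis g x (span B) es" if "finite B" for B
    using that
  proof induction
    case empty
    have "orthonormal_basis g x (span {}) []" by (simp add: orthonormal_basis_def)
    then show ?case by blast
  next
    case (insert a B)
    then obtain es where es: "orthonormal_basis g x (span B) es" by blast
    have on: "g x (es ! i) (es ! j) = (if i = j then 1 else 0)" if "i < length es" "j < length es" for i j
      using es that by (simp add: orthonormal_basis_def)
    have span: "span (set es) = span B" using es by (simp add: orthonormal_basis_def)
    define p where "p = (\<Sum>i<length es. g x (es ! i) a *\<^sub>R es ! i)"
    define w where "w = a - p"
    have p: "p \<in> span B"
      unfolding p_def span[symmetric] by (intro span_sum span_scale span_base) auto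
    have span_w: "span (insert a B) = span (insert w (set es))"
    proof -
      have "span (insert w (set es)) = span (insert w B)"
        by (simp only: span_insert span)
      also have "\<dots> = span (insert a B)"
        by (rule eq_span_insert_eq) (use p in \<open>simp add: w_def span_neg\<close>)
      finally show ?thesis by simp
    qed
    have orth: "g x (es ! i) w = 0" if i: "i < length es" for i
    proof -
      have "g x (es ! i) p = (\<Sum>j<length es. g x (es ! j) a * g x (es ! i) (es ! j))"
        by (simp add: p_def linear_sum[OF lin] linear_cmul[OF lin])
      also have "\<dots> = (\<Sum>j<length es. if j = i then g x (es ! j) a else 0)"
        by (rule sum.cong) (auto simp: on i)
      also have "\<dots> = g x (es ! i) a" using i by simp
      finally show ?thesis by (simp add: w_def linear_diff[OF lin])
    qed
    have orth': "g x w (es ! i) = 0" if "i < length es" for i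
      using orth[OF that] sym[of w "es ! i"] by simp
    show ?case
    proof (cases "w = 0")
      case True
      then have "span (insert a B) = span B" using span_w span by (simp add: span_insert_0)
      then show ?thesis using es by auto
    next
      case False
      define c where "c = 1 / sqrt (g x w w)"
      have c: "c \<noteq> 0" "c * c * g x w w = 1"
      proof -
        have "0 < g x w w" by (rule pos[OF False])
        then show "c \<noteq> 0" by (simp add: c_def)
        have "c * c = 1 / (sqrt (g x w w) * sqrt (g x w w))" by (simp add: c_def)
        then show "c * c * g x w w = 1" using \<open>0 < g x w w\<close> by simp
      qed
      have "orthonormal_basis g x (span (insert a B)) (es @ [c *\<^sub>R w])"
        unfolding orthonormal_basis_def
      proof (intro conjI allI impI)
        have "span (insert (c *\<^sub>R w) (set es)) = span (insert w (set es))"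
          unfolding span_eq
        proof (intro conjI subsetI)
          fix v assume "v \<in> insert w (set es)"
          moreover have "(1 / c) *\<^sub>R (c *\<^sub>R w) \<in> span (insert (c *\<^sub>R w) (set es))"
            by (intro span_scale span_base) simp
          ultimately show "v \<in> span (insert (c *\<^sub>R w) (set es))"
            using c(1) by (auto intro: span_base)
        qed (auto intro: span_base intro!: span_scale)
        then show "span (set (es @ [c *\<^sub>R w])) = span (insert a B)" using span_w by simp
      next
        fix i j assume "i < length (es @ [c *\<^sub>R w])" "j < length (es @ [c *\<^sub>R w])"
        then consider "i < length es" "j < length es" | "i < length es" "j = length es"
          | "i = length es" "j < length es" | "i = length es" "j = length es" by force
        then show "g x ((es @ [c *\<^sub>R w]) ! i) ((es @ [c *\<^sub>R w]) ! j) = (if i = j then 1 else 0)"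
        proof cases
          case 1 then show ?thesis using on[OF 1] by (simp add: nth_append)
        next
          case 2 then show ?thesis using orth[OF 2(1)] by (simp add: nth_append bilinear_rmul[OF bil])
        next
          case 3 then show ?thesis using orth'[OF 3(2)] by (simp add: nth_append bilinear_lmul[OF bil])
        next
          case 4 then show ?thesis using c(2)
            by (simp add: nth_append bilinear_lmul[OF bil] bilinear_rmul[OF bil] mult.assoc)
        qed
      qed
      then show ?thesis by blast
    qed
  qed
  moreover obtain B where B: "B \<subseteq> E" "independent B" "E \<subseteq> span B"
    using basis_exists[of E] by metis
  moreover have "finite B" by (rule independent_imp_finite[OF B(2)])
  moreover have "span B = E" by (rule span_subspace[OF B(1,3) E])
  ultimately show ?thesis by metis
qed

section \<open>Uniform estimates near compact sets\<close>

lemma one_div_mono: "0 < s \<Longrightarrow> s \<le> r \<Longrightarrow> 1 / r \<le> 1 / (s::real)"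
  by (intro divide_left_mono mult_pos_pos) auto

text \<open>Stronger than uniform continuity on \<open>K\<close>: only one of the two points lies in
  \<open>K\<close>, and \<open>d\<close> also keeps the other one inside the domain. This is needed
  because points near an orbit in \<open>Q\<close> usually lie outside \<open>Q\<close>.\<close>

lemma near_compact_uniform_cont:
  fixes f :: "'a::metric_space \<Rightarrow> 'b::metric_space"
  assumes K: "compact K" "K \<subseteq> D" and D: "open D" and f: "continuous_on D f" and e: "0 < e"
  shows "\<exists>d>0. \<forall>x\<in>K. \<forall>y. dist y x < d \<longrightarrow> y \<in> D \<and> dist (f y) (f x) < e"
proof (rule compact_uniform[OF K(1), where P = "\<lambda>x d. \<forall>y. dist y x < d \<longrightarrow> y \<in> D \<and> dist (f y) (f x) < e"])
  fix x0 assume "x0 \<in> K"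
  then have x0: "x0 \<in> D" using K by auto
  obtain d1 where d1: "0 < d1" "ball x0 d1 \<subseteq> D" using D x0 openE by blast
  have "isCont f x0" using f D x0 by (simp add: continuous_on_eq_continuous_at)
  then obtain d2 where d2: "0 < d2" "\<And>y. dist y x0 < d2 \<Longrightarrow> dist (f y) (f x0) < e / 2"
    unfolding continuous_at_eps_delta using e half_gt_zero by metis
  let ?d = "min d1 d2 / 2"
  have "y \<in> D \<and> dist (f y) (f x) < e" if "x \<in> ball x0 ?d \<inter> K" "dist y x < ?d" for x y
  proof -
    have x: "dist x x0 < ?d" using that by (simp add: dist_commute)
    have y: "dist y x0 < min d1 d2" using dist_triangle[of y x0 x] x that(2) by linarith
    then have "y \<in> D" using d1 by (auto simp: dist_commute)
    moreover have "dist (f y) (f x0) < e / 2" "dist (f x) (f x0) < e / 2"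
      using d2 x y d1(1) by auto
    then have "dist (f y) (f x) < e" using dist_triangle2[of "f y" "f x" "f x0"] by linarith
    ultimately show ?thesis by blast
  qed
  moreover have "0 < ?d" using d1 d2 by simp
  ultimately show "\<exists>U r. open U \<and> x0 \<in> U \<and> 0 < r \<and>
      (\<forall>q\<in>U \<inter> K. \<forall>y. dist y q < r \<longrightarrow> y \<in> D \<and> dist (f y) (f q) < e)"
    by (intro exI[of _ "ball x0 ?d"] exI[of _ ?d]) auto
qed auto

lemma near_compact_bounds:
  fixes h :: "'a::metric_space \<Rightarrow> real"
  assumes K: "compact K" "K \<subseteq> D" and D: "open D" and h: "continuous_on D h"
    and pos: "\<And>y. y \<in> D \<Longrightarrow> 0 < h y"
  shows "\<exists>d>0. \<forall>x\<in>K. \<forall>y. dist y x < d \<longrightarrow> y \<in> D \<and> d \<le> h y \<and> h y \<le> 1 / d"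
proof (rule compact_uniform[OF K(1), where P = "\<lambda>x d. \<forall>y. dist y x < d \<longrightarrow> y \<in> D \<and> d \<le> h y \<and> h y \<le> 1 / d"])
  fix x0 assume "x0 \<in> K"
  then have x0: "x0 \<in> D" using K by auto
  define m where "m = h x0 / 2"
  have m: "0 < m" using pos[OF x0] by (simp add: m_def)
  obtain d where d: "0 < d" "\<And>y. dist y x0 < d \<Longrightarrow> y \<in> D \<and> dist (h y) (h x0) < m"
    using near_compact_uniform_cont[of "{x0}" D h m] x0 D h m by auto
  \<comment> \<open>Near \<open>x0\<close> the values of \<open>h\<close> lie between
    \<open>m\<close> and \<open>3 * m\<close>, so \<open>?r\<close> has to be at most
    \<open>m\<close> and at most \<open>1 / (3 * m)\<close>.\<close>
  let ?r = "min (d / 2) (min m (1 / (3 * m)))"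
  have "y \<in> D \<and> ?r \<le> h y \<and> h y \<le> 1 / ?r" if "x \<in> ball x0 (d / 2) \<inter> K" "dist y x < ?r" for x y
  proof -
    have "dist y x0 < d" using dist_triangle[of y x0 x] that by (auto simp: dist_commute)
    then have "y \<in> D" "\<bar>h y - 2 * m\<bar> < m" using d(2) by (auto simp: dist_real_def m_def)
    then have "m \<le> h y" "h y \<le> 3 * m" by linarith+
    moreover have "3 * m \<le> 1 / ?r"
    proof -
      have "0 < ?r" "?r \<le> 1 / (3 * m)" using d m by auto
      then have "1 / (1 / (3 * m)) \<le> 1 / ?r" by (intro divide_left_mono mult_pos_pos) (use m in auto)
      then show ?thesis by simp
    qed
    ultimately show ?thesis using \<open>y \<in> D\<close> by auto
  qed
  moreover have "0 < ?r" using d m by simp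
  ultimately show "\<exists>U r. open U \<and> x0 \<in> U \<and> 0 < r \<and>
      (\<forall>q\<in>U \<inter> K. \<forall>y. dist y q < r \<longrightarrow> y \<in> D \<and> r \<le> h y \<and> h y \<le> 1 / r)"
    using d(1) by (intro exI[of _ "ball x0 (d / 2)"] exI[of _ ?r]) auto
next
  fix q and r s :: real
  assume *: "\<forall>y. dist y q < r \<longrightarrow> y \<in> D \<and> r \<le> h y \<and> h y \<le> 1 / r" and s: "0 < s" "s \<le> r"
  have "1 / r \<le> 1 / s" using s by (intro divide_left_mono mult_pos_pos) auto
  then show "\<forall>y. dist y q < s \<longrightarrow> y \<in> D \<and> s \<le> h y \<and> h y \<le> 1 / s"
    using * s by (meson le_less_trans less_le_trans order_trans)
qed

text \<open>Continuity of derivatives and projections is available for each fixed vector only; the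
  sum over a basis turns it into a locally bounded operator norm.\<close>

lemma linear_norm_le_sum_Basis:
  fixes L :: "'a::euclidean_space \<Rightarrow> 'b::real_normed_vector"
  assumes "linear L"
  shows "norm (L v) \<le> (\<Sum>u\<in>Basis. norm (L u)) * norm v"
proof -
  have "L v = (\<Sum>u\<in>Basis. (v \<bullet> u) *\<^sub>R L u)"
    by (subst euclidean_representation[of v, symmetric]) (simp only: linear_sum[OF assms] linear_cmul[OF assms])
  also have "norm \<dots> \<le> (\<Sum>u\<in>Basis. norm v * norm (L u))"
    by (rule sum_norm_le) (simp add: Basis_le_norm mult_right_mono)
  finally show ?thesis by (simp add: sum_distrib_left mult.commute)
qed

locale riemannian = smooth_manifold A for A :: "('m::{metric_space, second_countable_topology}, 'n::finite) chart set" +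
  fixes g :: "('m, 'n) metric_tensor"
  assumes metric: "riemannian_metric A g"
begin

lemma bilinear_metric: "bilinear (g x)" and metric_sym: "g x u v = g x v u"
  and metric_pos: "v \<noteq> 0 \<Longrightarrow> 0 < g x v v"
  using metric by (auto simp: riemannian_metric_def)

lemma tnorm_scale: "tnorm g x (a *\<^sub>R v) = \<bar>a\<bar> * tnorm g x v"
  using bilinear_metric[of x] by (simp add: tnorm_def bilinear_lmul bilinear_rmul real_sqrt_mult mult.assoc[symmetric])

lemma continuous_metric: "c \<in> A \<Longrightarrow> continuous_on (snd c ` fst c) (\<lambda>z. metric_in_chart A g c z u v)"
proof -
  assume "c \<in> A"
  then have "Ck_on 0 (snd c ` fst c) (\<lambda>z. metric_in_chart A g c z u v)"
    using metric unfolding riemannian_metric_def by blast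
  then show ?thesis by simp
qed

lemma metric_at_chart:
  "c \<in> A \<Longrightarrow> x \<in> fst c \<Longrightarrow> metric_in_chart A g c (snd c x) u v = g x (from_coords A c x u) (from_coords A c x v)"
  using inv_chart_chart[OF chart] by (simp add: metric_in_chart_def Let_def)

lemma
  assumes c: "c \<in> A" and z: "z \<in> snd c ` fst c"
  shows bilinear_metric_in_chart: "bilinear (metric_in_chart A g c z)"
    and metric_in_chart_pos: "v \<noteq> 0 \<Longrightarrow> 0 < metric_in_chart A g c z v v"
proof -
  define x where "x = inv_chart c z"
  have x: "x \<in> fst c" unfolding x_def by (rule inv_chart_in[OF chart[OF c] z])
  have m: "metric_in_chart A g c z = (\<lambda>u v. g x (from_coords A c x u) (from_coords A c x v))"
    by (simp add: metric_in_chart_def x_def Let_def fun_eq_iff)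
  have lin: "linear (from_coords A c x)" by (rule linear_coords[OF c x])
  have gl: "linear (g x u)" "linear (\<lambda>u. g x u v)" for u v
    using bilinear_metric[of x] by (auto simp: bilinear_def)
  show "bilinear (metric_in_chart A g c z)"
    unfolding bilinear_def m
    using linear_compose[OF lin gl(1)] linear_compose[OF lin gl(2)] by (auto simp: o_def)
  assume "v \<noteq> 0"
  then have "from_coords A c x v \<noteq> 0"
    using to_from_coords(1)[OF c x, of v] linear_0[OF linear_coords(1)[OF c x]] by auto
  then show "0 < metric_in_chart A g c z v v" unfolding m by (rule metric_pos)
qed

definition density :: "('m, 'n) chart \<Rightarrow> real^'n \<Rightarrow> real" where
  "density c z = sqrt (Determinants.det (\<chi> i j. metric_in_chart A g c z (axis i 1) (axis j 1)))"

lemma density_uniform: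
  assumes c: "c \<in> A" and K: "compact K" "K \<subseteq> fst c"
  shows "\<exists>d>0. \<forall>x\<in>K. \<forall>z. dist z (snd c x) < d \<longrightarrow>
    z \<in> snd c ` fst c \<and> d \<le> density c z \<and> density c z \<le> 1 / d"
proof -
  have "compact (snd c ` K)"
    using compact_continuous_image continuous_on_subset[OF continuous_chart[OF chart[OF c]] K(2)] K(1) by blast
  moreover have "continuous_on (snd c ` fst c) (density c)"
    unfolding density_def Determinants.det_def
    by (auto intro!: continuous_intros continuous_metric[OF c])
  moreover have "0 < density c z" if "z \<in> snd c ` fst c" for z
    unfolding density_def
    using gram_det_pos[OF bilinear_metric_in_chart[OF c that] metric_in_chart_pos[OF c that]] by simp
  ultimately have "\<exists>d>0. \<forall>x\<in>snd c ` K. \<forall>z. dist z x < d \<longrightarrow>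
      z \<in> snd c ` fst c \<and> d \<le> density c z \<and> density c z \<le> 1 / d"
    using K(2) by (intro near_compact_bounds open_chart_image chart c) auto
  then show ?thesis by auto
qed

text \<open>All terms are homogeneous in \<open>v\<close>, so compactness of the product of the
  coordinate image of \<open>K\<close> with the unit sphere suffices. Excluding \<open>v = 0\<close>
  from the domain of \<open>h\<close> makes \<open>h\<close> positive.\<close>

lemma tnorm_uniform:
  assumes c: "c \<in> A" and K: "compact K" "K \<subseteq> fst c"
  shows "\<exists>d>0. \<forall>x\<in>K. \<forall>v. d * norm v \<le> tnorm g x (from_coords A c x v) \<and>
    tnorm g x (from_coords A c x v) \<le> 1 / d * norm v"
proof -
  let ?I = "snd c ` fst c"
  define h where "h = (\<lambda>(z, v). sqrt (metric_in_chart A g c z v v))"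
  have "continuous_on (?I \<times> - {0}) (\<lambda>p. \<Sum>i\<in>UNIV. \<Sum>j\<in>UNIV.
      snd p $ i * snd p $ j * metric_in_chart A g c (fst p) (axis i 1) (axis j 1))"
    by (intro continuous_intros continuous_on_compose2[OF continuous_metric[OF c]]) auto
  then have "continuous_on (?I \<times> - {0}) (\<lambda>p. sqrt (\<Sum>i\<in>UNIV. \<Sum>j\<in>UNIV.
      snd p $ i * snd p $ j * metric_in_chart A g c (fst p) (axis i 1) (axis j 1)))"
    by (rule continuous_on_real_sqrt)
  moreover have "(\<Sum>i\<in>UNIV. \<Sum>j\<in>UNIV. snd p $ i * snd p $ j * metric_in_chart A g c (fst p) (axis i 1) (axis j 1))
      = metric_in_chart A g c (fst p) (snd p) (snd p)" if "p \<in> ?I \<times> - {0}" for p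
    using that by (intro bilinear_expand[symmetric] bilinear_metric_in_chart c) auto
  ultimately have cont: "continuous_on (?I \<times> - {0}) h"
    by (subst continuous_on_cong[OF refl]) (auto simp: h_def case_prod_unfold)
  have "compact (snd c ` K)"
    using compact_continuous_image continuous_on_subset[OF continuous_chart[OF chart[OF c]] K(2)] K(1) by blast
  then have "compact (snd c ` K \<times> sphere (0::real^'n) 1)" by (intro compact_Times) auto
  moreover have "snd c ` K \<times> sphere (0::real^'n) 1 \<subseteq> ?I \<times> - {0}" using K(2) by auto
  moreover have "open (?I \<times> - {0::real^'n})" using open_chart_image[OF chart[OF c]] by (intro open_Times) auto
  moreover have "0 < h p" if "p \<in> ?I \<times> - {0}" for p
    using that metric_in_chart_pos[OF c, of "fst p" "snd p"] by (simp add: h_def mem_Times_iff case_prod_unfold)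
  ultimately obtain d where d: "0 < d" "\<And>p. p \<in> snd c ` K \<times> sphere 0 1 \<Longrightarrow> d \<le> h p \<and> h p \<le> 1 / d"
    using near_compact_bounds[OF _ _ _ cont] by (metis dist_self)
  have "d * norm v \<le> tnorm g x (from_coords A c x v) \<and> tnorm g x (from_coords A c x v) \<le> 1 / d * norm v"
    if x: "x \<in> K" for x v
  proof (cases "v = 0")
    case True
    then show ?thesis
      using tnorm_scale[of x 0 0] K(2) x linear_0[OF linear_coords(2)[OF c]] by auto
  next
    case False
    define u where "u = (1 / norm v) *\<^sub>R v"
    have v: "v = norm v *\<^sub>R u" and u: "norm u = 1" using False by (auto simp: u_def)
    have "h (snd c x, u) = tnorm g x (from_coords A c x u)"
      using metric_at_chart[OF c] K(2) x by (auto simp: h_def tnorm_def)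
    moreover have "tnorm g x (from_coords A c x v) = norm v * tnorm g x (from_coords A c x u)"
      using K(2) x by (subst v) (simp add: linear_cmul[OF linear_coords(2)[OF c]] tnorm_scale subset_iff)
    moreover have "d \<le> h (snd c x, u)" "h (snd c x, u) \<le> 1 / d" using d(2)[of "(snd c x, u)"] x u by auto
    ultimately show ?thesis
      using mult_left_mono[of d "h (snd c x, u)" "norm v"] mult_left_mono[of "h (snd c x, u)" "1 / d" "norm v"]
      by (simp add: mult.commute)
  qed
  then show ?thesis using d(1) by blast
qed

end

context smooth_manifold
begin

text \<open>The parameter \<open>r\<close> bounds both the radius and, through \<open>1 / r\<close>, the Lipschitz constant of the derivative,
  so that a property which is monotone in one parameter has to be made uniform.\<close>

lemma step_uniform:
  fixes f :: "'m \<Rightarrow> 'b::metric_space \<Rightarrow> 'm"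
  assumes c: "c \<in> A" "d \<in> A" and S: "compact S" "S \<subseteq> {(b, x). x \<in> fst c \<and> f x b \<in> fst d}"
    and cont: "continuous_on UNIV (\<lambda>(b, x). f x b)"
    and C2: "\<And>b. C2_map A (\<lambda>x. f x b)" and deriv: "derivatives_continuous A f"
  defines "D \<equiv> \<lambda>b z. frechet_derivative (local_rep c d (\<lambda>x. f x b)) (at z)"
  shows "\<exists>r>0. \<forall>p\<in>S. \<forall>z. dist z (snd c (snd p)) < r \<longrightarrow>
      z \<in> snd c ` fst c \<and> f (inv_chart c z) (fst p) \<in> fst d \<and>
      (\<forall>v. norm (D (fst p) z v - D (fst p) (snd c (snd p)) v) \<le> 1 / r * dist z (snd c (snd p)) * norm v)"
proof (rule compact_uniform[OF S(1), where P = "\<lambda>p r. \<forall>z. dist z (snd c (snd p)) < r \<longrightarrow>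
      z \<in> snd c ` fst c \<and> f (inv_chart c z) (fst p) \<in> fst d \<and>
      (\<forall>v. norm (D (fst p) z v - D (fst p) (snd c (snd p)) v) \<le> 1 / r * dist z (snd c (snd p)) * norm v)"])
  fix p0 assume "p0 \<in> S"
  then obtain b0 x0 where p0: "p0 = (b0, x0)" "x0 \<in> fst c" "f x0 b0 \<in> fst d" using S(2) by (cases p0) auto
  let ?I = "snd c ` fst c"
  note cc = chart[OF c(1)] and cd = chart[OF c(2)]
  define W where "W = {(b, z). z \<in> ?I \<and> f (inv_chart c z) b \<in> fst d}"
  define z0 where "z0 = snd c x0"
  define DD where "DD u v b z = frechet_derivative (\<lambda>z. D b z u) (at z) v" for u v b z
  have W_open: "open W"
  proof -
    have "continuous_on (UNIV \<times> ?I) (\<lambda>p. inv_chart c (snd p))"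
      by (rule continuous_on_compose2[OF continuous_inv_chart[OF cc] continuous_on_snd[OF continuous_on_id]]) auto
    then have "continuous_on (UNIV \<times> ?I) (\<lambda>p :: 'b \<times> _. (fst p, inv_chart c (snd p)))"
      by (intro continuous_on_Pair continuous_on_fst continuous_on_id)
    then have "continuous_on (UNIV \<times> ?I) (\<lambda>(b, z). f (inv_chart c z) b)"
      using continuous_on_compose2[OF cont, of "UNIV \<times> ?I" "\<lambda>p. (fst p, inv_chart c (snd p))"]
      by (simp add: case_prod_unfold)
    then have "open ((UNIV \<times> ?I) \<inter> (\<lambda>(b, z). f (inv_chart c z) b) -` fst d)"
      by (intro continuous_open_preimage open_Times open_chart_image open_chart_dom cc cd) auto
    moreover have "(UNIV \<times> ?I) \<inter> (\<lambda>(b, z). f (inv_chart c z) b) -` fst d = W" by (auto simp: W_def)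
    ultimately show ?thesis by simp
  qed
  have DD_cont: "continuous_on W (\<lambda>(b, z). DD u v b z)" for u v
    using deriv c unfolding derivatives_continuous_def DD_def D_def W_def Let_def by blast
  have W_deriv: "z \<in> snd c ` (fst c \<inter> (\<lambda>x. f x b) -` fst d)" if "(b, z) \<in> W" for b z
    using that inv_chart_in[OF cc] chart_inv_chart[OF cc] unfolding W_def
    by (intro image_eqI[of z _ "inv_chart c z"]) auto
  \<comment> \<open>\<open>h\<close> dominates all second partial derivatives at once and is
    continuous on the open set \<open>W\<close>, so one bound \<open>H\<close> holds near
    \<open>(b0, z0)\<close>, uniformly in the base point.\<close>
  define h where "h = (\<lambda>(b, z). \<Sum>u\<in>(Basis :: (real^'n) set). \<Sum>v\<in>(Basis :: (real^'n) set). norm (DD u v b z))"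
  have h_cont: "continuous_on W h"
    using continuous_on_norm[OF DD_cont] unfolding h_def case_prod_unfold by (intro continuous_on_sum) auto
  define H where "H = h (b0, z0) + 1"
  have h0: "0 \<le> h p" for p by (auto simp: h_def case_prod_unfold intro!: sum_nonneg)
  have H: "0 < H" using h0[of "(b0, z0)"] by (simp add: H_def)
  have "(b0, z0) \<in> W" using p0 inv_chart_chart[OF cc] by (auto simp: W_def z0_def)
  moreover have "open (W \<inter> h -` {..<H})" by (intro continuous_open_preimage h_cont W_open) simp
  ultimately obtain U V where UV: "open U" "open V" "(b0, z0) \<in> U \<times> V" "U \<times> V \<subseteq> W \<inter> h -` {..<H}"
    using open_prod_elim[of "W \<inter> h -` {..<H}" "(b0, z0)"] by (auto simp: H_def)
  then obtain e where e: "0 < e" "ball z0 e \<subseteq> V" by (auto elim: openE)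
  define N where "N = real (card (Basis :: (real^'n) set))"
  have N: "0 < N" by (simp add: N_def)
  \<comment> \<open>The radius \<open>e / 2\<close> keeps both \<open>snd c x\<close> and
    \<open>z\<close> in \<open>ball z0 e\<close>, where the mean value inequality applies;
    \<open>N * H\<close> turns the bounds on the \<open>N\<close> basis vectors into one on all
    vectors.\<close>
  define r where "r = min (e / 2) (1 / (N * H))"
  have r: "0 < r" using e H N by (simp add: r_def)
  have NH: "N * H \<le> 1 / r"
  proof -
    have "r \<le> 1 / (N * H)" by (simp add: r_def)
    then have "1 / (1 / (N * H)) \<le> 1 / r" using r N H by (intro divide_left_mono) auto
    then show ?thesis by simp
  qed
  have main: "z \<in> ?I \<and> f (inv_chart c z) b \<in> fst d \<and>
      (\<forall>v. norm (D b z v - D b (snd c x) v) \<le> 1 / r * dist z (snd c x) * norm v)"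
    if b: "b \<in> U" and x: "x \<in> fst c" "snd c x \<in> ball z0 (e / 2)" and z: "dist z (snd c x) < r" for b x z
  proof -
    have ball: "(b, y) \<in> W" "h (b, y) < H" if "y \<in> ball z0 e" for y
    proof -
      have "y \<in> V" using e(2) that by (rule subsetD)
      then have "(b, y) \<in> W \<inter> h -` {..<H}" by (intro subsetD[OF UV(4)] SigmaI b)
      then show "(b, y) \<in> W" "h (b, y) < H" by simp_all
    qed
    have zx: "snd c x \<in> ball z0 e" using x e(1) by auto
    have zb: "z \<in> ball z0 e"
      using z x(2) dist_triangle[of z0 z "snd c x"] by (auto simp: r_def dist_commute)
    have basis: "norm (D b z u - D b (snd c x) u) \<le> H * dist z (snd c x)" if u: "u \<in> Basis" for u
    proof -
      have "norm ((\<lambda>z. D b z u) z - (\<lambda>z. D b z u) (snd c x)) \<le> H * norm (z - snd c x)"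
      proof (rule differentiable_bound[where S = "ball z0 e" and f' = "\<lambda>z v. DD u v b z"])
        fix y assume y: "y \<in> ball z0 e"
        have "(\<lambda>z. D b z u) differentiable (at y)"
          unfolding D_def by (rule C2_map_differentiable(2)[OF C2 c W_deriv[OF ball(1)[OF y]]])
        then have der: "((\<lambda>z. D b z u) has_derivative (\<lambda>v. DD u v b y)) (at y)"
          unfolding DD_def using frechet_derivative_works by blast
        then show "((\<lambda>z. D b z u) has_derivative (\<lambda>v. DD u v b y)) (at y within ball z0 e)"
          by (rule has_derivative_at_withinI)
        have "norm (DD u w b y) \<le> H * norm w" for w
        proof -
          have "norm (DD u w b y) \<le> (\<Sum>v\<in>Basis. norm (DD u v b y)) * norm w"
            by (rule linear_norm_le_sum_Basis[OF has_derivative_linear[OF der]])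
          moreover have "(\<Sum>v\<in>Basis. norm (DD u v b y)) \<le> h (b, y)"
            unfolding h_def prod.case
            by (rule member_le_sum[OF u, of "\<lambda>u. \<Sum>v\<in>Basis. norm (DD u v b y)"]) (auto intro: sum_nonneg)
          then have "(\<Sum>v\<in>Basis. norm (DD u v b y)) * norm w \<le> H * norm w"
            using ball(2)[OF y] by (intro mult_right_mono) auto
          ultimately show ?thesis by linarith
        qed
        then show "onorm (\<lambda>v. DD u v b y) \<le> H" by (rule onorm_le)
      qed (use zx zb in auto)
      then show ?thesis by (simp add: dist_norm)
    qed
    have lin: "linear (D b y)" if "y \<in> ball z0 e" for y
    proof -
      have "local_rep c d (\<lambda>x. f x b) differentiable (at y)"
        by (rule C2_map_differentiable(1)[OF C2 c W_deriv[OF ball(1)[OF that]]])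
      then show ?thesis unfolding D_def using frechet_derivative_works has_derivative_linear by blast
    qed
    have linD: "linear (\<lambda>v. D b z v - D b (snd c x) v)" by (intro linear_compose_sub lin zx zb)
    have "norm (D b z v - D b (snd c x) v) \<le> 1 / r * dist z (snd c x) * norm v" for v
    proof -
      have "norm (D b z v - D b (snd c x) v)
          \<le> (\<Sum>u\<in>Basis. norm (D b z u - D b (snd c x) u)) * norm v"
        by (rule linear_norm_le_sum_Basis[OF linD])
      also have "\<dots> \<le> (\<Sum>u\<in>(Basis :: (real^'n) set). H * dist z (snd c x)) * norm v"
        by (intro mult_right_mono sum_mono basis) auto
      also have "\<dots> = (N * H) * dist z (snd c x) * norm v" by (simp add: N_def)
      also have "\<dots> \<le> 1 / r * dist z (snd c x) * norm v" by (intro mult_right_mono NH) auto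
      finally show ?thesis .
    qed
    then show ?thesis using ball(1)[OF zb] by (auto simp: W_def)
  qed
  have "open (fst c \<inter> snd c -` ball z0 (e / 2))"
    by (intro continuous_open_preimage continuous_chart open_chart_dom cc) auto
  moreover have "(b0, x0) \<in> U \<times> (fst c \<inter> snd c -` ball z0 (e / 2))"
    using UV(3) p0 e by (auto simp: z0_def)
  ultimately show "\<exists>U r. open U \<and> p0 \<in> U \<and> 0 < r \<and> (\<forall>p\<in>U \<inter> S. \<forall>z. dist z (snd c (snd p)) < r \<longrightarrow>
      z \<in> snd c ` fst c \<and> f (inv_chart c z) (fst p) \<in> fst d \<and>
      (\<forall>v. norm (D (fst p) z v - D (fst p) (snd c (snd p)) v) \<le> 1 / r * dist z (snd c (snd p)) * norm v))"
    using UV(1) r main p0(1)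
    by (intro exI[of _ "U \<times> (fst c \<inter> snd c -` ball z0 (e / 2))"] exI[of _ r]) (auto intro: open_Times)
next
  fix p and r s :: real
  assume *: "\<forall>z. dist z (snd c (snd p)) < r \<longrightarrow>
      z \<in> snd c ` fst c \<and> f (inv_chart c z) (fst p) \<in> fst d \<and>
      (\<forall>v. norm (D (fst p) z v - D (fst p) (snd c (snd p)) v) \<le> 1 / r * dist z (snd c (snd p)) * norm v)"
    and s: "0 < s" "s \<le> r"
  have le: "1 / r \<le> 1 / s" using s by (intro divide_left_mono mult_pos_pos) auto
  show "\<forall>z. dist z (snd c (snd p)) < s \<longrightarrow>
      z \<in> snd c ` fst c \<and> f (inv_chart c z) (fst p) \<in> fst d \<and>
      (\<forall>v. norm (D (fst p) z v - D (fst p) (snd c (snd p)) v) \<le> 1 / s * dist z (snd c (snd p)) * norm v)"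
  proof (intro allI impI conjI)
    fix z v assume "dist z (snd c (snd p)) < s"
    then have z: "dist z (snd c (snd p)) < r" using s by simp
    then show "z \<in> snd c ` fst c" "f (inv_chart c z) (fst p) \<in> fst d" using * by blast+
    have "norm (D (fst p) z v - D (fst p) (snd c (snd p)) v) \<le> 1 / r * dist z (snd c (snd p)) * norm v"
      using * z by blast
    also have "\<dots> \<le> 1 / s * dist z (snd c (snd p)) * norm v" by (intro mult_right_mono le) auto
    finally show "norm (D (fst p) z v - D (fst p) (snd c (snd p)) v) \<le> 1 / s * dist z (snd c (snd p)) * norm v" .
  qed
qed

end

section \<open>Skew products and adapted frames\<close>

lemma proj_along_eq:
  assumes E: "subspace E" "subspace F" "E \<inter> F = {0}" and u: "u \<in> E" "w \<in> F"
  shows "proj_along E F (u + w) = u"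
  unfolding proj_along_def
proof (rule the_equality)
  fix u' assume u': "u' \<in> E \<and> u + w - u' \<in> F"
  have "(u + w - u') - w \<in> F" using u' u E subspace_diff by blast
  moreover have "u - u' \<in> E" using u' u E subspace_diff by blast
  ultimately have "u - u' \<in> E \<inter> F" by simp
  then show "u' = u" using E by simp
qed (use u in simp)

locale hyperbolic_skew_product = riemannian A g
  for A :: "('m::{metric_space, second_countable_topology}, 'n::finite) chart set" and g :: "('m, 'n) metric_tensor" +
  fixes \<theta> :: "'b::metric_space \<Rightarrow> 'b" and \<phi> :: "int \<Rightarrow> 'm \<Rightarrow> 'b \<Rightarrow> 'm" and Q :: "'m set"
    and Em Ep :: "'b \<times> 'm \<Rightarrow> (real^'n) set" and lam :: real and dp :: nat
  assumes compact_base: "compact (UNIV :: 'b set)" and skew: "skew_product A \<theta> \<phi>"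
    and compact_Q: "compact Q" and hyp: "hyperbolic_splitting A g \<theta> \<phi> (lift \<phi> Q) Em Ep 1 lam"
    and dim_Ep: "p \<in> lift \<phi> Q \<Longrightarrow> dim (Ep p) = dp"
begin

lemma lam: "0 < lam" "lam < 1"
  using hyp by (auto simp: hyperbolic_splitting_def)

lemma C2_phi: "C2_map A (\<lambda>x. \<phi> k x b)"
  using skew by (simp add: skew_product_def C2_diffeomorphism_def)

lemma continuous_phi: "continuous_on UNIV (\<lambda>(b, x). \<phi> k x b)"
  using skew by (simp add: skew_product_def)

lemma derivatives_continuous_phi: "derivatives_continuous A (\<phi> k)"
  using skew by (simp add: skew_product_def)

definition base :: "nat \<Rightarrow> 'b \<Rightarrow> 'b" where "base n b = int_iterate \<theta> (int n) b"

lemma skew_eq: "skew \<theta> \<phi> (int n) (b, x) = (base n b, \<phi> (int n) x b)"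
  by (simp add: skew_def base_def)

lemma skew_add: "skew \<theta> \<phi> (k + l) p = skew \<theta> \<phi> k (skew \<theta> \<phi> l p)"
  using skew unfolding skew_product_def by (metis comp_apply)

lemma skew_0: "skew \<theta> \<phi> 0 p = p"
  using skew unfolding skew_product_def by simp

lemma phi_0 [simp]: "\<phi> 0 x b = x"
  using skew_0[of "(b, x)"] by (simp add: skew_def)

lemma skew_Suc: "skew \<theta> \<phi> (int (Suc n)) p = skew \<theta> \<phi> 1 (skew \<theta> \<phi> (int n) p)"
  using skew_add[of 1 "int n" p] by simp

lemma phi_Suc: "\<phi> (int (Suc n)) x b = \<phi> 1 (\<phi> (int n) x b) (base n b)"
  using skew_Suc[of n "(b, x)"] by (simp add: skew_def base_def)

lemma lift_skew: "p \<in> lift \<phi> Q \<Longrightarrow> skew \<theta> \<phi> k p \<in> lift \<phi> Q"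
proof -
  assume p: "p \<in> lift \<phi> Q"
  have "\<phi> j (snd (skew \<theta> \<phi> k p)) (fst (skew \<theta> \<phi> k p)) = snd (skew \<theta> \<phi> (j + k) p)" for j
    unfolding skew_add[of j k p] by (simp add: skew_def case_prod_unfold)
  moreover have "snd (skew \<theta> \<phi> j p) \<in> Q" for j
    using p by (auto simp: skew_def lift_def)
  ultimately show ?thesis by (simp add: lift_def case_prod_unfold)
qed

lemma snd_lift: "p \<in> lift \<phi> Q \<Longrightarrow> snd p \<in> Q"
proof -
  assume "p \<in> lift \<phi> Q"
  then have "\<phi> 0 (snd p) (fst p) \<in> Q" unfolding lift_def mem_Collect_eq case_prod_unfold by (rule spec)
  then show ?thesis by simp
qed

text \<open>An intersection of closed conditions, one for each time, inside the compact set
  \<open>UNIV \<times> Q\<close>.\<close>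

lemma compact_lift: "compact (lift \<phi> Q)"
proof -
  have "closed ((\<lambda>(b, x). \<phi> k x b) -` Q)" for k
    by (rule closed_vimage[OF compact_imp_closed[OF compact_Q] continuous_phi])
  then have "closed (\<Inter>k. (\<lambda>(b, x). \<phi> k x b) -` Q)" by blast
  moreover have "(\<Inter>k. (\<lambda>(b, x). \<phi> k x b) -` Q) = lift \<phi> Q" by (auto simp: lift_def)
  ultimately have "closed (lift \<phi> Q)" by simp
  moreover have "lift \<phi> Q \<subseteq> UNIV \<times> Q" using snd_lift by force
  ultimately show ?thesis
    using compact_Int_closed[OF compact_Times[OF compact_base compact_Q]] by (metis inf.absorb2)
qed

lemma splitting:
  assumes "p \<in> lift \<phi> Q"
  shows "subspace (Em p)" "subspace (Ep p)" "Em p \<inter> Ep p = {0}" "\<exists>u\<in>Em p. \<exists>w\<in>Ep p. v = u + w"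
  using assms hyp unfolding hyperbolic_splitting_def is_splitting_def by auto

lemma dim_Em:
  assumes p: "p \<in> lift \<phi> Q"
  shows "dim (Em p) + dp = CARD('n)"
proof -
  have "{x + y |x y. x \<in> Em p \<and> y \<in> Ep p} = UNIV" using splitting(4)[OF p] by blast
  then show ?thesis
    using dim_sums_Int[OF splitting(1,2)[OF p]] splitting(3)[OF p] dim_Ep[OF p] by simp
qed

end

text \<open>Choices made once for the whole lift. \<open>\<delta>\<close> is a Lebesgue number of
  the finite chart cover \<open>F\<close>. The set \<open>I\<close> and the enumerations
  \<open>hp\<close>, \<open>hm\<close> label the basis vectors of the two subspaces by coordinates;
  constant dimensions allow the same labels at every point, so that all step maps share one fixed
  coordinate splitting.\<close>

locale hyperbolic_frames = hyperbolic_skew_product A g \<theta> \<phi> Q Em Ep lam dp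
  for A :: "('m::{metric_space, second_countable_topology}, 'n::finite) chart set" and g :: "('m, 'n) metric_tensor"
    and \<theta> :: "'b::metric_space \<Rightarrow> 'b" and \<phi> :: "int \<Rightarrow> 'm \<Rightarrow> 'b \<Rightarrow> 'm" and Q :: "'m set"
    and Em Ep :: "'b \<times> 'm \<Rightarrow> (real^'n) set" and lam :: real and dp :: nat +
  fixes F :: "('m, 'n) chart set" and \<delta> :: real
    and I :: "'n well_ordered set" and hp hm :: "'n well_ordered \<Rightarrow> nat"
  assumes F: "finite F" "F \<subseteq> A" and \<delta>: "0 < \<delta>" "x \<in> Q \<Longrightarrow> \<exists>c\<in>F. ball x \<delta> \<subseteq> fst c"
    and hp: "bij_betw hp I {0..<dp}" and hm: "bij_betw hm (- I) {0..<CARD('n) - dp}"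
begin

text \<open>The same choice of bases as in \<^const>\<open>abs_det\<close>, so that the matrix of the cocycle in adapted frames has
  exactly the determinant of the statement.\<close>

definition es where "es p = (SOME es. orthonormal_basis g (snd p) (Ep p) es)"
definition em where "em p = (SOME es. orthonormal_basis g (snd p) (Em p) es)"

lemma es: "p \<in> lift \<phi> Q \<Longrightarrow> orthonormal_basis g (snd p) (Ep p) (es p)"
  unfolding es_def
  using exists_orthonormal_basis[of g "snd p" "Ep p", OF bilinear_metric metric_sym metric_pos splitting(2)]
  by (metis (no_types, lifting) someI_ex)

lemma em: "p \<in> lift \<phi> Q \<Longrightarrow> orthonormal_basis g (snd p) (Em p) (em p)"
  unfolding em_def
  using exists_orthonormal_basis[of g "snd p" "Em p", OF bilinear_metric metric_sym metric_pos splitting(1)]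
  by (metis (no_types, lifting) someI_ex)

lemma length_es: "p \<in> lift \<phi> Q \<Longrightarrow> length (es p) = dp"
  using orthonormal_basis_length[OF bilinear_metric es] dim_Ep by metis

lemma length_em: "p \<in> lift \<phi> Q \<Longrightarrow> length (em p) = CARD('n) - dp"
  using orthonormal_basis_length[OF bilinear_metric em] dim_Em by (metis add_diff_cancel_right')

definition fr :: "'b \<times> 'm \<Rightarrow> 'n well_ordered \<Rightarrow> real^'n" where
  "fr p i = (if i \<in> I then es p ! hp i else em p ! hm i)"

text \<open>An isometry on each coordinate block by \<open>tnorm_S\<close>, but not on their sum,
  since \<open>Em p\<close> and \<open>Ep p\<close> need not be orthogonal. Nothing relates the
  frames at different points.\<close>

definition S :: "'b \<times> 'm \<Rightarrow> real^'n well_ordered \<Rightarrow> real^'n" where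
  "S p v = (\<Sum>i\<in>UNIV. v $ i *\<^sub>R fr p i)"

lemma hp_less: "i \<in> I \<Longrightarrow> hp i < dp" and hm_less: "i \<notin> I \<Longrightarrow> hm i < CARD('n) - dp"
  using hp hm by (auto simp: bij_betw_def)

lemma fr_orthonormal:
  assumes p: "p \<in> lift \<phi> Q" and ij: "i \<in> J" "j \<in> J" and J: "J = I \<or> J = - I"
  shows "g (snd p) (fr p i) (fr p j) = (if i = j then 1 else 0)"
  using J
proof
  assume "J = I"
  then have "g (snd p) (es p ! hp i) (es p ! hp j) = (if hp i = hp j then 1 else 0)"
    using es[OF p] ij length_es[OF p] hp_less by (simp add: orthonormal_basis_def)
  moreover have "hp i = hp j \<longleftrightarrow> i = j"
    using hp ij \<open>J = I\<close> by (auto simp: bij_betw_def inj_on_def)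
  ultimately show ?thesis using \<open>J = I\<close> ij by (simp add: fr_def)
next
  assume J: "J = - I"
  then have "g (snd p) (em p ! hm i) (em p ! hm j) = (if hm i = hm j then 1 else 0)"
    using em[OF p] ij length_em[OF p] hm_less by (simp add: orthonormal_basis_def)
  moreover have "hm i = hm j \<longleftrightarrow> i = j"
    using hm ij J by (auto simp: bij_betw_def inj_on_def)
  ultimately show ?thesis using J ij by (simp add: fr_def)
qed

lemma linear_S: "linear (S p)"
  unfolding S_def by (rule linearI) (simp_all add: scaleR_add_left sum.distrib scaleR_sum_right)

lemma S_cproj: "S p (cproj J v) = (\<Sum>i\<in>J. v $ i *\<^sub>R fr p i)"
proof -
  have "S p (cproj J v) = (\<Sum>i\<in>UNIV. if i \<in> J then v $ i *\<^sub>R fr p i else 0)"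
    unfolding S_def by (rule sum.cong) (auto simp: cproj_def)
  then show ?thesis by (simp add: sum.inter_restrict[symmetric])
qed

lemma metric_S_fr:
  assumes p: "p \<in> lift \<phi> Q" and i: "i \<in> J" and J: "J = I \<or> J = - I"
  shows "g (snd p) (fr p i) (S p (cproj J v)) = v $ i"
proof -
  have lin: "linear (g (snd p) u)" for u using bilinear_metric[of "snd p"] by (simp add: bilinear_def)
  have "g (snd p) (fr p i) (S p (cproj J v)) = (\<Sum>j\<in>J. v $ j * g (snd p) (fr p i) (fr p j))"
    by (simp add: S_cproj linear_sum[OF lin] linear_cmul[OF lin])
  also have "\<dots> = (\<Sum>j\<in>J. if i = j then v $ j else 0)"
    by (rule sum.cong) (simp_all add: fr_orthonormal[OF p i _ J])
  also have "\<dots> = v $ i" using i by simp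
  finally show ?thesis .
qed

lemma tnorm_S:
  assumes p: "p \<in> lift \<phi> Q" and J: "J = I \<or> J = - I"
  shows "tnorm g (snd p) (S p (cproj J v)) = norm (cproj J v)"
proof -
  have lin: "linear (\<lambda>u. g (snd p) u w)" for w using bilinear_metric[of "snd p"] by (simp add: bilinear_def)
  have "g (snd p) (S p (cproj J v)) (S p (cproj J v))
      = (\<Sum>i\<in>J. v $ i * g (snd p) (fr p i) (S p (cproj J v)))"
    by (subst S_cproj) (simp add: linear_sum[OF lin] linear_cmul[OF lin])
  also have "\<dots> = (\<Sum>i\<in>J. (v $ i)\<^sup>2)"
    by (rule sum.cong) (simp_all add: metric_S_fr[OF p _ J] power2_eq_square)
  also have "\<dots> = (\<Sum>i\<in>UNIV. (cproj J v $ i)\<^sup>2)"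
    by (rule sum.mono_neutral_cong_left) (auto simp: cproj_def)
  finally show ?thesis by (simp add: tnorm_def norm_vec_def L2_set_def)
qed

lemma S_range:
  assumes p: "p \<in> lift \<phi> Q"
  shows "range (\<lambda>v. S p (cproj I v)) = Ep p" "range (\<lambda>v. S p (cproj (- I) v)) = Em p"
proof -
  have sub: "subspace (range (\<lambda>v. S p (cproj J v)))" for J
    using linear_subspace_image[OF linear_compose[OF linear_cproj linear_S] subspace_UNIV] by (simp add: o_def)
  have fr: "fr p i = S p (cproj J (axis i 1))" if "i \<in> J" for i J
    using that unfolding S_cproj by (simp add: axis_def if_distrib[of "\<lambda>a. a *\<^sub>R _"] cong: if_cong)
  have span: "span (set (es p)) = Ep p" "span (set (em p)) = Em p"
    using es[OF p] em[OF p] by (auto simp: orthonormal_basis_def)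
  show "range (\<lambda>v. S p (cproj I v)) = Ep p"
  proof
    have "fr p i \<in> Ep p" if "i \<in> I" for i
      using that hp_less[OF that] length_es[OF p] unfolding span(1)[symmetric] by (auto simp: fr_def intro: span_base)
    then show "range (\<lambda>v. S p (cproj I v)) \<subseteq> Ep p"
      using splitting(2)[OF p] by (auto simp: S_cproj intro!: subspace_sum subspace_scale)
    have "set (es p) \<subseteq> range (\<lambda>v. S p (cproj I v))"
    proof
      fix e assume "e \<in> set (es p)"
      then obtain k where k: "k < dp" "e = es p ! k" using length_es[OF p] by (auto simp: in_set_conv_nth)
      have "k \<in> hp ` I" using hp k(1) by (simp add: bij_betw_def)
      then obtain i where "i \<in> I" "hp i = k" by blast
      then have "e = fr p i" using k by (simp add: fr_def)
      then show "e \<in> range (\<lambda>v. S p (cproj I v))" using fr[OF \<open>i \<in> I\<close>] by auto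
    qed
    then show "Ep p \<subseteq> range (\<lambda>v. S p (cproj I v))"
      unfolding span(1)[symmetric] by (rule span_minimal[OF _ sub])
  qed
  show "range (\<lambda>v. S p (cproj (- I) v)) = Em p"
  proof
    have "fr p i \<in> Em p" if "i \<in> - I" for i
      using that hm_less[of i] length_em[OF p] unfolding span(2)[symmetric] by (auto simp: fr_def intro: span_base)
    then show "range (\<lambda>v. S p (cproj (- I) v)) \<subseteq> Em p"
      using splitting(1)[OF p] by (auto simp: S_cproj intro!: subspace_sum subspace_scale)
    have "set (em p) \<subseteq> range (\<lambda>v. S p (cproj (- I) v))"
    proof
      fix e assume "e \<in> set (em p)"
      then obtain k where k: "k < CARD('n) - dp" "e = em p ! k" using length_em[OF p] by (auto simp: in_set_conv_nth)
      have "k \<in> hm ` (- I)" using hm k(1) by (simp add: bij_betw_def)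
      then obtain i where i: "i \<in> - I" "hm i = k" by blast
      then have "e = fr p i" using k by (simp add: fr_def)
      then show "e \<in> range (\<lambda>v. S p (cproj (- I) v))" using fr[OF i(1)] by auto
    qed
    then show "Em p \<subseteq> range (\<lambda>v. S p (cproj (- I) v))"
      unfolding span(2)[symmetric] by (rule span_minimal[OF _ sub])
  qed
qed

lemma S_split: "S p v = S p (cproj (- I) v) + S p (cproj I v)"
  by (metis cproj_add_compl linear_add linear_S)

lemma proj_S:
  assumes p: "p \<in> lift \<phi> Q"
  shows "proj_along (Ep p) (Em p) (S p v) = S p (cproj I v)"
    "proj_along (Em p) (Ep p) (S p v) = S p (cproj (- I) v)"
proof -
  have "S p (cproj I v) \<in> Ep p" "S p (cproj (- I) v) \<in> Em p" using S_range[OF p] by auto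
  then have "proj_along (Ep p) (Em p) (S p (cproj I v) + S p (cproj (- I) v)) = S p (cproj I v)"
    "proj_along (Em p) (Ep p) (S p (cproj (- I) v) + S p (cproj I v)) = S p (cproj (- I) v)"
    using splitting(3)[OF p] by (auto intro!: proj_along_eq splitting[OF p])
  then show "proj_along (Ep p) (Em p) (S p v) = S p (cproj I v)"
    "proj_along (Em p) (Ep p) (S p v) = S p (cproj (- I) v)"
    by (simp_all add: S_split[of p v] add.commute)
qed

lemma bij_S:
  assumes p: "p \<in> lift \<phi> Q"
  shows "bij (S p)"
proof -
  have "v = 0" if "S p v = 0" for v
  proof -
    have "S p (cproj J v) = 0" if "J = I \<or> J = - I" for J
      using proj_S[OF p, of v] proj_S[OF p, of 0] \<open>S p v = 0\<close> that
      by (auto simp: linear_0[OF linear_S] cproj_simps)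
    then have "norm (cproj J v) = 0" if "J = I \<or> J = - I" for J
      using tnorm_S[OF p that, of v] that tnorm_scale[of _ 0 0] by simp
    then show ?thesis using cproj_add_compl[of I v] by simp
  qed
  then have "inj (S p)" by (simp add: linear_injective_0[OF linear_S])
  moreover have "w \<in> range (S p)" for w
  proof -
    obtain u v where uv: "u \<in> Em p" "v \<in> Ep p" "w = u + v" using splitting(4)[OF p] by blast
    then obtain u' v' where "u = S p (cproj (- I) u')" "v = S p (cproj I v')" using S_range[OF p] by blast
    then have "w = S p (cproj (- I) u' + cproj I v')" using uv by (simp add: linear_add[OF linear_S])
    then show ?thesis by blast
  qed
  ultimately show ?thesis by (auto simp: bij_def)
qed

section \<open>A finite family of charts\<close>

definition ch :: "'m \<Rightarrow> ('m, 'n) chart" where "ch x = (SOME c. c \<in> F \<and> ball x \<delta> \<subseteq> fst c)"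

definition zc :: "'m \<Rightarrow> real^'n" where "zc x = snd (ch x) x"

text \<open>The Lebesgue number \<open>\<delta>\<close> makes these sets compact, although together they cover \<open>Q\<close>.\<close>

definition core :: "('m, 'n) chart \<Rightarrow> 'm set" where "core c = {x \<in> Q. ball x \<delta> \<subseteq> fst c}"

lemma ch:
  assumes "x \<in> Q"
  shows "ch x \<in> F" "ch x \<in> A" "x \<in> core (ch x)" "x \<in> fst (ch x)"
proof -
  have "\<exists>c. c \<in> F \<and> ball x \<delta> \<subseteq> fst c" using \<delta>(2)[OF assms] by blast
  then have "ch x \<in> F \<and> ball x \<delta> \<subseteq> fst (ch x)" unfolding ch_def by (rule someI_ex)
  then show "ch x \<in> F" "ch x \<in> A" "x \<in> core (ch x)" "x \<in> fst (ch x)"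
    using F(2) assms \<delta>(1) by (auto simp: core_def)
qed

lemma core_subset: "core c \<subseteq> fst c"
  using \<delta>(1) by (auto simp: core_def)

lemma compact_core: "compact (core c)"
proof -
  have "core c = Q \<inter> (\<Inter>y\<in>- fst c. {x. \<delta> \<le> dist x y})" 
  proof (intro equalityI subsetI)
    fix x assume "x \<in> Q \<inter> (\<Inter>y\<in>- fst c. {x. \<delta> \<le> dist x y})"
    then have "x \<in> Q" "\<And>y. y \<notin> fst c \<Longrightarrow> \<not> dist x y < \<delta>" by (auto simp: not_less)
    then show "x \<in> core c" unfolding core_def by (auto simp: subset_iff)
  qed (auto simp: core_def subset_iff not_less[symmetric])
  moreover have "closed (\<Inter>y\<in>- fst c. {x. \<delta> \<le> dist x y})"
    by (intro closed_INT ballI closed_Collect_le continuous_intros)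
  ultimately show ?thesis using compact_Int_closed[OF compact_Q] by simp
qed

text \<open>For a fixed chart the estimates are uniform on its compact core, and \<open>F\<close> is
  finite. This replaces any continuity of the choice \<open>ch\<close>.\<close>

lemma uniform_charts:
  fixes P :: "('m, 'n) chart \<Rightarrow> 'm \<Rightarrow> real \<Rightarrow> bool"
  assumes "\<And>c. c \<in> F \<Longrightarrow> \<exists>r>0. \<forall>x\<in>core c. P c x r"
    and "\<And>c x r s. P c x r \<Longrightarrow> 0 < s \<Longrightarrow> s \<le> r \<Longrightarrow> P c x s"
  shows "\<exists>r>0. \<forall>x\<in>Q. P (ch x) x r"
proof -
  have "\<exists>r>0. \<forall>c\<in>F. \<forall>x\<in>core c. P c x r"
    by (rule finite_uniform[OF F(1)]) (use assms in blast)+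
  then show ?thesis using ch by blast
qed

text \<open>Together with \<open>inv_chart_close\<close> this translates closeness of orbits into
  closeness of coordinates and back, uniformly over \<open>Q\<close>.\<close>

lemma chart_close:
  assumes "0 < \<rho>"
  shows "\<exists>e>0. \<forall>x\<in>Q. \<forall>y. dist y x < e \<longrightarrow> y \<in> fst (ch x) \<and> dist (snd (ch x) y) (zc x) < \<rho>"
  unfolding zc_def
proof (rule uniform_charts[where P = "\<lambda>c x e. \<forall>y. dist y x < e \<longrightarrow> y \<in> fst c \<and> dist (snd c y) (snd c x) < \<rho>"])
  fix c assume "c \<in> F"
  then have c: "is_chart c" using F(2) chart by blast
  show "\<exists>e>0. \<forall>x\<in>core c. \<forall>y. dist y x < e \<longrightarrow> y \<in> fst c \<and> dist (snd c y) (snd c x) < \<rho>"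
    by (rule near_compact_uniform_cont[OF compact_core core_subset open_chart_dom[OF c] continuous_chart[OF c] assms])
qed auto

lemma inv_chart_close:
  assumes "0 < e"
  shows "\<exists>\<rho>>0. \<forall>x\<in>Q. \<forall>z. dist z (zc x) < \<rho> \<longrightarrow> z \<in> snd (ch x) ` fst (ch x) \<and> dist (inv_chart (ch x) z) x < e"
  unfolding zc_def
proof (rule uniform_charts[where P = "\<lambda>c x \<rho>. \<forall>z. dist z (snd c x) < \<rho> \<longrightarrow>
      z \<in> snd c ` fst c \<and> dist (inv_chart c z) x < e"])
  fix c assume "c \<in> F"
  then have c: "is_chart c" using F(2) chart by blast
  have "compact (snd c ` core c)"
    by (rule compact_continuous_image[OF continuous_on_subset[OF continuous_chart[OF c] core_subset] compact_core])
  from near_compact_uniform_cont[OF this image_mono[OF core_subset] open_chart_image[OF c] continuous_inv_chart[OF c] assms]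
  obtain \<rho> where \<rho>: "0 < \<rho>" "\<And>x z. x \<in> snd c ` core c \<Longrightarrow> dist z x < \<rho> \<Longrightarrow>
      z \<in> snd c ` fst c \<and> dist (inv_chart c z) (inv_chart c x) < e" by blast
  have "z \<in> snd c ` fst c \<and> dist (inv_chart c z) x < e" if "x \<in> core c" "dist z (snd c x) < \<rho>" for x z
    using \<rho>(2)[of "snd c x" z] that inv_chart_chart[OF c subsetD[OF core_subset that(1)]] by simp
  then show "\<exists>\<rho>>0. \<forall>x\<in>core c. \<forall>z. dist z (snd c x) < \<rho> \<longrightarrow> z \<in> snd c ` fst c \<and> dist (inv_chart c z) x < e"
    using \<rho>(1) by blast
qed auto

lemma density_close:
  "\<exists>d>0. \<forall>x\<in>Q. \<forall>z. dist z (zc x) < d \<longrightarrow> d \<le> density (ch x) z \<and> density (ch x) z \<le> 1 / d"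
  unfolding zc_def
proof (rule uniform_charts[where P = "\<lambda>c x d. \<forall>z. dist z (snd c x) < d \<longrightarrow> d \<le> density c z \<and> density c z \<le> 1 / d"])
  fix c assume "c \<in> F"
  then have c: "c \<in> A" using F(2) by blast
  obtain d where d: "0 < d" "\<forall>x\<in>core c. \<forall>z. dist z (snd c x) < d \<longrightarrow>
      z \<in> snd c ` fst c \<and> d \<le> density c z \<and> density c z \<le> 1 / d"
    using density_uniform[OF c compact_core core_subset] by auto
  then show "\<exists>d>0. \<forall>x\<in>core c. \<forall>z. dist z (snd c x) < d \<longrightarrow> d \<le> density c z \<and> density c z \<le> 1 / d"
    by (intro exI[of _ d]) simp
next
  fix c x and r s :: real
  assume *: "\<forall>z. dist z (snd c x) < r \<longrightarrow> r \<le> density c z \<and> density c z \<le> 1 / r" and s: "0 < s" "s \<le> r"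
  show "\<forall>z. dist z (snd c x) < s \<longrightarrow> s \<le> density c z \<and> density c z \<le> 1 / s"
  proof (intro allI impI)
    fix z assume "dist z (snd c x) < s"
    then have "r \<le> density c z \<and> density c z \<le> 1 / r" using * s(2) by simp
    then show "s \<le> density c z \<and> density c z \<le> 1 / s" using one_div_mono[OF s] s(2) by linarith
  qed
qed

lemma tnorm_close:
  "\<exists>d>0. \<forall>x\<in>Q. \<forall>v. d * norm v \<le> tnorm g x (from_coords A (ch x) x v) \<and>
    tnorm g x (from_coords A (ch x) x v) \<le> 1 / d * norm v"
proof (rule uniform_charts[where P = "\<lambda>c x d. \<forall>v. d * norm v \<le> tnorm g x (from_coords A c x v) \<and>
    tnorm g x (from_coords A c x v) \<le> 1 / d * norm v"])
  fix c assume "c \<in> F"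
  then have c: "c \<in> A" using F(2) by blast
  show "\<exists>d>0. \<forall>x\<in>core c. \<forall>v. d * norm v \<le> tnorm g x (from_coords A c x v) \<and>
      tnorm g x (from_coords A c x v) \<le> 1 / d * norm v"
    by (rule tnorm_uniform[OF c compact_core core_subset])
next
  fix c x and r s :: real
  assume *: "\<forall>v. r * norm v \<le> tnorm g x (from_coords A c x v) \<and> tnorm g x (from_coords A c x v) \<le> 1 / r * norm v"
    and s: "0 < s" "s \<le> r"
  show "\<forall>v. s * norm v \<le> tnorm g x (from_coords A c x v) \<and> tnorm g x (from_coords A c x v) \<le> 1 / s * norm v"
  proof
    fix v
    show "s * norm v \<le> tnorm g x (from_coords A c x v) \<and> tnorm g x (from_coords A c x v) \<le> 1 / s * norm v"
      using spec[OF *, of v] mult_right_mono[OF s(2) norm_ge_zero[of v]]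
        mult_right_mono[OF one_div_mono[OF s] norm_ge_zero[of v]] by linarith
  qed
qed

definition cpr :: "('b \<times> 'm \<Rightarrow> (real^'n) set) \<Rightarrow> ('b \<times> 'm \<Rightarrow> (real^'n) set) \<Rightarrow> ('m, 'n) chart \<Rightarrow>
    'b \<times> 'm \<Rightarrow> real^'n \<Rightarrow> real^'n" where
  "cpr E E' c p v = to_coords A c (snd p) (proj_along (E p) (E' p) (from_coords A c (snd p) v))"

text \<open>A bound on the projections keeps the two subbundles at a uniform angle in coordinates.
  Continuity holds for fixed vectors only, so the bound is taken on a basis over the compact part of
  the lift above \<open>core c\<close>, and linearity does the rest.\<close>

lemma proj_close:
  assumes cont: "projections_continuous A (lift \<phi> Q) E E'"
    and lin: "\<And>p c. p \<in> lift \<phi> Q \<Longrightarrow> c \<in> A \<Longrightarrow> snd p \<in> fst c \<Longrightarrow> linear (cpr E E' c p)"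
  shows "\<exists>d>0. \<forall>p\<in>lift \<phi> Q. \<forall>v. norm (cpr E E' (ch (snd p)) p v) \<le> 1 / d * norm v"
proof -
  have "\<exists>d>0. \<forall>x\<in>Q. \<forall>b v. (b, x) \<in> lift \<phi> Q \<longrightarrow> norm (cpr E E' (ch x) (b, x) v) \<le> 1 / d * norm v"
  proof (rule uniform_charts[where P = "\<lambda>c x d. \<forall>b v. (b, x) \<in> lift \<phi> Q \<longrightarrow> norm (cpr E E' c (b, x) v) \<le> 1 / d * norm v"])
    fix c assume "c \<in> F"
    then have c: "c \<in> A" using F(2) by blast
    have "continuous_on {(b, x) \<in> lift \<phi> Q. x \<in> fst c} (\<lambda>p. cpr E E' c p v)" for v
      using cont c unfolding projections_continuous_def cpr_def by (auto simp: case_prod_unfold)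
    moreover have "lift \<phi> Q \<inter> UNIV \<times> core c \<subseteq> {(b, x) \<in> lift \<phi> Q. x \<in> fst c}"
      using core_subset[of c] by auto
    ultimately have "continuous_on (lift \<phi> Q \<inter> UNIV \<times> core c) (\<lambda>p. \<Sum>u\<in>(Basis :: (real^'n) set). norm (cpr E E' c p u))"
      by (intro continuous_on_sum continuous_on_norm) (rule continuous_on_subset)
    moreover have "compact (lift \<phi> Q \<inter> UNIV \<times> core c)"
      by (intro compact_Int_closed compact_lift closed_Times compact_imp_closed[OF compact_core]) simp
    ultimately have "bounded ((\<lambda>p. \<Sum>u\<in>(Basis :: (real^'n) set). norm (cpr E E' c p u)) ` (lift \<phi> Q \<inter> UNIV \<times> core c))"
      using compact_continuous_image compact_imp_bounded by blast
    then obtain a where a: "0 < a" "\<And>p. p \<in> lift \<phi> Q \<inter> UNIV \<times> core c \<Longrightarrow>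
        norm (\<Sum>u\<in>(Basis :: (real^'n) set). norm (cpr E E' c p u)) \<le> a"
      unfolding bounded_pos by auto
    have "norm (cpr E E' c (b, x) v) \<le> 1 / (1 / a) * norm v"
      if x: "x \<in> core c" and p: "(b, x) \<in> lift \<phi> Q" for b x v
    proof -
      have "norm (cpr E E' c (b, x) v) \<le> (\<Sum>u\<in>Basis. norm (cpr E E' c (b, x) u)) * norm v"
        using linear_norm_le_sum_Basis[OF lin[OF p c]] subsetD[OF core_subset x] by simp
      also have "\<dots> \<le> a * norm v" using a(2)[of "(b, x)"] x p by (intro mult_right_mono) auto
      finally show ?thesis by simp
    qed
    then show "\<exists>d>0. \<forall>x\<in>core c. \<forall>b v. (b, x) \<in> lift \<phi> Q \<longrightarrow> norm (cpr E E' c (b, x) v) \<le> 1 / d * norm v"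
      using a(1) by (intro exI[of _ "1 / a"]) auto
  next
    fix c x and r s :: real
    assume *: "\<forall>b v. (b, x) \<in> lift \<phi> Q \<longrightarrow> norm (cpr E E' c (b, x) v) \<le> 1 / r * norm v" and s: "0 < s" "s \<le> r"
    show "\<forall>b v. (b, x) \<in> lift \<phi> Q \<longrightarrow> norm (cpr E E' c (b, x) v) \<le> 1 / s * norm v"
    proof (intro allI impI)
      fix b v assume "(b, x) \<in> lift \<phi> Q"
      then have "norm (cpr E E' c (b, x) v) \<le> 1 / r * norm v" using * by blast
      then show "norm (cpr E E' c (b, x) v) \<le> 1 / s * norm v"
        using mult_right_mono[OF one_div_mono[OF s] norm_ge_zero[of v]] by linarith
    qed
  qed
  then obtain d where d: "0 < d" "\<And>x b v. x \<in> Q \<Longrightarrow> (b, x) \<in> lift \<phi> Q \<Longrightarrow>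
      norm (cpr E E' (ch x) (b, x) v) \<le> 1 / d * norm v" by blast
  have "norm (cpr E E' (ch (snd p)) p v) \<le> 1 / d * norm v" if "p \<in> lift \<phi> Q" for p v
    using d(2)[OF snd_lift[OF that], of "fst p" v] that by simp
  then show ?thesis using d(1) by blast
qed

definition D :: "'b \<times> 'm \<Rightarrow> real^'n \<Rightarrow> real^'n \<Rightarrow> real^'n" where
  "D p z = frechet_derivative (local_rep (ch (snd p)) (ch (\<phi> 1 (snd p) (fst p))) (\<lambda>y. \<phi> 1 y (fst p))) (at z)"

lemma phi_1_in: "p \<in> lift \<phi> Q \<Longrightarrow> \<phi> 1 (snd p) (fst p) \<in> Q"
  by (auto simp: lift_def)

lemma step_close:
  "\<exists>r>0. \<forall>p\<in>lift \<phi> Q. \<forall>z. dist z (zc (snd p)) < r \<longrightarrow>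
      z \<in> snd (ch (snd p)) ` fst (ch (snd p)) \<and>
      \<phi> 1 (inv_chart (ch (snd p)) z) (fst p) \<in> fst (ch (\<phi> 1 (snd p) (fst p))) \<and>
      (\<forall>v. norm (D p z v - D p (zc (snd p)) v) \<le> 1 / r * dist z (zc (snd p)) * norm v)"
proof -
  define P where "P c d p r \<longleftrightarrow> (\<forall>z. dist z (snd c (snd p)) < r \<longrightarrow>
      z \<in> snd c ` fst c \<and> \<phi> 1 (inv_chart c z) (fst p) \<in> fst d \<and>
      (\<forall>v. norm (frechet_derivative (local_rep c d (\<lambda>y. \<phi> 1 y (fst p))) (at z) v
          - frechet_derivative (local_rep c d (\<lambda>y. \<phi> 1 y (fst p))) (at (snd c (snd p))) v)
        \<le> 1 / r * dist z (snd c (snd p)) * norm v))" for c d :: "('m, 'n) chart" and p :: "'b \<times> 'm" and r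
  \<comment> \<open>For each pair of charts, the points lying in the core of the first with image in
    the core of the second form a compact set, and these finitely many sets cover the lift.\<close>
  define SS where "SS = (\<lambda>(c, d). lift \<phi> Q \<inter> (UNIV \<times> core c) \<inter> (\<lambda>(b, x). \<phi> 1 x b) -` core d)"
  have "\<exists>r>0. \<forall>cd\<in>F \<times> F. \<forall>p\<in>SS cd. P (fst cd) (snd cd) p r"
  proof (rule finite_uniform[where P = "\<lambda>cd r. \<forall>p\<in>SS cd. P (fst cd) (snd cd) p r"])
    fix cd assume "cd \<in> F \<times> F"
    then obtain c d where cd: "cd = (c, d)" "c \<in> A" "d \<in> A" using F(2) by blast
    have "compact (SS (c, d))"
      unfolding SS_def prod.case
      by (intro compact_Int_closed compact_lift closed_Times compact_imp_closed[OF compact_core]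
          closed_vimage[OF compact_imp_closed[OF compact_core] continuous_phi] closed_UNIV)
    moreover have "SS (c, d) \<subseteq> {(b, x). x \<in> fst c \<and> \<phi> 1 x b \<in> fst d}"
      using core_subset[of c] core_subset[of d] unfolding SS_def by auto
    ultimately show "\<exists>r>0. \<forall>p\<in>SS cd. P (fst cd) (snd cd) p r"
      unfolding P_def cd(1) fst_conv snd_conv
      by (rule step_uniform[OF cd(2,3) _ _ continuous_phi C2_phi derivatives_continuous_phi])
  next
    fix cd and r s :: real
    assume *: "\<forall>p\<in>SS cd. P (fst cd) (snd cd) p r" and s: "0 < s" "s \<le> r"
    show "\<forall>p\<in>SS cd. P (fst cd) (snd cd) p s"
      unfolding P_def
    proof (intro ballI allI impI conjI)
      fix p z and v :: "real^'n" assume p: "p \<in> SS cd" and "dist z (snd (fst cd) (snd p)) < s"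
      then have z: "dist z (snd (fst cd) (snd p)) < r" using s(2) by simp
      have Pr: "P (fst cd) (snd cd) p r" using * p by blast
      show "z \<in> snd (fst cd) ` fst (fst cd)" "\<phi> 1 (inv_chart (fst cd) z) (fst p) \<in> fst (snd cd)"
        using Pr z unfolding P_def by blast+
      have "1 / r * dist z (snd (fst cd) (snd p)) * norm v \<le> 1 / s * dist z (snd (fst cd) (snd p)) * norm v"
        by (intro mult_right_mono one_div_mono s) auto
      moreover have "norm (frechet_derivative (local_rep (fst cd) (snd cd) (\<lambda>y. \<phi> 1 y (fst p))) (at z) v
          - frechet_derivative (local_rep (fst cd) (snd cd) (\<lambda>y. \<phi> 1 y (fst p))) (at (snd (fst cd) (snd p))) v)
        \<le> 1 / r * dist z (snd (fst cd) (snd p)) * norm v"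
        using Pr z unfolding P_def by blast
      ultimately show "norm (frechet_derivative (local_rep (fst cd) (snd cd) (\<lambda>y. \<phi> 1 y (fst p))) (at z) v
          - frechet_derivative (local_rep (fst cd) (snd cd) (\<lambda>y. \<phi> 1 y (fst p))) (at (snd (fst cd) (snd p))) v)
        \<le> 1 / s * dist z (snd (fst cd) (snd p)) * norm v" by linarith
    qed
  qed (use F in simp)
  then obtain r where r: "0 < r" "\<And>cd p. cd \<in> F \<times> F \<Longrightarrow> p \<in> SS cd \<Longrightarrow> P (fst cd) (snd cd) p r" by blast
  have "P (ch (snd p)) (ch (\<phi> 1 (snd p) (fst p))) p r" if p: "p \<in> lift \<phi> Q" for p
    using r(2)[of "(ch (snd p), ch (\<phi> 1 (snd p) (fst p)))" p] ch[OF snd_lift[OF p]] ch[OF phi_1_in[OF p]] p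
    by (simp add: SS_def case_prod_unfold mem_Times_iff)
  then have "\<forall>p\<in>lift \<phi> Q. P (ch (snd p)) (ch (\<phi> 1 (snd p) (fst p))) p r" by blast
  with r(1) have "\<exists>r>0. \<forall>p\<in>lift \<phi> Q. P (ch (snd p)) (ch (\<phi> 1 (snd p) (fst p))) p r" by blast
  then show ?thesis unfolding P_def D_def zc_def .
qed

section \<open>Coordinates adapted to the splitting\<close>

definition T :: "'b \<times> 'm \<Rightarrow> real^'n well_ordered \<Rightarrow> real^'n" where
  "T p v = to_coords A (ch (snd p)) (snd p) (S p v)"

definition Ti :: "'b \<times> 'm \<Rightarrow> real^'n \<Rightarrow> real^'n well_ordered" where
  "Ti p w = inv_into UNIV (S p) (from_coords A (ch (snd p)) (snd p) w)"

context
  fixes p assumes p: "p \<in> lift \<phi> Q"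
begin

lemma from_coords_T: "from_coords A (ch (snd p)) (snd p) (T p v) = S p v"
  unfolding T_def by (rule to_from_coords(2)) (use ch[OF snd_lift[OF p]] in auto)

lemma T_Ti [simp]: "T p (Ti p w) = w" "Ti p (T p v) = v"
proof -
  have "S p (inv_into UNIV (S p) y) = y" for y
    using bij_S[OF p] by (simp add: bij_is_surj surj_f_inv_f)
  then show "T p (Ti p w) = w"
    unfolding T_def Ti_def using to_from_coords(1) ch[OF snd_lift[OF p]] by simp
  show "Ti p (T p v) = v"
    unfolding Ti_def from_coords_T using bij_S[OF p] by (simp add: bij_is_inj)
qed

lemma linear_T: "linear (T p)"
  using linear_compose[OF linear_S linear_coords(1), of "ch (snd p)" "snd p" p] ch[OF snd_lift[OF p]]
  by (simp add: o_def T_def[abs_def])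

lemma linear_Ti: "linear (Ti p)"
proof (rule linearI)
  fix a b and t :: real
  have "T p (Ti p a + Ti p b) = a + b" by (simp add: linear_add[OF linear_T])
  then show "Ti p (a + b) = Ti p a + Ti p b" using T_Ti(2) by metis
  have "T p (t *\<^sub>R Ti p a) = t *\<^sub>R a" by (simp add: linear_cmul[OF linear_T])
  then show "Ti p (t *\<^sub>R a) = t *\<^sub>R Ti p a" using T_Ti(2) by metis
qed

lemma cpr_T:
  "cpr Ep Em (ch (snd p)) p (T p v) = T p (cproj I v)"
  "cpr Em Ep (ch (snd p)) p (T p v) = T p (cproj (- I) v)"
  unfolding cpr_def from_coords_T proj_S[OF p] by (simp_all add: T_def)

end

text \<open>\<open>proj_along\<close> is a definite description; its linearity comes from writing it
  as a coordinate projection conjugated by the frame \<open>S p\<close>.\<close>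

lemma cpr_linear:
  assumes p: "p \<in> lift \<phi> Q" and c: "c \<in> A" "snd p \<in> fst c"
  shows "linear (cpr Ep Em c p)" "linear (cpr Em Ep c p)"
proof -
  have "proj_along (Ep p) (Em p) y = S p (cproj I (inv_into UNIV (S p) y))"
    "proj_along (Em p) (Ep p) y = S p (cproj (- I) (inv_into UNIV (S p) y))" for y
    using proj_S[OF p, of "inv_into UNIV (S p) y"] bij_S[OF p] by (simp_all add: bij_is_surj surj_f_inv_f)
  moreover have "linear (inv_into UNIV (S p))"
  proof -
    have "inv_into UNIV (S p) y = Ti p (to_coords A (ch (snd p)) (snd p) y)" for y
      unfolding Ti_def using to_from_coords(2) ch[OF snd_lift[OF p]] by simp
    then have "inv_into UNIV (S p) = Ti p \<circ> to_coords A (ch (snd p)) (snd p)" by auto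
    then show ?thesis using linear_compose[OF linear_coords(1) linear_Ti[OF p]] ch[OF snd_lift[OF p]] by simp
  qed
  then have "linear (to_coords A c (snd p) \<circ> (S p \<circ> (cproj J \<circ> (inv_into UNIV (S p) \<circ> from_coords A c (snd p)))))" for J
    by (intro linear_compose[OF _ linear_coords(1)[OF c]] linear_compose[OF _ linear_S]
        linear_compose[OF _ linear_cproj] linear_compose[OF linear_coords(2)[OF c]])
  then have "linear (\<lambda>v. to_coords A c (snd p) (S p (cproj J (inv_into UNIV (S p) (from_coords A c (snd p) v)))))" for J
    by (simp add: o_def)
  ultimately show "linear (cpr Ep Em c p)" "linear (cpr Em Ep c p)"
    by (simp_all add: cpr_def[abs_def])
qed

text \<open>Each block is a Riemannian isometry and the metric is comparable to the coordinate norm,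
  which costs \<open>1 / d\<close> per block in the upper bound. For the lower bound the blocks must
  be recovered from their sum, at the cost of the projection norms \<open>1 / d1\<close> and
  \<open>1 / d2\<close>.\<close>

lemma T_bounds:
  "\<exists>\<kappa>\<ge>1. \<forall>p\<in>lift \<phi> Q. \<forall>v. norm (T p v) \<le> \<kappa> * norm v \<and> norm v \<le> \<kappa> * norm (T p v)"
proof -
  obtain d where d: "0 < d" "\<And>x v. x \<in> Q \<Longrightarrow> d * norm v \<le> tnorm g x (from_coords A (ch x) x v) \<and>
      tnorm g x (from_coords A (ch x) x v) \<le> 1 / d * norm v"
    using tnorm_close by blast
  have pc: "projections_continuous A (lift \<phi> Q) Ep Em" "projections_continuous A (lift \<phi> Q) Em Ep"
    using hyp by (auto simp: hyperbolic_splitting_def)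
  obtain d1 where d1: "0 < d1" "\<And>p v. p \<in> lift \<phi> Q \<Longrightarrow> norm (cpr Ep Em (ch (snd p)) p v) \<le> 1 / d1 * norm v"
    using proj_close[OF pc(1) cpr_linear(1)] by blast
  obtain d2 where d2: "0 < d2" "\<And>p v. p \<in> lift \<phi> Q \<Longrightarrow> norm (cpr Em Ep (ch (snd p)) p v) \<le> 1 / d2 * norm v"
    using proj_close[OF pc(2) cpr_linear(2)] by blast
  define \<kappa> where "\<kappa> = max 1 (max (2 / d) (1 / d * (1 / d1 + 1 / d2)))"
  have \<kappa>: "1 \<le> \<kappa>" "2 / d \<le> \<kappa>" "1 / d * (1 / d1 + 1 / d2) \<le> \<kappa>" by (simp_all add: \<kappa>_def)
  have "norm (T p v) \<le> \<kappa> * norm v \<and> norm v \<le> \<kappa> * norm (T p v)" if p: "p \<in> lift \<phi> Q" for p v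
  proof
    note tn = d(2)[OF snd_lift[OF p]]
    have TJ: "tnorm g (snd p) (from_coords A (ch (snd p)) (snd p) (T p (cproj J v))) = norm (cproj J v)"
      if "J = I \<or> J = - I" for J
      unfolding from_coords_T[OF p] by (rule tnorm_S[OF p that])
    have nJ: "norm (T p (cproj J v)) \<le> 1 / d * norm v" if J: "J = I \<or> J = - I" for J
    proof -
      have "d * norm (T p (cproj J v)) \<le> norm v"
        using tn[of "T p (cproj J v)"] TJ[OF J] norm_cproj_le[of J v] by linarith
      then show ?thesis using d(1) by (simp add: field_simps)
    qed
    have "T p v = T p (cproj (- I) v) + T p (cproj I v)"
      by (metis cproj_add_compl linear_add linear_T[OF p])
    then have "norm (T p v) \<le> norm (T p (cproj (- I) v)) + norm (T p (cproj I v))"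
      using norm_triangle_ineq by metis
    then have "norm (T p v) \<le> 1 / d * norm v + 1 / d * norm v"
      using nJ[of I] nJ[of "- I"] by simp
    then have "norm (T p v) \<le> 2 / d * norm v" by simp
    also have "\<dots> \<le> \<kappa> * norm v" by (intro mult_right_mono \<kappa>) simp
    finally show "norm (T p v) \<le> \<kappa> * norm v" .
    have "norm v \<le> norm (cproj (- I) v) + norm (cproj I v)"
      by (metis cproj_add_compl norm_triangle_ineq)
    also have "\<dots> \<le> 1 / d * norm (T p (cproj (- I) v)) + 1 / d * norm (T p (cproj I v))"
      using tn[of "T p (cproj (- I) v)"] tn[of "T p (cproj I v)"] TJ[of I] TJ[of "- I"] by simp
    also have "\<dots> \<le> 1 / d * (1 / d2 * norm (T p v)) + 1 / d * (1 / d1 * norm (T p v))"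
      using d1(2)[OF p, of "T p v"] d2(2)[OF p, of "T p v"] d(1) cpr_T[OF p]
      by (intro add_mono mult_left_mono) auto
    also have "\<dots> = 1 / d * (1 / d1 + 1 / d2) * norm (T p v)" by (simp add: algebra_simps)
    also have "\<dots> \<le> \<kappa> * norm (T p v)" by (intro mult_right_mono \<kappa>) simp
    finally show "norm v \<le> \<kappa> * norm (T p v)" .
  qed
  then show ?thesis using \<kappa>(1) by blast
qed

section \<open>The step maps in adapted coordinates\<close>

definition nxt :: "'b \<times> 'm \<Rightarrow> 'b \<times> 'm" where "nxt p = skew \<theta> \<phi> 1 p"

lemma snd_nxt [simp]: "snd (nxt p) = \<phi> 1 (snd p) (fst p)"
  by (simp add: nxt_def skew_def case_prod_unfold)

lemma nxt_lift: "p \<in> lift \<phi> Q \<Longrightarrow> nxt p \<in> lift \<phi> Q"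
  unfolding nxt_def by (rule lift_skew)

lemma nxt_skew: "nxt (skew \<theta> \<phi> (int n) p) = skew \<theta> \<phi> (int (Suc n)) p"
  unfolding nxt_def by (rule skew_Suc[symmetric])

lemma snd_skew: "snd (skew \<theta> \<phi> (int n) p) = \<phi> (int n) (snd p) (fst p)"
  and fst_skew: "fst (skew \<theta> \<phi> (int n) p) = base n (fst p)"
  by (cases p, simp add: skew_eq)+

text \<open>Coordinates are centred at the orbit: \<open>w\<close> stands for the point with chart
  value \<open>zc (snd p) + T p w\<close>. The map is total, but only its values at small
  \<open>w\<close>, where both charts apply, carry meaning.\<close>

definition stepf :: "'b \<times> 'm \<Rightarrow> real^'n well_ordered \<Rightarrow> real^'n well_ordered" where
  "stepf p w = Ti (nxt p) (local_rep (ch (snd p)) (ch (snd (nxt p))) (\<lambda>y. \<phi> 1 y (fst p)) (zc (snd p) + T p w)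
    - zc (snd (nxt p)))"

definition stepA :: "'b \<times> 'm \<Rightarrow> real^'n well_ordered \<Rightarrow> real^'n well_ordered \<Rightarrow> real^'n well_ordered" where
  "stepA p w v = Ti (nxt p) (D p (zc (snd p) + T p w) (T p v))"

lemma stepf_0:
  assumes p: "p \<in> lift \<phi> Q"
  shows "stepf p 0 = 0"
proof -
  have "inv_chart (ch (snd p)) (zc (snd p)) = snd p"
    unfolding zc_def using inv_chart_chart[OF chart] ch[OF snd_lift[OF p]] by simp
  then have "local_rep (ch (snd p)) (ch (snd (nxt p))) (\<lambda>y. \<phi> 1 y (fst p)) (zc (snd p) + T p 0) = zc (snd (nxt p))"
    by (simp add: local_rep_def linear_0[OF linear_T[OF p]] zc_def)
  then show ?thesis by (simp add: stepf_def linear_0[OF linear_Ti[OF nxt_lift[OF p]]])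
qed

text \<open>The charts of the finite family cancel, so the linear part is conjugate to the intrinsic
  tangent map by the frames alone. This is how the hypotheses on the splitting reach the step
  maps.\<close>

lemma S_stepA_0:
  assumes p: "p \<in> lift \<phi> Q"
  shows "S (nxt p) (stepA p 0 v) = tangent_map A (\<lambda>y. \<phi> 1 y (fst p)) (snd p) (S p v)"
proof -
  let ?f = "\<lambda>y. \<phi> 1 y (fst p)"
  note x = ch[OF snd_lift[OF p]] and x' = ch[OF phi_1_in[OF p]]
  have "T (nxt p) (stepA p 0 v) = drep (ch (snd p)) (ch (\<phi> 1 (snd p) (fst p))) ?f (snd p) (to_coords A (ch (snd p)) (snd p) (S p v))"
    using T_Ti(1)[OF nxt_lift[OF p]]
    by (simp add: stepA_def linear_0[OF linear_T[OF p]] D_def drep_def zc_def T_def[of p v])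
  also have "\<dots> = to_coords A (ch (\<phi> 1 (snd p) (fst p))) (\<phi> 1 (snd p) (fst p)) (tangent_map A ?f (snd p) (S p v))"
    by (rule drep_to_coords[OF C2_phi x(2) x'(2) x(4) x'(4)])
  finally have "from_coords A (ch (snd (nxt p))) (snd (nxt p)) (T (nxt p) (stepA p 0 v))
      = tangent_map A ?f (snd p) (S p v)"
    using to_from_coords(2)[OF x'(2) x'(4)] by simp
  then show ?thesis using from_coords_T[OF nxt_lift[OF p]] by simp
qed

lemma tangent_map_splitting:
  assumes p: "p \<in> lift \<phi> Q"
  shows "tangent_map A (\<lambda>y. \<phi> 1 y (fst p)) (snd p) ` Em p = Em (nxt p)"
    and "tangent_map A (\<lambda>y. \<phi> 1 y (fst p)) (snd p) ` Ep p = Ep (nxt p)"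
    and "v \<in> Em p \<Longrightarrow> tnorm g (snd (nxt p)) (tangent_map A (\<lambda>y. \<phi> 1 y (fst p)) (snd p) v) \<le> lam * tnorm g (snd p) v"
    and "v \<in> Ep p \<Longrightarrow> tnorm g (snd p) v \<le> lam * tnorm g (snd (nxt p)) (tangent_map A (\<lambda>y. \<phi> 1 y (fst p)) (snd p) v)"
proof -
  obtain b x where bx: "p = (b, x)" by (cases p)
  have inv: "\<forall>(b, x)\<in>lift \<phi> Q. \<forall>k.
        tangent_map A (\<lambda>y. \<phi> k y b) x ` Em (b, x) = Em (skew \<theta> \<phi> k (b, x)) \<and>
        tangent_map A (\<lambda>y. \<phi> k y b) x ` Ep (b, x) = Ep (skew \<theta> \<phi> k (b, x))"
    and est: "\<forall>(b, x)\<in>lift \<phi> Q. \<forall>k::nat.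
        (\<forall>v\<in>Em (b, x). tnorm g (\<phi> (int k) x b) (tangent_map A (\<lambda>y. \<phi> (int k) y b) x v)
            \<le> 1 * lam ^ k * tnorm g x v) \<and>
        (\<forall>v\<in>Ep (b, x). tnorm g (\<phi> (int k) x b) (tangent_map A (\<lambda>y. \<phi> (int k) y b) x v)
            \<ge> (1 / 1) * (1 / lam) ^ k * tnorm g x v)"
    using hyp unfolding hyperbolic_splitting_def by blast+
  show "tangent_map A (\<lambda>y. \<phi> 1 y (fst p)) (snd p) ` Em p = Em (nxt p)"
    "tangent_map A (\<lambda>y. \<phi> 1 y (fst p)) (snd p) ` Ep p = Ep (nxt p)"
    using bspec[OF inv p] by (simp_all add: bx nxt_def)
  have e: "\<forall>k::nat.
        (\<forall>v\<in>Em (b, x). tnorm g (\<phi> (int k) x b) (tangent_map A (\<lambda>y. \<phi> (int k) y b) x v)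
            \<le> 1 * lam ^ k * tnorm g x v) \<and>
        (\<forall>v\<in>Ep (b, x). tnorm g (\<phi> (int k) x b) (tangent_map A (\<lambda>y. \<phi> (int k) y b) x v)
            \<ge> (1 / 1) * (1 / lam) ^ k * tnorm g x v)"
    using bspec[OF est p] unfolding bx prod.case .
  note e1 = spec[OF e, of 1, simplified]
  show "v \<in> Em p \<Longrightarrow> tnorm g (snd (nxt p)) (tangent_map A (\<lambda>y. \<phi> 1 y (fst p)) (snd p) v) \<le> lam * tnorm g (snd p) v"
    using e1 by (simp add: bx)
  show "v \<in> Ep p \<Longrightarrow> tnorm g (snd p) v \<le> lam * tnorm g (snd (nxt p)) (tangent_map A (\<lambda>y. \<phi> 1 y (fst p)) (snd p) v)"
    using e1 lam by (simp add: bx field_simps)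
qed

lemma stepA_0_range:
  assumes p: "p \<in> lift \<phi> Q" and J: "J = I \<or> J = - I"
  shows "\<exists>u. stepA p 0 (cproj J v) = cproj J u"
proof -
  have "S (nxt p) (stepA p 0 (cproj J v)) \<in> range (\<lambda>v. S (nxt p) (cproj J v))"
    using J S_range[OF p] S_range[OF nxt_lift[OF p]] tangent_map_splitting(1,2)[OF p]
    unfolding S_stepA_0[OF p] by blast
  then show ?thesis using bij_S[OF nxt_lift[OF p]] by (auto simp: bij_def inj_eq)
qed

text \<open>Invariance keeps the image inside one block, where \<open>S\<close> is an isometry; the
  Riemannian rates thus carry over without any constant.\<close>

lemma stepA_0_norm:
  assumes p: "p \<in> lift \<phi> Q" and J: "J = I \<or> J = - I"
  shows "tnorm g (snd (nxt p)) (tangent_map A (\<lambda>y. \<phi> 1 y (fst p)) (snd p) (S p (cproj J v)))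
    = norm (stepA p 0 (cproj J v))"
proof -
  obtain u where u: "stepA p 0 (cproj J v) = cproj J u" using stepA_0_range[OF assms] by blast
  show ?thesis
    unfolding S_stepA_0[OF p, symmetric] u by (rule tnorm_S[OF nxt_lift[OF p] J])
qed

lemma linear_stepA_0:
  assumes p: "p \<in> lift \<phi> Q"
  shows "linear (stepA p 0)"
proof -
  have "linear (D p (zc (snd p)))"
    using linear_drep[OF C2_phi, of "ch (snd p)" "ch (\<phi> 1 (snd p) (fst p))" "snd p"]
      ch[OF snd_lift[OF p]] ch[OF phi_1_in[OF p]] by (simp add: D_def drep_def zc_def)
  from linear_compose[OF linear_T[OF p] linear_compose[OF this linear_Ti[OF nxt_lift[OF p]]]]
  show ?thesis by (simp add: stepA_def[abs_def] linear_0[OF linear_T[OF p]] o_def)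
qed

lemma stepA_0_commute:
  assumes p: "p \<in> lift \<phi> Q"
  shows "cproj I (stepA p 0 v) = stepA p 0 (cproj I v)"
proof -
  obtain u where u: "stepA p 0 (cproj I v) = cproj I u" using stepA_0_range[OF p] by blast
  obtain u' where u': "stepA p 0 (cproj (- I) v) = cproj (- I) u'" using stepA_0_range[OF p] by blast
  have "stepA p 0 v = stepA p 0 (cproj (- I) v) + stepA p 0 (cproj I v)"
    by (metis cproj_add_compl linear_add linear_stepA_0[OF p])
  then show ?thesis by (simp add: u u' cproj_simps)
qed

text \<open>\<open>K\<close> and \<open>r0\<close> are uniform over the lift, and every smaller
  radius is admissible with the same maps: the final argument uses each sequence with two
  radii.\<close>

lemma step_sequence:
  "\<exists>K r0. 0 < r0 \<and>
    (\<forall>p\<in>lift \<phi> Q. \<forall>w. norm w < r0 \<longrightarrow> zc (snd p) + T p w \<in> snd (ch (snd p)) ` fst (ch (snd p)) \<and>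
      \<phi> 1 (inv_chart (ch (snd p)) (zc (snd p) + T p w)) (fst p) \<in> fst (ch (snd (nxt p)))) \<and>
    (\<forall>r p. 0 < r \<longrightarrow> r \<le> r0 \<longrightarrow> p \<in> lift \<phi> Q \<longrightarrow>
      hyperbolic_sequence I lam K r (\<lambda>k. stepf (skew \<theta> \<phi> (int k) p)) (\<lambda>k. stepA (skew \<theta> \<phi> (int k) p)))"
proof -
  obtain \<kappa> where \<kappa>: "1 \<le> \<kappa>" "\<And>p v. p \<in> lift \<phi> Q \<Longrightarrow> norm (T p v) \<le> \<kappa> * norm v"
    "\<And>p v. p \<in> lift \<phi> Q \<Longrightarrow> norm v \<le> \<kappa> * norm (T p v)"
    using T_bounds by blast
  obtain d where d: "0 < d"
    "\<And>p z. p \<in> lift \<phi> Q \<Longrightarrow> dist z (zc (snd p)) < d \<Longrightarrow> z \<in> snd (ch (snd p)) ` fst (ch (snd p)) \<and>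
      \<phi> 1 (inv_chart (ch (snd p)) z) (fst p) \<in> fst (ch (\<phi> 1 (snd p) (fst p)))"
    "\<And>p z v. p \<in> lift \<phi> Q \<Longrightarrow> dist z (zc (snd p)) < d \<Longrightarrow>
      norm (D p z v - D p (zc (snd p)) v) \<le> 1 / d * dist z (zc (snd p)) * norm v"
    using step_close by metis
  \<comment> \<open>One factor \<open>\<kappa>\<close> comes from \<open>Ti\<close>, two from
    \<open>T\<close>, which acts on the displacement and on the vector; \<open>1 / d\<close> is the
    Lipschitz constant of the derivative in charts.\<close>
  define K where "K = \<kappa> * (1 / d * (\<kappa> * \<kappa>))"
  have K: "0 < K" using \<kappa>(1) d(1) by (simp add: K_def)
  \<comment> \<open>The first bound keeps \<open>T p w\<close> within the chart radius
    \<open>d\<close>, the second is the smallness condition of \<open>hyperbolic_sequence\<close>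
    solved for the radius.\<close>
  define r0 where "r0 = min (d / \<kappa>) (((1 - lam) / 2)\<^sup>2 / (12 * K))"
  have r0: "0 < r0" using \<kappa>(1) d(1) K lam by (simp add: r0_def)
  have Tw: "dist (zc (snd p) + T p w) (zc (snd p)) < d" "dist (zc (snd p) + T p w) (zc (snd p)) \<le> \<kappa> * norm w"
    if "p \<in> lift \<phi> Q" "norm w < r0" for p w
  proof -
    have "\<kappa> * norm w < \<kappa> * (d / \<kappa>)" using that(2) \<kappa>(1) by (intro mult_strict_left_mono) (auto simp: r0_def)
    also have "\<dots> = d" using \<kappa>(1) by simp
    finally show "dist (zc (snd p) + T p w) (zc (snd p)) < d" using \<kappa>(2)[OF that(1), of w] by (simp add: dist_norm)
    show "dist (zc (snd p) + T p w) (zc (snd p)) \<le> \<kappa> * norm w"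
      using \<kappa>(2)[OF that(1), of w] by (simp add: dist_norm)
  qed
  have nTi: "norm (Ti p u) \<le> \<kappa> * norm u" if "p \<in> lift \<phi> Q" for p u
    using \<kappa>(3)[OF that, of "Ti p u"] T_Ti(1)[OF that] by simp
  have deriv: "(stepf p has_derivative stepA p w) (at w)" if p: "p \<in> lift \<phi> Q" and w: "norm w < r0" for p w
  proof -
    let ?c = "ch (snd p)" and ?d = "ch (snd (nxt p))" and ?f = "\<lambda>y. \<phi> 1 y (fst p)" and ?z = "zc (snd p) + T p w"
    have z: "?z \<in> snd ?c ` fst ?c" "?f (inv_chart ?c ?z) \<in> fst ?d" using d(2)[OF p Tw(1)[OF p w]] by auto
    have c: "is_chart ?c" using ch(2)[OF snd_lift[OF p]] chart by blast
    have "?z \<in> snd ?c ` (fst ?c \<inter> ?f -` fst ?d)"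
      using z inv_chart_in[OF c z(1)] chart_inv_chart[OF c z(1)] by (intro image_eqI[of _ _ "inv_chart ?c ?z"]) auto
    then have "local_rep ?c ?d ?f differentiable (at ?z)"
      by (intro C2_map_differentiable(1) C2_phi ch snd_lift p nxt_lift)
    then have 1: "(local_rep ?c ?d ?f has_derivative D p ?z) (at ?z)"
      by (simp add: D_def frechet_derivative_works)
    have 2: "((\<lambda>w. zc (snd p) + T p w) has_derivative T p) (at w)"
      using has_derivative_add[OF has_derivative_const linear_imp_has_derivative[OF linear_T[OF p]]] by simp
    have "((\<lambda>w. local_rep ?c ?d ?f (zc (snd p) + T p w) - zc (snd (nxt p))) has_derivative (\<lambda>v. D p ?z (T p v) - 0)) (at w)"
      by (rule has_derivative_diff[OF has_derivative_compose[OF 2 1] has_derivative_const])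
    from has_derivative_compose[OF this linear_imp_has_derivative[OF linear_Ti[OF nxt_lift[OF p]]]]
    show ?thesis by (simp add: stepf_def[abs_def] stepA_def[abs_def])
  qed
  have lip: "norm (stepA p w v - stepA p 0 v) \<le> K * norm w * norm v"
    if p: "p \<in> lift \<phi> Q" and w: "norm w < r0" for p w v
  proof -
    let ?z = "zc (snd p) + T p w"
    have "stepA p w v - stepA p 0 v = Ti (nxt p) (D p ?z (T p v) - D p (zc (snd p)) (T p v))"
      by (simp add: stepA_def linear_0[OF linear_T[OF p]] linear_diff[OF linear_Ti[OF nxt_lift[OF p]]])
    then have "norm (stepA p w v - stepA p 0 v) \<le> \<kappa> * norm (D p ?z (T p v) - D p (zc (snd p)) (T p v))"
      using nTi[OF nxt_lift[OF p]] by simp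
    also have "\<dots> \<le> \<kappa> * (1 / d * dist ?z (zc (snd p)) * norm (T p v))"
      using \<kappa>(1) by (intro mult_left_mono d(3)[OF p Tw(1)[OF p w]]) auto
    also have "\<dots> \<le> \<kappa> * (1 / d * (\<kappa> * norm w) * (\<kappa> * norm v))"
      using \<kappa>(1) d(1) Tw(2)[OF p w] \<kappa>(2)[OF p, of v] by (intro mult_left_mono mult_mono) auto
    also have "\<dots> = K * norm w * norm v" by (simp add: K_def)
    finally show ?thesis .
  qed
  have "hyperbolic_sequence I lam K r (\<lambda>k. stepf (skew \<theta> \<phi> (int k) p)) (\<lambda>k. stepA (skew \<theta> \<phi> (int k) p))"
    if r: "0 < r" "r \<le> r0" and p: "p \<in> lift \<phi> Q" for r p
  proof
    fix k and w v :: "real^'n well_ordered"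
    let ?p = "skew \<theta> \<phi> (int k) p"
    have pk: "?p \<in> lift \<phi> Q" by (rule lift_skew[OF p])
    show "0 < lam" "lam < 1" "0 < r" "0 \<le> K" using lam r K by auto
    have "12 * K * r \<le> 12 * K * (((1 - lam) / 2)\<^sup>2 / (12 * K))"
      using K r(2) unfolding r0_def by (intro mult_left_mono) auto
    then show "12 * K * r \<le> ((1 - lam) / 2)\<^sup>2" using K by simp
    show "stepf ?p 0 = 0" by (rule stepf_0[OF pk])
    show "cproj I (stepA ?p 0 v) = stepA ?p 0 (cproj I v)" by (rule stepA_0_commute[OF pk])
    have "S ?p (cproj (- I) v) \<in> Em ?p" "S ?p (cproj I v) \<in> Ep ?p" using S_range[OF pk] by auto
    then show "norm (stepA ?p 0 (cproj (- I) v)) \<le> lam * norm (cproj (- I) v)"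
      "norm (cproj I v) \<le> lam * norm (stepA ?p 0 (cproj I v))"
      using tangent_map_splitting(3,4)[OF pk] stepA_0_norm[OF pk, of "- I" v] stepA_0_norm[OF pk, of I v]
        tnorm_S[OF pk, of "- I" v] tnorm_S[OF pk, of I v] by metis+
    assume w: "norm w < r"
    show "(stepf ?p has_derivative stepA ?p w) (at w)" "norm (stepA ?p w v - stepA ?p 0 v) \<le> K * norm w * norm v"
      using deriv[OF pk] lip[OF pk] w r by auto
  qed
  moreover have "zc (snd p) + T p w \<in> snd (ch (snd p)) ` fst (ch (snd p)) \<and>
      \<phi> 1 (inv_chart (ch (snd p)) (zc (snd p) + T p w)) (fst p) \<in> fst (ch (snd (nxt p)))"
    if "p \<in> lift \<phi> Q" "norm w < r0" for p w
    using d(2)[OF that(1) Tw(1)[OF that]] by simp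
  ultimately show ?thesis using r0 by blast
qed

text \<open>The orbit of \<open>0\<close> stays at \<open>0\<close>, so \<open>dorbit\<close>
  composes the linear parts only, and the intermediate frames cancel in the chain rule.\<close>

lemma S_dorbit:
  assumes p: "p \<in> lift \<phi> Q"
    and hs: "hyperbolic_sequence I lam K r (\<lambda>k. stepf (skew \<theta> \<phi> (int k) p)) (\<lambda>k. stepA (skew \<theta> \<phi> (int k) p))"
  shows "S (skew \<theta> \<phi> (int n) p) (hyperbolic_sequence.dorbit (\<lambda>k. stepf (skew \<theta> \<phi> (int k) p))
      (\<lambda>k. stepA (skew \<theta> \<phi> (int k) p)) n 0 v)
    = tangent_map A (\<lambda>y. \<phi> (int n) y (fst p)) (snd p) (S p v)"
proof -
  interpret hs: hyperbolic_sequence I lam K r "\<lambda>k. stepf (skew \<theta> \<phi> (int k) p)" "\<lambda>k. stepA (skew \<theta> \<phi> (int k) p)"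
    by (rule hs)
  show ?thesis
  proof (induction n)
    case 0
    have "(\<lambda>y. \<phi> (int 0) y (fst p)) = id" by (rule ext) simp
    then show ?case by (simp only: tangent_map_id hs.dorbit.simps of_nat_0 skew_0 id_apply)
  next
    case (Suc n)
    let ?p = "skew \<theta> \<phi> (int n) p"
    have "(\<lambda>y. \<phi> (int (Suc n)) y (fst p)) = (\<lambda>y. \<phi> 1 y (base n (fst p))) \<circ> (\<lambda>y. \<phi> (int n) y (fst p))"
      by (rule ext) (simp only: phi_Suc comp_apply)
    then have "tangent_map A (\<lambda>y. \<phi> (int (Suc n)) y (fst p)) (snd p) (S p v)
        = tangent_map A (\<lambda>y. \<phi> 1 y (fst ?p)) (snd ?p) (tangent_map A (\<lambda>y. \<phi> (int n) y (fst p)) (snd p) (S p v))"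
      by (simp only: tangent_map_comp[OF C2_phi C2_phi] snd_skew fst_skew comp_apply)
    also have "\<dots> = S (nxt ?p) (stepA ?p 0 (hs.dorbit n 0 v))"
      unfolding Suc[symmetric] by (rule S_stepA_0[OF lift_skew[OF p], symmetric])
    finally show ?case by (simp only: nxt_skew hs.dorbit.simps hs.orbit_zero)
  qed
qed

text \<open>Block diagonality keeps the image of an expanding coordinate vector expanding, and its
  components are inner products with the basis \<open>es\<close> at the end point. The rows for
  \<open>- I\<close> are those of the identity, so \<open>det_block\<close> leaves precisely the
  matrix in \<open>abs_det\<close>, for the same chosen bases.\<close>

lemma det_dmixed:
  assumes p: "p \<in> lift \<phi> Q"
    and hs: "hyperbolic_sequence I lam K r (\<lambda>k. stepf (skew \<theta> \<phi> (int k) p)) (\<lambda>k. stepA (skew \<theta> \<phi> (int k) p))"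
  shows "\<bar>Determinants.det (matrix (hyperbolic_sequence.dmixed I (\<lambda>k. stepf (skew \<theta> \<phi> (int k) p))
      (\<lambda>k. stepA (skew \<theta> \<phi> (int k) p)) n 0))\<bar>
    = abs_det g (snd p) (Ep p) (\<phi> (int n) (snd p) (fst p)) (Ep (skew \<theta> \<phi> (int n) p))
        (tangent_map A (\<lambda>y. \<phi> (int n) y (fst p)) (snd p))"
proof -
  interpret hs: hyperbolic_sequence I lam K r "\<lambda>k. stepf (skew \<theta> \<phi> (int k) p)" "\<lambda>k. stepA (skew \<theta> \<phi> (int k) p)"
    by (rule hs)
  let ?q = "skew \<theta> \<phi> (int n) p" and ?L = "tangent_map A (\<lambda>y. \<phi> (int n) y (fst p)) (snd p)"
  have q: "?q \<in> lift \<phi> Q" by (rule lift_skew[OF p])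
  have comm: "cproj I (hs.dorbit n 0 v) = hs.dorbit n 0 (cproj I v)" for v
    by (induction n) (simp_all add: hs.commute)
  define a where "a i j = g (snd ?q) (es ?q ! i) (?L (es p ! j))" for i j
  have "Determinants.det (matrix (hs.dmixed n 0)) = Determinant.det (Matrix.mat dp dp (\<lambda>(i, j). a i j))"
  proof (rule det_block[OF hp])
    fix i j assume i: "i \<in> I" and j: "j \<in> I"
    have ax: "cproj I (axis j 1) = axis j (1::real)"
      using j by (auto simp: cproj_def axis_def Finite_Cartesian_Product.vec_eq_iff)
    have Sax: "S p (axis j 1) = es p ! hp j"
      using S_cproj[of p I "axis j 1"] j unfolding ax
      by (simp add: axis_def if_distrib[of "\<lambda>a. a *\<^sub>R _"] fr_def cong: if_cong)
    have "matrix (hs.dmixed n 0) $ i $ j = hs.dorbit n 0 (axis j 1) $ i"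
      using i by (simp add: matrix_def hs.dmixed_def cproj_def)
    also have "\<dots> = g (snd ?q) (fr ?q i) (S ?q (cproj I (hs.dorbit n 0 (axis j 1))))"
      using metric_S_fr[OF q i] by simp
    also have "cproj I (hs.dorbit n 0 (axis j 1)) = hs.dorbit n 0 (axis j 1)"
      by (simp add: comm ax)
    also have "S ?q (hs.dorbit n 0 (axis j 1)) = ?L (S p (axis j 1))"
      by (rule S_dorbit[OF p hs])
    finally show "matrix (hs.dmixed n 0) $ i $ j = a (hp i) (hp j)"
      using i by (simp add: a_def Sax fr_def)
  next
    fix i j assume "i \<notin> I"
    then show "matrix (hs.dmixed n 0) $ i $ j = (if i = j then 1 else 0)"
      by (simp add: matrix_def hs.dmixed_def cproj_def axis_def)
  qed
  then show ?thesis
    using length_es[OF p] length_es[OF q]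
    by (simp add: abs_det_def Let_def a_def es_def snd_skew)
qed

section \<open>Bowen balls\<close>

text \<open>As long as the true orbit stays in the charts, chart maps and their inverses cancel, and
  its adapted coordinates form an orbit of the step maps. This places Bowen balls inside images of
  \<open>W n\<close>.\<close>

lemma orbit_of_point:
  assumes p: "p \<in> lift \<phi> Q"
    and y: "\<And>k. k \<le> n \<Longrightarrow> \<phi> (int k) y (fst p) \<in> fst (ch (snd (skew \<theta> \<phi> (int k) p)))"
  defines "w \<equiv> \<lambda>k. Ti (skew \<theta> \<phi> (int k) p)
    (snd (ch (snd (skew \<theta> \<phi> (int k) p))) (\<phi> (int k) y (fst p)) - zc (snd (skew \<theta> \<phi> (int k) p)))"
  assumes "k \<le> n"
  shows "orbit (\<lambda>k. stepf (skew \<theta> \<phi> (int k) p)) k (w 0) = w k"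
  using \<open>k \<le> n\<close>
proof (induction k)
  case (Suc k)
  let ?p = "skew \<theta> \<phi> (int k) p"
  have pk: "?p \<in> lift \<phi> Q" by (rule lift_skew[OF p])
  have c: "is_chart (ch (snd ?p))" using ch(2)[OF snd_lift[OF pk]] chart by blast
  have "T ?p (w k) = snd (ch (snd ?p)) (\<phi> (int k) y (fst p)) - zc (snd ?p)"
    unfolding w_def by (rule T_Ti(1)[OF pk])
  then have "stepf ?p (w k) = Ti (nxt ?p) (local_rep (ch (snd ?p)) (ch (snd (nxt ?p))) (\<lambda>y. \<phi> 1 y (fst ?p))
      (snd (ch (snd ?p)) (\<phi> (int k) y (fst p))) - zc (snd (nxt ?p)))"
    by (simp add: stepf_def)
  also have "local_rep (ch (snd ?p)) (ch (snd (nxt ?p))) (\<lambda>y. \<phi> 1 y (fst ?p)) (snd (ch (snd ?p)) (\<phi> (int k) y (fst p)))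
      = snd (ch (snd (nxt ?p))) (\<phi> (int (Suc k)) y (fst p))"
    by (simp only: local_rep_def comp_apply fst_skew phi_Suc inv_chart_chart[OF c y[OF Suc_leD[OF Suc.prems]]])
  finally have "stepf ?p (w k) = w (Suc k)" unfolding w_def nxt_skew .
  then show ?case using Suc.IH[OF Suc_leD[OF Suc.prems]] by (simp only: orbit.simps)
qed (simp only: orbit.simps)

text \<open>The converse passage: for a small coordinate orbit, \<open>step\<close> guarantees at
  each time that the image lies in the next chart domain, so reading coordinates back recovers the
  true orbit.\<close>

lemma point_of_orbit:
  assumes p: "p \<in> lift \<phi> Q"
    and step: "\<And>p w. p \<in> lift \<phi> Q \<Longrightarrow> norm w < r \<Longrightarrow>
      zc (snd p) + T p w \<in> snd (ch (snd p)) ` fst (ch (snd p)) \<and>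
      \<phi> 1 (inv_chart (ch (snd p)) (zc (snd p) + T p w)) (fst p) \<in> fst (ch (snd (nxt p)))"
    and w: "\<And>k. k \<le> n \<Longrightarrow> norm (orbit (\<lambda>k. stepf (skew \<theta> \<phi> (int k) p)) k w) < r"
  defines "y \<equiv> inv_chart (ch (snd p)) (zc (snd p) + T p w)"
  assumes "k \<le> n"
  shows "\<phi> (int k) y (fst p) \<in> fst (ch (snd (skew \<theta> \<phi> (int k) p))) \<and>
    snd (ch (snd (skew \<theta> \<phi> (int k) p))) (\<phi> (int k) y (fst p))
      = zc (snd (skew \<theta> \<phi> (int k) p)) + T (skew \<theta> \<phi> (int k) p) (orbit (\<lambda>k. stepf (skew \<theta> \<phi> (int k) p)) k w)"
  using \<open>k \<le> n\<close>
proof (induction k)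
  case 0
  have c: "is_chart (ch (snd p))" using ch(2)[OF snd_lift[OF p]] chart by blast
  have "zc (snd p) + T p w \<in> snd (ch (snd p)) ` fst (ch (snd p))" using step[OF p, of w] w[of 0] by simp
  then have "y \<in> fst (ch (snd p))" "snd (ch (snd p)) y = zc (snd p) + T p w"
    unfolding y_def by (simp_all only: inv_chart_in[OF c] chart_inv_chart[OF c])
  then show ?case by (simp only: of_nat_0 skew_0 phi_0 orbit.simps simp_thms)
next
  case (Suc k)
  let ?p = "skew \<theta> \<phi> (int k) p" and ?w = "orbit (\<lambda>k. stepf (skew \<theta> \<phi> (int k) p)) k w"
  let ?y = "\<phi> (int k) y (fst p)"
  have pk: "?p \<in> lift \<phi> Q" by (rule lift_skew[OF p])
  have c: "is_chart (ch (snd ?p))" using ch(2)[OF snd_lift[OF pk]] chart by blast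
  have IH: "?y \<in> fst (ch (snd ?p))" "snd (ch (snd ?p)) ?y = zc (snd ?p) + T ?p ?w" using Suc by auto
  have inv: "inv_chart (ch (snd ?p)) (zc (snd ?p) + T ?p ?w) = ?y"
    using inv_chart_chart[OF c IH(1)] IH(2) by simp
  have phi: "\<phi> 1 ?y (fst ?p) = \<phi> (int (Suc k)) y (fst p)" by (simp only: phi_Suc fst_skew)
  have "\<phi> (int (Suc k)) y (fst p) \<in> fst (ch (snd (nxt ?p)))"
    using conjunct2[OF step[OF pk w[OF Suc_leD[OF Suc.prems]]]] unfolding inv phi .
  moreover have "T (nxt ?p) (stepf ?p ?w) = snd (ch (snd (nxt ?p))) (\<phi> (int (Suc k)) y (fst p)) - zc (snd (nxt ?p))"
    unfolding stepf_def T_Ti(1)[OF nxt_lift[OF pk]] local_rep_def comp_apply inv phi ..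
  then have "snd (ch (snd (nxt ?p))) (\<phi> (int (Suc k)) y (fst p)) = zc (snd (nxt ?p)) + T (nxt ?p) (stepf ?p ?w)"
    by simp
  ultimately show ?case unfolding nxt_skew orbit.simps by blast
qed

lemma bowen_ball_iff: "y \<in> bowen_ball \<phi> b n x \<epsilon> \<longleftrightarrow> (\<forall>k\<le>n. dist (\<phi> (int k) x b) (\<phi> (int k) y b) < \<epsilon>)"
  unfolding bowen_ball_def bowen_dist_def by (subst mem_Collect_eq, subst Max_less_iff) auto

lemma open_bowen_ball: "open (bowen_ball \<phi> b n x \<epsilon>)"
proof -
  have "bowen_ball \<phi> b n x \<epsilon> = (\<Inter>k\<in>{..n}. {y. dist (\<phi> (int k) x b) (\<phi> (int k) y b) < \<epsilon>})"
    by (auto simp: bowen_ball_iff)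
  moreover have "open {y. dist (\<phi> (int k) x b) (\<phi> (int k) y b) < \<epsilon>}" for k
    using C2_phi[of "int k" b] by (intro open_Collect_less continuous_intros) (simp add: C2_map_def)
  ultimately show ?thesis by (simp add: open_INT)
qed

lemma volume_bounds:
  assumes vol: "is_riemannian_volume A g vol" and c: "c \<in> A" and X: "open X" "X \<subseteq> fst c"
    and d: "0 < d" "\<And>z. z \<in> snd c ` X \<Longrightarrow> d \<le> density c z \<and> density c z \<le> 1 / d"
  shows "open (snd c ` X)"
    and "emeasure vol X \<le> ennreal (1 / d) * emeasure lborel (snd c ` X)"
    and "ennreal d * emeasure lborel (snd c ` X) \<le> emeasure vol X"
proof -
  have "snd c ` (fst c \<inter> id -` X) = snd c ` X" using X(2) by auto
  then show o: "open (snd c ` X)"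
    using open_chart_preimage[OF chart[OF c] continuous_on_id' X(1)] by (simp add: id_def)
  have e: "emeasure vol X = (\<integral>\<^sup>+z\<in>snd c ` X. ennreal (density c z) \<partial>lborel)"
    using bspec[OF bspec[OF conjunct2[OF vol[unfolded is_riemannian_volume_def]] c], of X] X
    unfolding density_def by simp
  have "emeasure vol X \<le> (\<integral>\<^sup>+z. ennreal (1 / d) * indicator (snd c ` X) z \<partial>lborel)"
    unfolding e using d(2) by (intro nn_integral_mono) (auto simp: indicator_def intro: ennreal_leI)
  also have "\<dots> = ennreal (1 / d) * emeasure lborel (snd c ` X)"
    using o by (intro nn_integral_cmult_indicator) simp
  finally show "emeasure vol X \<le> ennreal (1 / d) * emeasure lborel (snd c ` X)" .
  have "ennreal d * emeasure lborel (snd c ` X) = (\<integral>\<^sup>+z. ennreal d * indicator (snd c ` X) z \<partial>lborel)"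
    using o by (intro nn_integral_cmult_indicator[symmetric]) simp
  also have "\<dots> \<le> emeasure vol X"
    unfolding e using d(2) by (intro nn_integral_mono) (auto simp: indicator_def intro: ennreal_leI)
  finally show "ennreal d * emeasure lborel (snd c ` X) \<le> emeasure vol X" .
qed

theorem bowen_ball_volume:
  assumes vol: "is_riemannian_volume A g vol"
  shows "\<exists>\<epsilon>0>0. \<forall>\<epsilon>. 0 < \<epsilon> \<and> \<epsilon> < \<epsilon>0 \<longrightarrow>
    (\<exists>C\<ge>1. \<forall>(b, x)\<in>lift \<phi> Q. \<forall>n::nat.
       let D = abs_det g x (Ep (b, x)) (\<phi> (int n) x b) (Ep (skew \<theta> \<phi> (int n) (b, x)))
                 (tangent_map A (\<lambda>y. \<phi> (int n) y b) x)
       in ennreal (1 / C) \<le> emeasure vol (bowen_ball \<phi> b n x \<epsilon>) * ennreal D \<and>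
          emeasure vol (bowen_ball \<phi> b n x \<epsilon>) * ennreal D \<le> ennreal C)"
proof -
  obtain K r0 where r0: "0 < r0"
    and step: "\<And>p w. p \<in> lift \<phi> Q \<Longrightarrow> norm w < r0 \<Longrightarrow>
      zc (snd p) + T p w \<in> snd (ch (snd p)) ` fst (ch (snd p)) \<and>
      \<phi> 1 (inv_chart (ch (snd p)) (zc (snd p) + T p w)) (fst p) \<in> fst (ch (snd (nxt p)))"
    and seq: "\<And>r p. 0 < r \<Longrightarrow> r \<le> r0 \<Longrightarrow> p \<in> lift \<phi> Q \<Longrightarrow>
      hyperbolic_sequence I lam K r (\<lambda>k. stepf (skew \<theta> \<phi> (int k) p)) (\<lambda>k. stepA (skew \<theta> \<phi> (int k) p))"
    using step_sequence by blast
  obtain \<kappa> where \<kappa>: "1 \<le> \<kappa>" "\<And>p v. p \<in> lift \<phi> Q \<Longrightarrow> norm (T p v) \<le> \<kappa> * norm v"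
    "\<And>p v. p \<in> lift \<phi> Q \<Longrightarrow> norm v \<le> \<kappa> * norm (T p v)"
    using T_bounds by blast
  obtain d where d: "0 < d" "\<And>x z. x \<in> Q \<Longrightarrow> dist z (zc x) < d \<Longrightarrow> d \<le> density (ch x) z \<and> density (ch x) z \<le> 1 / d"
    using density_close by blast
  define N where "N = CARD('n)"
  define q where "q = (1 - lam) / 2"
  define r1 where "r1 = min r0 d"
  have r1: "0 < r1" "r1 \<le> r0" "r1 \<le> d" using r0 d(1) by (auto simp: r1_def)
  \<comment> \<open>Division by \<open>\<kappa>\<close> compensates for \<open>Ti\<close>: a chart
    distance below \<open>r1 / \<kappa>\<close> becomes an adapted norm below
    \<open>r1\<close>.\<close>
  obtain \<epsilon>0 where \<epsilon>0: "0 < \<epsilon>0" "\<And>x y. x \<in> Q \<Longrightarrow> dist y x < \<epsilon>0 \<Longrightarrow> y \<in> fst (ch x) \<and> dist (snd (ch x) y) (zc x) < r1 / \<kappa>"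
    using chart_close[of "r1 / \<kappa>"] r1 \<kappa>(1) by auto
  have main: "\<exists>C\<ge>1. \<forall>p\<in>lift \<phi> Q. \<forall>n::nat. \<forall>D.
       D = abs_det g (snd p) (Ep p) (\<phi> (int n) (snd p) (fst p)) (Ep (skew \<theta> \<phi> (int n) p))
                 (tangent_map A (\<lambda>y. \<phi> (int n) y (fst p)) (snd p)) \<longrightarrow>
       ennreal (1 / C) \<le> emeasure vol (bowen_ball \<phi> (fst p) n (snd p) \<epsilon>) * ennreal D \<and>
       emeasure vol (bowen_ball \<phi> (fst p) n (snd p) \<epsilon>) * ennreal D \<le> ennreal C"
    if \<epsilon>: "0 < \<epsilon>" "\<epsilon> < \<epsilon>0" for \<epsilon>
  proof -
    obtain \<rho> where \<rho>: "0 < \<rho>" "\<And>x z. x \<in> Q \<Longrightarrow> dist z (zc x) < \<rho> \<Longrightarrow>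
        z \<in> snd (ch x) ` fst (ch x) \<and> dist (inv_chart (ch x) z) x < \<epsilon>"
      using inv_chart_close[OF \<epsilon>(1)] by blast
    \<comment> \<open>Division by \<open>\<kappa>\<close> now compensates for \<open>T\<close>. Only
      \<open>r2\<close> depends on \<epsilon>; the upper constant \<open>U\<close> involves
      \<open>r1\<close> alone, so the dependence of \<open>C\<close> on \<epsilon> enters through
      \<open>L\<close>.\<close>
    define r2 where "r2 = min r1 (\<rho> / \<kappa>)"
    have r2: "0 < r2" "r2 \<le> r0" "r2 \<le> \<rho> / \<kappa>" using r1 \<rho>(1) \<kappa>(1) by (auto simp: r2_def)
    define U where "U = 1 / d * \<kappa> ^ N * 2 ^ N * measure lebesgue (ball (0::real^'n well_ordered) (2 * r1))"
    define L where "L = d * (1 / \<kappa>) ^ N * (1 / 2) ^ N * measure lebesgue (ball (0::real^'n well_ordered) (q * r2 / 4))"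
    have L: "0 < L"
      unfolding L_def using d(1) \<kappa>(1) lam r2(1)
      by (intro mult_pos_pos zero_less_power) (auto simp: q_def content_ball_pos)
    define C where "C = max 1 (max U (1 / L))"
    have C: "1 \<le> C" "U \<le> C" "1 / L \<le> C" by (auto simp: C_def)
    have C': "1 / C \<le> L"
      using C(1,3) L by (simp add: field_simps)
    show ?thesis
    proof (rule exI[of _ C], intro conjI C(1) ballI allI impI)
      fix p :: "'b \<times> 'm" and n :: nat and D :: real
      assume p: "p \<in> lift \<phi> Q" and D: "D = abs_det g (snd p) (Ep p) (\<phi> (int n) (snd p) (fst p)) (Ep (skew \<theta> \<phi> (int n) p))
                 (tangent_map A (\<lambda>y. \<phi> (int n) y (fst p)) (snd p))"
      let ?f = "\<lambda>k. stepf (skew \<theta> \<phi> (int k) p)" and ?A = "\<lambda>k. stepA (skew \<theta> \<phi> (int k) p)"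
      let ?c = "ch (snd p)" and ?B = "bowen_ball \<phi> (fst p) n (snd p) \<epsilon>"
      let ?\<tau> = "\<lambda>w. zc (snd p) + T p w"
      \<comment> \<open>The same step maps with two radii: \<open>h1\<close> bounds the Bowen ball
        from outside, \<open>h2\<close> from inside. Both derivatives of the mixed coordinates at
        \<open>0\<close> have determinant \<open>D\<close> in absolute value.\<close>
      interpret h1: hyperbolic_sequence I lam K r1 ?f ?A by (rule seq[OF r1(1,2) p])
      interpret h2: hyperbolic_sequence I lam K r2 ?f ?A by (rule seq[OF r2(1,2) p])
      have D1: "D = \<bar>Determinants.det (matrix (h1.dmixed n 0))\<bar>"
        unfolding D by (rule det_dmixed[OF p h1.hyperbolic_sequence_axioms, symmetric])
      have D2: "D = \<bar>Determinants.det (matrix (h2.dmixed n 0))\<bar>"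
        unfolding D by (rule det_dmixed[OF p h2.hyperbolic_sequence_axioms, symmetric])
      have D0: "0 \<le> D" by (simp add: D1)
      have pk: "snd (skew \<theta> \<phi> (int k) p) \<in> Q" for k by (rule snd_lift[OF lift_skew[OF p]])
      have c: "?c \<in> A" "is_chart ?c" using ch(2)[OF snd_lift[OF p]] chart by auto
      have close: "\<phi> (int k) y (fst p) \<in> fst (ch (snd (skew \<theta> \<phi> (int k) p))) \<and>
          dist (snd (ch (snd (skew \<theta> \<phi> (int k) p))) (\<phi> (int k) y (fst p))) (zc (snd (skew \<theta> \<phi> (int k) p))) < r1 / \<kappa>"
        if "y \<in> ?B" "k \<le> n" for y k
        using that \<epsilon>(2) by (intro \<epsilon>0(2) pk) (force simp: bowen_ball_iff snd_skew dist_commute)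
      have B_dom: "?B \<subseteq> fst ?c" using close[of _ 0] by (auto simp: skew_0)
      have dens: "d \<le> density ?c z \<and> density ?c z \<le> 1 / d" if "z \<in> snd ?c ` ?B" for z
      proof (rule d(2)[OF snd_lift[OF p]])
        have "r1 / \<kappa> \<le> r1" using r1(1) \<kappa>(1) by (simp add: divide_le_eq)
        then show "dist z (zc (snd p)) < d"
          using that close[of _ 0] r1(3) by (force simp: skew_0)
      qed
      note vb = volume_bounds[OF vol c(1) open_bowen_ball B_dom d(1) dens]
      have sub1: "snd ?c ` ?B \<subseteq> ?\<tau> ` h1.W n"
      proof
        fix z assume "z \<in> snd ?c ` ?B"
        then obtain y where y: "y \<in> ?B" "z = snd ?c y" by blast
        define w where "w = (\<lambda>k. Ti (skew \<theta> \<phi> (int k) p)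
          (snd (ch (snd (skew \<theta> \<phi> (int k) p))) (\<phi> (int k) y (fst p)) - zc (snd (skew \<theta> \<phi> (int k) p))))"
        have "norm (orbit ?f k (w 0)) < r1" if "k \<le> n" for k
        proof -
          have "orbit ?f k (w 0) = w k"
            unfolding w_def by (rule orbit_of_point[OF p _ that]) (use close[OF y(1)] in blast)
          moreover have "norm (w k) \<le> \<kappa> * norm (T (skew \<theta> \<phi> (int k) p) (w k))"
            by (rule \<kappa>(3)[OF lift_skew[OF p]])
          moreover have "norm (T (skew \<theta> \<phi> (int k) p) (w k)) < r1 / \<kappa>"
            unfolding w_def T_Ti(1)[OF lift_skew[OF p]] using close[OF y(1) that] by (simp add: dist_norm)
          then have "\<kappa> * norm (T (skew \<theta> \<phi> (int k) p) (w k)) < \<kappa> * (r1 / \<kappa>)"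
            using \<kappa>(1) by (intro mult_strict_left_mono) auto
          ultimately show ?thesis using \<kappa>(1) by simp
        qed
        then have "w 0 \<in> h1.W n" by (simp add: h1.W_def)
        moreover have "?\<tau> (w 0) = z" by (simp add: w_def skew_0 T_Ti(1)[OF p] y)
        ultimately show "z \<in> ?\<tau> ` h1.W n" by blast
      qed
      have sub2: "?\<tau> ` h2.W n \<subseteq> snd ?c ` ?B"
      proof
        fix z assume "z \<in> ?\<tau> ` h2.W n"
        then obtain w where w: "\<And>k. k \<le> n \<Longrightarrow> norm (orbit ?f k w) < r2" "z = ?\<tau> w"
          by (auto simp: h2.W_def)
        define y where "y = inv_chart ?c (?\<tau> w)"
        have yk: "\<phi> (int k) y (fst p) \<in> fst (ch (snd (skew \<theta> \<phi> (int k) p))) \<and>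
          snd (ch (snd (skew \<theta> \<phi> (int k) p))) (\<phi> (int k) y (fst p))
            = zc (snd (skew \<theta> \<phi> (int k) p)) + T (skew \<theta> \<phi> (int k) p) (orbit ?f k w)" if "k \<le> n" for k
          unfolding y_def by (rule point_of_orbit[OF p step _ that]) (use w(1) r2(2) in force)+
        have "dist (\<phi> (int k) y (fst p)) (snd (skew \<theta> \<phi> (int k) p)) < \<epsilon>" if k: "k \<le> n" for k
        proof -
          let ?p = "skew \<theta> \<phi> (int k) p"
          have "\<kappa> * norm (orbit ?f k w) < \<kappa> * (\<rho> / \<kappa>)"
            using w(1)[OF k] r2(3) \<kappa>(1) by (intro mult_strict_left_mono) auto
          then have "norm (T ?p (orbit ?f k w)) < \<rho>"
            using \<kappa>(2)[OF lift_skew[OF p], of "int k" "orbit ?f k w"] \<kappa>(1) by simp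
          then have "dist (snd (ch (snd ?p)) (\<phi> (int k) y (fst p))) (zc (snd ?p)) < \<rho>"
            using yk[OF k] by (simp add: dist_norm)
          then have "dist (inv_chart (ch (snd ?p)) (snd (ch (snd ?p)) (\<phi> (int k) y (fst p)))) (snd ?p) < \<epsilon>"
            using \<rho>(2)[OF pk] by blast
          then show ?thesis
            unfolding inv_chart_chart[OF chart[OF ch(2)[OF pk]] conjunct1[OF yk[OF k]]] .
        qed
        then have "y \<in> ?B" by (simp add: bowen_ball_iff snd_skew dist_commute)
        moreover have "snd ?c y = z" using yk[of 0] w(2) by (simp add: skew_0)
        ultimately show "z \<in> snd ?c ` ?B" by blast
      qed
      have bW: "bounded (h1.W n)" "bounded (h2.W n)"
        by (rule bounded_subset[OF bounded_ball[of 0 r1]], force simp: h1.W_def)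
          (rule bounded_subset[OF bounded_ball[of 0 r2]], force simp: h2.W_def)
      note a1 = affine_image_measure[OF linear_T[OF p] \<kappa>(1) \<kappa>(2,3)[OF p] h1.open_W bW(1), where z = "zc (snd p)"]
      note a2 = affine_image_measure[OF linear_T[OF p] \<kappa>(1) \<kappa>(2,3)[OF p] h2.open_W bW(2), where z = "zc (snd p)"]
      have "emeasure vol ?B \<le> ennreal (1 / d) * ennreal (\<kappa> ^ N * measure lebesgue (h1.W n))"
      proof -
        have "emeasure lborel (snd ?c ` ?B) \<le> emeasure lborel (?\<tau> ` h1.W n)"
          using a1(1) by (intro emeasure_mono sub1) simp
        also note a1(2)
        finally have "ennreal (1 / d) * emeasure lborel (snd ?c ` ?B)
            \<le> ennreal (1 / d) * ennreal (\<kappa> ^ N * measure lebesgue (h1.W n))"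
          unfolding N_def by (intro mult_left_mono) auto
        with vb(2) show ?thesis by (rule order_trans)
      qed
      then have "emeasure vol ?B * ennreal D \<le> ennreal (1 / d) * ennreal (\<kappa> ^ N * measure lebesgue (h1.W n)) * ennreal D"
        by (rule mult_right_mono) simp
      also have "\<dots> = ennreal (1 / d * \<kappa> ^ N * (D * measure lebesgue (h1.W n)))"
        using d(1) \<kappa>(1) D0 by (simp add: ennreal_mult[symmetric] mult_ac)
      also have "\<dots> \<le> ennreal U"
      proof (rule ennreal_leI)
        have "D * measure lebesgue (h1.W n) \<le> 2 ^ N * measure lebesgue (ball (0::real^'n well_ordered) (2 * r1))"
          using h1.measure_W(2)[of n] by (simp add: D1[symmetric] N_def card_well_ordered power_divide field_simps)
        then have "1 / d * \<kappa> ^ N * (D * measure lebesgue (h1.W n))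
            \<le> 1 / d * \<kappa> ^ N * (2 ^ N * measure lebesgue (ball (0::real^'n well_ordered) (2 * r1)))"
          using d(1) \<kappa>(1) by (intro mult_left_mono) auto
        then show "1 / d * \<kappa> ^ N * (D * measure lebesgue (h1.W n)) \<le> U" by (simp add: U_def mult.assoc)
      qed
      also have "\<dots> \<le> ennreal C" by (rule ennreal_leI[OF C(2)])
      finally show "emeasure vol ?B * ennreal D \<le> ennreal C" .
      have "ennreal (1 / C) \<le> ennreal L" by (rule ennreal_leI[OF C'])
      also have "\<dots> \<le> ennreal (d * (1 / \<kappa>) ^ N * (D * measure lebesgue (h2.W n)))"
      proof (rule ennreal_leI)
        have "(1 / 2) ^ N * measure lebesgue (ball (0::real^'n well_ordered) (q * r2 / 4)) \<le> D * measure lebesgue (h2.W n)"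
          using h2.measure_W(1)[of n]
          by (simp add: D2[symmetric] N_def q_def h2.q_def card_well_ordered power_divide field_simps)
        then have "d * (1 / \<kappa>) ^ N * ((1 / 2) ^ N * measure lebesgue (ball (0::real^'n well_ordered) (q * r2 / 4)))
            \<le> d * (1 / \<kappa>) ^ N * (D * measure lebesgue (h2.W n))"
          using d(1) \<kappa>(1) by (intro mult_left_mono) auto
        then show "L \<le> d * (1 / \<kappa>) ^ N * (D * measure lebesgue (h2.W n))" by (simp add: L_def mult.assoc)
      qed
      also have "\<dots> = ennreal d * ennreal ((1 / \<kappa>) ^ N * measure lebesgue (h2.W n)) * ennreal D"
        using d(1) \<kappa>(1) D0 by (simp add: ennreal_mult[symmetric] mult_ac)
      also have "\<dots> \<le> emeasure vol ?B * ennreal D"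
      proof (rule mult_right_mono)
        note a2(3)
        also have "emeasure lborel (?\<tau> ` h2.W n) \<le> emeasure lborel (snd ?c ` ?B)"
          using vb(1) by (intro emeasure_mono sub2) simp
        finally have "ennreal d * ennreal ((1 / \<kappa>) ^ N * measure lebesgue (h2.W n))
            \<le> ennreal d * emeasure lborel (snd ?c ` ?B)"
          unfolding N_def by (intro mult_left_mono) auto
        then show "ennreal d * ennreal ((1 / \<kappa>) ^ N * measure lebesgue (h2.W n)) \<le> emeasure vol ?B"
          using vb(3) by (rule order_trans)
      qed simp
      finally show "ennreal (1 / C) \<le> emeasure vol ?B * ennreal D" .
    qed
  qed
  show ?thesis
  proof (rule exI[of _ \<epsilon>0], intro conjI \<epsilon>0(1) allI impI)
    fix \<epsilon> :: real assume "0 < \<epsilon> \<and> \<epsilon> < \<epsilon>0"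
    then obtain C where C: "C \<ge> 1" and *: "\<And>p n D. p \<in> lift \<phi> Q \<Longrightarrow>
       D = abs_det g (snd p) (Ep p) (\<phi> (int n) (snd p) (fst p)) (Ep (skew \<theta> \<phi> (int n) p))
                 (tangent_map A (\<lambda>y. \<phi> (int n) y (fst p)) (snd p)) \<Longrightarrow>
       ennreal (1 / C) \<le> emeasure vol (bowen_ball \<phi> (fst p) n (snd p) \<epsilon>) * ennreal D \<and>
       emeasure vol (bowen_ball \<phi> (fst p) n (snd p) \<epsilon>) * ennreal D \<le> ennreal C"
      using main[of \<epsilon>] by blast
    show "\<exists>C\<ge>1. \<forall>(b, x)\<in>lift \<phi> Q. \<forall>n::nat.
       let D = abs_det g x (Ep (b, x)) (\<phi> (int n) x b) (Ep (skew \<theta> \<phi> (int n) (b, x)))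
                 (tangent_map A (\<lambda>y. \<phi> (int n) y b) x)
       in ennreal (1 / C) \<le> emeasure vol (bowen_ball \<phi> b n x \<epsilon>) * ennreal D \<and>
          emeasure vol (bowen_ball \<phi> b n x \<epsilon>) * ennreal D \<le> ennreal C"
      unfolding Let_def
    proof (rule exI[of _ C], intro conjI C, clarify)
      fix b x n assume p: "(b, x) \<in> lift \<phi> Q"
      show "ennreal (1 / C) \<le> emeasure vol (bowen_ball \<phi> b n x \<epsilon>) *
          ennreal (abs_det g x (Ep (b, x)) (\<phi> (int n) x b) (Ep (skew \<theta> \<phi> (int n) (b, x)))
                 (tangent_map A (\<lambda>y. \<phi> (int n) y b) x)) \<and>
        emeasure vol (bowen_ball \<phi> b n x \<epsilon>) *
          ennreal (abs_det g x (Ep (b, x)) (\<phi> (int n) x b) (Ep (skew \<theta> \<phi> (int n) (b, x)))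
                 (tangent_map A (\<lambda>y. \<phi> (int n) y b) x)) \<le> ennreal C"
        using *[OF p, unfolded fst_conv snd_conv, OF refl] .
    qed
  qed
qed

end

theorem mainTheorem4:
  fixes A :: "('m::{metric_space, second_countable_topology}, 'n::finite) chart set"
    and g :: "('m, 'n) metric_tensor"
    and vol :: "'m measure"
    and \<theta> :: "'b::metric_space \<Rightarrow> 'b"
    and \<phi> :: "int \<Rightarrow> 'm \<Rightarrow> 'b \<Rightarrow> 'm"
    and Q :: "'m set"
    and Em Ep :: "'b \<times> 'm \<Rightarrow> (real^'n) set"
    and c lam :: real
  assumes "compact (UNIV :: 'b set)"
    and "riemannian_manifold A g"
    and "is_riemannian_volume A g vol"
    and "skew_product A \<theta> \<phi>"
    and "compact Q"
    and "\<forall>x\<in>Q. \<exists>b. range (\<lambda>k. \<phi> k x b) \<subseteq> Q"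
    and "hyperbolic_splitting A g \<theta> \<phi> (lift \<phi> Q) Em Ep c lam"
    and "\<exists>d. \<forall>p\<in>lift \<phi> Q. dim (Em p) = d"
    and "\<exists>d. \<forall>p\<in>lift \<phi> Q. dim (Ep p) = d"
    and "c = 1"
  shows "\<exists>\<epsilon>0>0. \<forall>\<epsilon>. 0 < \<epsilon> \<and> \<epsilon> < \<epsilon>0 \<longrightarrow>
    (\<exists>C\<ge>1. \<forall>(b, x)\<in>lift \<phi> Q. \<forall>n::nat.
       let D = abs_det g x (Ep (b, x)) (\<phi> (int n) x b) (Ep (skew \<theta> \<phi> (int n) (b, x)))
                 (tangent_map A (\<lambda>y. \<phi> (int n) y b) x)
       in ennreal (1 / C) \<le> emeasure vol (bowen_ball \<phi> b n x \<epsilon>) * ennreal D \<and>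
          emeasure vol (bowen_ball \<phi> b n x \<epsilon>) * ennreal D \<le> ennreal C)"
proof (cases "lift \<phi> Q = {}")
  \<comment> \<open>Over an empty lift the claim is vacuous, but \<open>dp\<close> would be
    arbitrary and an index set with \<open>dp\<close> elements might not exist.\<close>
  case True
  then show ?thesis by (intro exI[of _ 1]) auto
next
  case False
  obtain dp where dp: "\<And>p. p \<in> lift \<phi> Q \<Longrightarrow> dim (Ep p) = dp" using assms(9) by blast
  interpret hyperbolic_skew_product A g \<theta> \<phi> Q Em Ep lam dp
    by unfold_locales (use assms dp in \<open>auto simp: riemannian_manifold_def\<close>)
  have dp_le: "dp \<le> CARD('n)" using False dim_Em by fastforce
  then obtain I :: "'n well_ordered set" where I: "card I = dp"
    using obtain_subset_with_card_n[of dp "UNIV :: 'n well_ordered set"] by (auto simp: card_well_ordered)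
  obtain hp where hp: "bij_betw hp I {0..<dp}"
    using ex_bij_betw_finite_nat[of I] I by auto
  have "card (- I) = CARD('n) - dp"
    using card_Diff_subset[of I UNIV] I by (simp add: card_well_ordered Compl_eq_Diff_UNIV)
  then obtain hm where hm: "bij_betw hm (- I) {0..<CARD('n) - dp}"
    using ex_bij_betw_finite_nat[of "- I"] by auto
  obtain X where X: "X \<subseteq> Q" "finite X" "Q \<subseteq> (\<Union>x\<in>X. fst (chart_at A x))"
    using compactE_image[OF compact_Q, of Q "\<lambda>x. fst (chart_at A x)"] chart_at open_chart_dom[OF chart] by blast
  define F where "F = chart_at A ` X"
  have "Q \<subseteq> \<Union>(fst ` F)" "\<And>G. G \<in> fst ` F \<Longrightarrow> open G"
    using X(3) open_chart_dom[OF chart[OF chart_at(1)]] unfolding F_def by blast+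
  \<comment> \<open>A Lebesgue number of the finite cover of \<open>Q\<close> by chart
    domains.\<close>
  then obtain \<delta> where \<delta>: "0 < \<delta>" "\<And>x. x \<in> Q \<Longrightarrow> \<exists>G\<in>fst ` F. ball x \<delta> \<subseteq> G"
    using Heine_Borel_lemma[OF compact_Q, of "fst ` F"] by metis
  interpret hyperbolic_frames A g \<theta> \<phi> Q Em Ep lam dp F \<delta> I hp hm
    by unfold_locales (use X(2) \<delta> hp hm chart_at in \<open>auto simp: F_def\<close>)
  show ?thesis by (rule bowen_ball_volume[OF assms(3)])
qed

end
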